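(* Let $X_P\subseteq\mathbb P(V)$ be the embedded toric variety associated with a full dimensional normal lattice polytope $P$, and denote by $A$ the set of faces of $P$. Let $X_\sigma$, $\sigma\in A$, be the collection of $T$-orbit closures in $X_P$ and let $f_\sigma\in\mathbb K[\hat X_P]$, $\sigma\in A$, be a collection of $\hat T$-eigenfunctions of degree $\deg f_\sigma\ge1$. Denote by $\mu_\sigma$ the $\hat T$-weight of $f_\sigma$. The following are equivalent: (a) The collection $(X_\sigma,f_\sigma)_{\sigma\in A}$ of subvarieties and homogeneous functions defines a Seshadri stratification on $X_P$ which is $T$-equivariant. (b) The collection $(X_\sigma,f_\sigma)_{\sigma\in A}$ of subvarieties and homogeneous functions defines a combinatorial Seshadri stratification on $X_P$.
   Context: Toric variety. $\mathbb K$ is an algebraically closed field of characteristic zero, $T\simeq(\mathbb K^* )^n$ is a torus with character lattice $M$, $M_{\mathbb R}=M\otimes_{\mathbb Z}\mathbb R$. $P\subseteq M_{\mathbb R}$ is a full dimensional normal lattice polytope, $\Lambda=P\cap M$, $V=\mathbb K^\Lambda$ with standard basis $\{e_\chi\}_{\chi\in\Lambda}$ and dual coordinates $x_\chi$. $X_P\subseteq\mathbb P(V)$ is the Zariski closure of the image of $T\to\mathbb P(V)$, $t\mapsto[\sum_{\chi\in\Lambda}\chi(t)e_\chi]$; $\hat X_P\subseteq V$ is its affine cone and $\mathbb K[\hat X_P]$ the coordinate ring of the cone (the homogeneous coordinate ring of $X_P$), graded by degree. $\hat T=\mathbb K^*\times T$, with character lattice $\hat M=\mathbb Z\oplus M$,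 acts on $V$ by $(c,t)\cdot e_\chi=c\chi(t)e_\chi$ and on functions by $(\hat t\cdot g)(x)=g(\hat t^{-1}x)$; so $x_\chi|_{\hat X_P}$ has weight $(-1,-\chi)$. A (nonzero) $\hat T$-eigenfunction $g$ is homogeneous and its weight $\lambda_g$ has first entry $-\deg g$. $M_{\mathbb R}$ is identified with $\{1\}\times M_{\mathbb R}\subset\mathbb R\oplus M_{\mathbb R}$. $A$ is the set of (nonempty) faces of $P$, including $P$, ordered by inclusion; $\sigma^o$ is the relative interior of $\sigma$; $X_\sigma$ is the Zariski closure of the $T$-orbit $\{[\sum_{\chi\in\Lambda\cap\sigma}\chi(t)e_\chi]\mid t\in T\}$; one has $X_\tau\subseteq X_\sigma$ iff $\tau\subseteq\sigma$. Combinatorial Seshadri stratification: each $f_\sigma$ is a $\hat T$-eigenfunction with $\deg f_\sigma\ge1$ and $\frac{-\mu_\sigma}{\deg f_\sigma}\in\sigma^o$ for all $\sigma\in A$. Seshadri stratification (in the sense of Chiriv\`i–Fang–Littelmann): for an embedded projective variety $X\subseteq\mathbb P(V)$, a finite collection of projective subvarieties $X_p\subseteq X$ and homogeneous functions $f_p$ of positive degree in the homogeneous coordinate ring of $X$, $p\in A$, where $A$ is a poset via $p\ge q\iff X_p\supseteq X_q$ and has a unique maximal element $p_{\max}$, with $X_{p_{\max}}=X$, is a Seshadri stratification if: (S1) all $X_p$ are smooth in codimension one, and if $q<p$ is a covering relation in $A$ then $X_q$ is of codimension one in $X_p$; (S2) if $q\not\le p$, then $f_q$ vanishes on $X_p$;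 (S3) for $p\in A$, set-theoretically $\{[v]\in\mathbb P(V)\mid f_p(v)=0\}\cap X_p=\bigcup_{q\text{ covered by }p}X_q$. A Seshadri stratification on $X_P$ is $T$-equivariant if (E1) its collection of subvarieties consists of the $T$-orbit closures $X_\sigma$, $\sigma\in A$, and (E2) its functions $f_\sigma$, $\sigma\in A$, are homogeneous $T$-eigenfunctions. *)

theory Defs
  imports
    "HOL-Analysis.Analysis"
    "HOL-Computational_Algebra.Polynomial"
    "HOL-Library.Poly_Mapping"
    "HOL-Library.Function_Algebras"
    "HOL-Library.Extended_Nat"
begin

section \<open>Polynomials in a set of variables\<close>

text \<open>
  A polynomial is a finitely supported map from monomials to coefficients, and a monomial is a
  finitely supported map from variables to exponents.
\<close>

type_synonym ('v, 'a) mpoly = "('v \<Rightarrow>\<^sub>0 nat) \<Rightarrow>\<^sub>0 'a"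

definition polys_over :: "'v set \<Rightarrow> ('v, 'a::zero) mpoly set" where
  "polys_over S = {p. \<forall>m \<in> Poly_Mapping.keys p. Poly_Mapping.keys m \<subseteq> S}"

definition peval :: "('v, 'a::comm_ring_1) mpoly \<Rightarrow> ('v \<Rightarrow> 'a) \<Rightarrow> 'a" where
  "peval p x = (\<Sum>m \<in> Poly_Mapping.keys p. Poly_Mapping.lookup p m *
                  (\<Prod>v \<in> Poly_Mapping.keys m. x v ^ Poly_Mapping.lookup m v))"

definition homogeneous :: "nat \<Rightarrow> ('v, 'a::zero) mpoly \<Rightarrow> bool" where
  "homogeneous d p \<longleftrightarrow>
     (\<forall>m \<in> Poly_Mapping.keys p. (\<Sum>v \<in> Poly_Mapping.keys m. Poly_Mapping.lookup m v) = d)"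

text \<open>
  The differential of \<open>p\<close> at \<open>x\<close> applied to \<open>w\<close>: the coefficient of \<open>t\<close> in
  \<open>p (x + t w)\<close>, computed in the polynomial ring in one variable \<open>t\<close>.
\<close>

definition differential ::
    "('v, 'a::comm_ring_1) mpoly \<Rightarrow> ('v \<Rightarrow> 'a) \<Rightarrow> ('v \<Rightarrow> 'a) \<Rightarrow> 'a" where
  "differential p x w =
     coeff (peval (Poly_Mapping.map (\<lambda>c. [:c:]) p) (\<lambda>v. [:x v, w v:])) 1"


section \<open>Projective space and its Zariski topology\<close>

text \<open>
  The vector space with coordinates indexed by \<open>S\<close> is realised as the functions supported in
  \<open>S\<close>. A point of its projective space is an equivalence class of nonzero vectors up to nonzero
  scalars.
\<close>

definition coord_space :: "'v set \<Rightarrow> ('v \<Rightarrow> 'k::field) set" where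
  "coord_space S = {x. \<forall>v. v \<notin> S \<longrightarrow> x v = 0}"

definition proj_point :: "('v \<Rightarrow> 'k::field) \<Rightarrow> ('v \<Rightarrow> 'k) set" where
  "proj_point x = {\<lambda>v. c * x v | c. c \<noteq> 0}"

definition proj_space :: "'v set \<Rightarrow> ('v \<Rightarrow> 'k::field) set set" where
  "proj_space S = proj_point ` (coord_space S - {\<lambda>_. 0})"

text \<open>
  The nonvanishing loci of homogeneous polynomials form a basis of the Zariski topology.
\<close>

definition zariski :: "'v set \<Rightarrow> ('v \<Rightarrow> 'k::field) set topology" where
  "zariski S = topology_generated_by
     {{L \<in> proj_space S. \<forall>x \<in> L. peval p x \<noteq> 0} | p d. p \<in> polys_over S \<and> homogeneous d p}"

definition affine_cone :: "('v \<Rightarrow> 'k::field) set set \<Rightarrow> ('v \<Rightarrow> 'k) set" where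
  "affine_cone Y = insert (\<lambda>_. 0) (\<Union> Y)"

definition irreducible_in :: "'p topology \<Rightarrow> 'p set \<Rightarrow> bool" where
  "irreducible_in T Y \<longleftrightarrow> Y \<subseteq> topspace T \<and> Y \<noteq> {} \<and>
     (\<forall>C D. closedin T C \<and> closedin T D \<and> Y \<subseteq> C \<union> D \<longrightarrow> Y \<subseteq> C \<or> Y \<subseteq> D)"

definition irr_closed :: "'p topology \<Rightarrow> 'p set \<Rightarrow> bool" where
  "irr_closed T Y \<longleftrightarrow> closedin T Y \<and> irreducible_in T Y"

definition irr_chain :: "'p topology \<Rightarrow> nat \<Rightarrow> (nat \<Rightarrow> 'p set) \<Rightarrow> bool" where
  "irr_chain T k Z \<longleftrightarrow> (\<forall>i\<le>k. irr_closed T (Z i)) \<and> (\<forall>i<k. Z i \<subset> Z (Suc i))"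

definition krull_dim :: "'p topology \<Rightarrow> 'p set \<Rightarrow> enat" where
  "krull_dim T Y = (SUP k \<in> {k. \<exists>Z. irr_chain T k Z \<and> Z k \<subseteq> Y}. enat k)"

text \<open>
  Codimension of a closed subset \<open>Y\<close> in an irreducible closed set \<open>X\<close>. The infimum over the
  irreducible closed subsets of \<open>Y\<close> makes this meaningful for reducible \<open>Y\<close>; the empty set
  has codimension \<open>\<infinity>\<close>.
\<close>

definition codim :: "'p topology \<Rightarrow> 'p set \<Rightarrow> 'p set \<Rightarrow> enat" where
  "codim T X Y =
     (INF W \<in> {W. irr_closed T W \<and> W \<subseteq> Y}.
        SUP k \<in> {k. \<exists>Z. irr_chain T k Z \<and> Z 0 = W \<and> Z k = X}. enat k)"

definition subvariety :: "'v set \<Rightarrow> ('v \<Rightarrow> 'k::field) set set \<Rightarrow> bool" where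
  "subvariety S Y \<longleftrightarrow> irr_closed (zariski S) Y"


section \<open>Smoothness in codimension one\<close>

definition cone_tangent_space ::
    "'v set \<Rightarrow> ('v \<Rightarrow> 'k::field) set set \<Rightarrow> ('v \<Rightarrow> 'k) \<Rightarrow> ('v \<Rightarrow> 'k) set" where
  "cone_tangent_space S Y x =
     {w \<in> coord_space S.
        \<forall>p \<in> polys_over S. (\<forall>y \<in> affine_cone Y. peval p y = 0) \<longrightarrow> differential p x w = 0}"

text \<open>
  Jacobian criterion: \<open>[x]\<close> is a smooth point of the variety \<open>Y\<close> iff the Zariski tangent space
  of the affine cone at \<open>x\<close> has the dimension of the cone, which is \<open>dim Y + 1\<close>.
\<close>

definition smooth_point :: "'v set \<Rightarrow> ('v \<Rightarrow> 'k::field) set set \<Rightarrow> ('v \<Rightarrow> 'k) set \<Rightarrow> bool" where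
  "smooth_point S Y L \<longleftrightarrow>
     (\<forall>x \<in> L. enat (vector_space.dim (\<lambda>(c::'k) w v. c * w v) (cone_tangent_space S Y x))
               = krull_dim (zariski S) Y + 1)"

definition smooth_in_codim_one :: "'v set \<Rightarrow> ('v \<Rightarrow> 'k::field) set set \<Rightarrow> bool" where
  "smooth_in_codim_one S Y \<longleftrightarrow> codim (zariski S) Y {L \<in> Y. \<not> smooth_point S Y L} \<ge> 2"


section \<open>Homogeneous coordinate ring\<close>

text \<open>
  Over an infinite field the coordinate ring of a (reduced) affine variety is its ring of polynomial
  functions. Elements are extensional functions on the cone.
\<close>

definition coord_ring :: "'v set \<Rightarrow> ('v \<Rightarrow> 'k::field) set set \<Rightarrow> (('v \<Rightarrow> 'k) \<Rightarrow> 'k) set" where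
  "coord_ring S X = {restrict (peval p) (affine_cone X) | p. p \<in> polys_over S}"

definition homogeneous_fun ::
    "'v set \<Rightarrow> ('v \<Rightarrow> 'k::field) set set \<Rightarrow> nat \<Rightarrow> (('v \<Rightarrow> 'k) \<Rightarrow> 'k) \<Rightarrow> bool" where
  "homogeneous_fun S X d g \<longleftrightarrow>
     (\<exists>p \<in> polys_over S. homogeneous d p \<and> g = restrict (peval p) (affine_cone X))"

text \<open>Meaningful for nonzero homogeneous \<open>g\<close> only, where \<open>d\<close> is unique.\<close>

definition fun_degree ::
    "'v set \<Rightarrow> ('v \<Rightarrow> 'k::field) set set \<Rightarrow> (('v \<Rightarrow> 'k) \<Rightarrow> 'k) \<Rightarrow> nat" where
  "fun_degree S X g = (THE d. homogeneous_fun S X d g)"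


section \<open>Seshadri stratifications\<close>

definition covered_in :: "'i set \<Rightarrow> ('i \<Rightarrow> 'p set) \<Rightarrow> 'i \<Rightarrow> 'i \<Rightarrow> bool" where
  "covered_in I Xs q p \<longleftrightarrow> q \<in> I \<and> p \<in> I \<and> Xs q \<subset> Xs p \<and>
     \<not> (\<exists>r \<in> I. Xs q \<subset> Xs r \<and> Xs r \<subset> Xs p)"

text \<open>
  The index set is ordered by inclusion of the subvarieties; this is a partial order exactly if
  \<open>Xs\<close> is injective on \<open>I\<close>.
\<close>

definition seshadri_stratification ::
    "'v set \<Rightarrow> ('v \<Rightarrow> 'k::field) set set \<Rightarrow> 'i set \<Rightarrow> ('i \<Rightarrow> ('v \<Rightarrow> 'k) set set)
       \<Rightarrow> ('i \<Rightarrow> ('v \<Rightarrow> 'k) \<Rightarrow> 'k) \<Rightarrow> bool" where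
  "seshadri_stratification S X I Xs fs \<longleftrightarrow>
     subvariety S X \<and> finite I \<and> inj_on Xs I \<and>
     (\<forall>p \<in> I. subvariety S (Xs p) \<and> Xs p \<subseteq> X) \<and>
     (\<forall>p \<in> I. \<exists>d \<ge> 1. homogeneous_fun S X d (fs p)) \<and>
     (\<exists>pmax \<in> I. (\<forall>p \<in> I. (\<forall>q \<in> I. \<not> Xs p \<subset> Xs q) \<longleftrightarrow> p = pmax) \<and> Xs pmax = X) \<and>
     \<comment> \<open>(S1)\<close>
     (\<forall>p \<in> I. smooth_in_codim_one S (Xs p)) \<and>
     (\<forall>p \<in> I. \<forall>q \<in> I. covered_in I Xs q p \<longrightarrow> codim (zariski S) (Xs p) (Xs q) = 1) \<and>
     \<comment> \<open>(S2)\<close>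
     (\<forall>p \<in> I. \<forall>q \<in> I. \<not> Xs q \<subseteq> Xs p \<longrightarrow> (\<forall>x \<in> affine_cone (Xs p). fs q x = 0)) \<and>
     \<comment> \<open>(S3)\<close>
     (\<forall>p \<in> I. {L \<in> Xs p. \<forall>x \<in> L. fs p x = 0} = (\<Union>q \<in> {q. covered_in I Xs q p}. Xs q))"


section \<open>Lattice polytopes\<close>

text \<open>The character lattice \<open>M\<close> of the torus is \<open>int ^ 'n\<close>, and \<open>real ^ 'n\<close> is its real span.\<close>

definition lattice_vec :: "int ^ 'n \<Rightarrow> real ^ 'n" where
  "lattice_vec \<omega> = (\<chi> i. of_int (\<omega> $ i))"

definition lattice_points :: "(real ^ 'n) set \<Rightarrow> (int ^ 'n) set" where
  "lattice_points P = {\<omega>. lattice_vec \<omega> \<in> P}"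

definition lattice_polytope :: "(real ^ 'n::finite) set \<Rightarrow> bool" where
  "lattice_polytope P \<longleftrightarrow> (\<exists>F. finite F \<and> P = convex hull (lattice_vec ` F))"

definition normal_polytope :: "(real ^ 'n::finite) set \<Rightarrow> bool" where
  "normal_polytope P \<longleftrightarrow>
     (\<forall>k::nat. k \<ge> 1 \<longrightarrow> (\<forall>\<omega> \<in> lattice_points ((*\<^sub>R) (real k) ` P).
        \<exists>\<psi>. (\<forall>i<k. \<psi> i \<in> lattice_points P) \<and> \<omega> = (\<Sum>i<k. \<psi> i)))"

definition faces :: "(real ^ 'n::finite) set \<Rightarrow> (real ^ 'n) set set" where
  "faces P = {\<sigma>. \<sigma> face_of P \<and> \<sigma> \<noteq> {}}"


section \<open>The embedded toric variety of a polytope\<close>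

definition torus :: "('k::field ^ 'n) set" where
  "torus = {t. \<forall>i. t $ i \<noteq> 0}"

definition character :: "int ^ 'n \<Rightarrow> 'k::field ^ 'n::finite \<Rightarrow> 'k" where
  "character \<omega> t = (\<Prod>i\<in>UNIV. t $ i powi (\<omega> $ i))"

definition orbit_closure ::
    "(real ^ 'n::finite) set \<Rightarrow> (real ^ 'n) set \<Rightarrow> (int ^ 'n \<Rightarrow> 'k::field) set set" where
  "orbit_closure P \<sigma> = zariski (lattice_points P) closure_of
     {proj_point (\<lambda>\<omega>. if \<omega> \<in> lattice_points P \<inter> lattice_points \<sigma> then character \<omega> t else 0)
       | t. t \<in> torus}"

definition toric_variety :: "(real ^ 'n::finite) set \<Rightarrow> (int ^ 'n \<Rightarrow> 'k::field) set set" where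
  "toric_variety P = zariski (lattice_points P) closure_of
     {proj_point (\<lambda>\<omega>. if \<omega> \<in> lattice_points P then character \<omega> t else 0) | t. t \<in> torus}"

text \<open>The extended torus, its characters and its linear action; \<open>T\<close> is the subgroup \<open>c = 1\<close>.\<close>

definition ext_torus :: "('k::field \<times> ('k ^ 'n)) set" where
  "ext_torus = (UNIV - {0}) \<times> torus"

definition ext_inverse :: "'k::field \<times> ('k ^ 'n) \<Rightarrow> 'k \<times> ('k ^ 'n)" where
  "ext_inverse = (\<lambda>(c, t). (inverse c, \<chi> i. inverse (t $ i)))"

definition ext_character :: "int \<times> (int ^ 'n) \<Rightarrow> 'k::field \<times> ('k ^ 'n::finite) \<Rightarrow> 'k" where
  "ext_character = (\<lambda>(a, \<omega>) (c, t). c powi a * character \<omega> t)"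

definition ext_act ::
    "'k::field \<times> ('k ^ 'n::finite) \<Rightarrow> (int ^ 'n \<Rightarrow> 'k) \<Rightarrow> (int ^ 'n \<Rightarrow> 'k)" where
  "ext_act = (\<lambda>(c, t) x \<omega>. c * character \<omega> t * x \<omega>)"

text \<open>
  The group acts on functions by \<open>(s g) x = g (s\<inverse> x)\<close>, so the coordinate \<open>x\<^sub>\<omega>\<close> has weight
  \<open>(-1, -\<omega>)\<close>. Eigenfunctions are nonzero.
\<close>

definition ext_eigenfunction ::
    "(real ^ 'n::finite) set \<Rightarrow> int \<times> (int ^ 'n) \<Rightarrow> ((int ^ 'n \<Rightarrow> 'k::field) \<Rightarrow> 'k) \<Rightarrow> bool" where
  "ext_eigenfunction P \<mu> g \<longleftrightarrow>
     g \<in> coord_ring (lattice_points P) (toric_variety P) \<and>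
     (\<exists>x \<in> affine_cone (toric_variety P). g x \<noteq> 0) \<and>
     (\<forall>s \<in> ext_torus. \<forall>x \<in> affine_cone (toric_variety P).
        g (ext_act (ext_inverse s) x) = ext_character \<mu> s * g x)"

definition torus_eigenfunction ::
    "(real ^ 'n::finite) set \<Rightarrow> int ^ 'n \<Rightarrow> ((int ^ 'n \<Rightarrow> 'k::field) \<Rightarrow> 'k) \<Rightarrow> bool" where
  "torus_eigenfunction P \<omega> g \<longleftrightarrow>
     g \<in> coord_ring (lattice_points P) (toric_variety P) \<and>
     (\<exists>x \<in> affine_cone (toric_variety P). g x \<noteq> 0) \<and>
     (\<forall>t \<in> torus. \<forall>x \<in> affine_cone (toric_variety P).
        g (ext_act (ext_inverse (1, t)) x) = character \<omega> t * g x)"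

definition toric_degree :: "(real ^ 'n::finite) set \<Rightarrow> ((int ^ 'n \<Rightarrow> 'k::field) \<Rightarrow> 'k) \<Rightarrow> nat" where
  "toric_degree P = fun_degree (lattice_points P) (toric_variety P)"

definition torus_equivariant ::
    "(real ^ 'n::finite) set \<Rightarrow> 'i set \<Rightarrow> ('i \<Rightarrow> (int ^ 'n \<Rightarrow> 'k::field) set set)
       \<Rightarrow> ('i \<Rightarrow> (int ^ 'n \<Rightarrow> 'k) \<Rightarrow> 'k) \<Rightarrow> bool" where
  "torus_equivariant P I Xs fs \<longleftrightarrow>
     Xs ` I = orbit_closure P ` faces P \<and>
     (\<forall>p \<in> I. (\<exists>d. homogeneous_fun (lattice_points P) (toric_variety P) d (fs p)) \<and>
              (\<exists>\<omega>. torus_eigenfunction P \<omega> (fs p)))"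

text \<open>
  The subvarieties of a combinatorial Seshadri stratification are the orbit closures, hence
  determined by \<open>P\<close>. The last condition takes place in \<open>real \<times> (real ^ 'n)\<close>, with \<open>P\<close> placed at
  height \<open>1\<close>.
\<close>

definition combinatorial_seshadri_stratification ::
    "(real ^ 'n::finite) set \<Rightarrow> ((real ^ 'n) set \<Rightarrow> (int ^ 'n \<Rightarrow> 'k::field) \<Rightarrow> 'k)
       \<Rightarrow> ((real ^ 'n) set \<Rightarrow> int \<times> (int ^ 'n)) \<Rightarrow> bool" where
  "combinatorial_seshadri_stratification P f \<mu> \<longleftrightarrow>
     (\<forall>\<sigma> \<in> faces P.
        ext_eigenfunction P (\<mu> \<sigma>) (f \<sigma>) \<and> toric_degree P (f \<sigma>) \<ge> 1 \<and>
        (- 1 / real (toric_degree P (f \<sigma>))) *\<^sub>R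
            (real_of_int (fst (\<mu> \<sigma>)), lattice_vec (snd (\<mu> \<sigma>)))
          \<in> {1} \<times> rel_interior \<sigma>)"

end

theory Submission
  imports Defs
begin

text \<open>
  An eigenfunction of the extended torus restricts to a multiple of a character on the cone over
  the open orbit, hence it is a multiple \<open>C x\<^sup>a\<close> of a monomial on the cone over \<open>X\<^sub>P\<close>
  (\<open>ext_eigenfunction_monomial\<close>). If its degree \<open>d\<close> is positive, the normalised weight
  \<open>q = wt a / d\<close> is an average of lattice points of \<open>P\<close>. A face \<open>\<tau>\<close> contains \<open>q\<close> if and only if it contains
  all factors of the monomial, that is, if and only if the function has no zero on the orbit of \<open>\<tau>\<close>
  (\<open>eigenfunction_nonvanishing_iff\<close>). Since \<open>X\<^sub>\<sigma>\<close> is the union of the orbits of the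
  faces of \<open>\<sigma>\<close>, the function \<open>f\<^sub>\<sigma>\<close> vanishes on \<open>X\<^sub>\<sigma>\<close> exactly along the \<open>X\<^sub>\<tau>\<close> with \<open>\<tau>\<close> a proper face of \<open>\<sigma>\<close>
  if and only if \<open>q\<^sub>\<sigma>\<close> lies in \<open>\<sigma>\<close> and in none of its proper faces (\<open>zero_locus_iff\<close>). So (S3) is
  equivalent to the combinatorial condition; and this condition implies (S2), because a face containing
  a relative interior point of \<open>\<sigma>\<close> contains \<open>\<sigma>\<close>.

  For the equivalence one has to show that the conditions that concern only the orbit closures
  hold, most notably (S1). Everything is read off from an explicit description of the cone over \<open>X\<^sub>\<sigma>\<close>:
  it consists of the points that satisfy all binomial relations between monomials of equal weight and
  whose coordinates outside \<open>\<sigma>\<close> vanish (\<open>orbit_closure_eq\<close>). By independence of characters, a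
  polynomial vanishes on the cone over the orbit if and only if the coefficients of its monomials in
  the coordinates of \<open>\<sigma>\<close> add up to zero in each weight, and such a polynomial vanishes at every
  point described. Normality of \<open>P\<close> enters through the fact that the support of a nonzero point of the cone is the set of lattice points of a face (\<open>toric_cone_support_face\<close>).

  The dimension of \<open>X\<^sub>\<sigma>\<close> is that of \<open>\<sigma>\<close>. Flags of faces give chains of this length. Conversely, a chain of
  \<open>k + 1\<close> irreducible closed sets forces the Hilbert function of the largest to grow at least like a
  polynomial of degree \<open>k\<close> (\<open>irr_chain_indep_forms\<close>), whereas that of \<open>X\<^sub>P\<close> is bounded by the
  number of lattice points in the multiples of \<open>P\<close>; for smaller faces one prolongs a chain by a flag
  from \<open>\<sigma>\<close> to \<open>P\<close>.

  For smoothness in codimension one, normality provides a lattice point of \<open>\<sigma>\<close> at lattice distance one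
  from any given facet (\<open>facet_lattice_point\<close>), so that a lattice basis of the facet extends
  to one of \<open>\<sigma>\<close>. In such a basis the tangent spaces of the cone at the points of the open orbit and of
  the orbits of the facets have explicit bases of \<open>dim \<sigma> + 1\<close> vectors: the derivatives of
  the torus action and, on the orbit of a facet, one direction normal to it
  (\<open>tangent_dim_open_orbit\<close>, \<open>tangent_dim_facet_orbit\<close>). Hence singular points occur in
  codimension at least two only.
\<close>

section \<open>Monomials and polynomial functions\<close>

abbreviation "keys \<equiv> Poly_Mapping.keys"
abbreviation "lookup \<equiv> Poly_Mapping.lookup"
abbreviation "single \<equiv> Poly_Mapping.single"

definition mon :: "('v \<Rightarrow>\<^sub>0 nat) \<Rightarrow> ('v \<Rightarrow> 'a::comm_ring_1) \<Rightarrow> 'a" where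
  "mon a x = (\<Prod>v \<in> keys a. x v ^ lookup a v)"

definition mdeg :: "('v \<Rightarrow>\<^sub>0 nat) \<Rightarrow> nat" where
  "mdeg a = (\<Sum>v \<in> keys a. lookup a v)"

lemma mon_superset:
  assumes "finite A" "keys a \<subseteq> A"
  shows "mon a x = (\<Prod>v \<in> A. x v ^ lookup a v)"
  unfolding mon_def by (rule prod.mono_neutral_left) (use assms in \<open>auto simp: in_keys_iff\<close>)

lemma mdeg_superset:
  assumes "finite A" "keys a \<subseteq> A"
  shows "mdeg a = (\<Sum>v \<in> A. lookup a v)"
  unfolding mdeg_def by (rule sum.mono_neutral_left) (use assms in \<open>auto simp: in_keys_iff\<close>)

lemma keys_add_nat:
  fixes a b :: "'v \<Rightarrow>\<^sub>0 nat"
  shows "keys (a + b) = keys a \<union> keys b"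
  by (auto simp: in_keys_iff lookup_add)

lemma mon_add: "mon (a + b) x = mon a x * mon b x"
proof -
  let ?A = "keys a \<union> keys b"
  show ?thesis
    by (simp add: mon_superset[of ?A] keys_add_nat lookup_add power_add prod.distrib)
qed

lemma mdeg_add: "mdeg (a + b) = mdeg a + mdeg b"
proof -
  let ?A = "keys a \<union> keys b"
  show ?thesis
    by (simp add: mdeg_superset[of ?A] keys_add_nat lookup_add sum.distrib)
qed

lemma mon_zero [simp]: "mon 0 x = 1" and mdeg_zero [simp]: "mdeg 0 = 0"
  by (simp_all add: mon_def mdeg_def)

lemma mon_single [simp]: "mon (single v k) x = x v ^ k"
  and mdeg_single [simp]: "mdeg (single v k) = k"
  by (cases "k = 0"; simp add: mon_def mdeg_def)+

lemma mon_sum: "mon (\<Sum>i\<in>I. a i) x = (\<Prod>i\<in>I. mon (a i) x)"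
  by (induction I rule: infinite_finite_induct) (auto simp: mon_add)

lemma mdeg_sum: "mdeg (\<Sum>i\<in>I. a i) = (\<Sum>i\<in>I. mdeg (a i))"
  by (induction I rule: infinite_finite_induct) (auto simp: mdeg_add)

lemma mon_scale: "mon a (\<lambda>v. c * x v) = c ^ mdeg a * mon a x"
  by (simp add: mon_def mdeg_def power_mult_distrib prod.distrib power_sum)

lemma mon_eq_0_iff:
  fixes x :: "'v \<Rightarrow> 'k::idom"
  shows "mon a x = 0 \<longleftrightarrow> (\<exists>v \<in> keys a. x v = 0)"
  by (auto simp: mon_def in_keys_iff)

lemma peval_mon: "peval p x = (\<Sum>a \<in> keys p. lookup p a * mon a x)"
  by (simp add: peval_def mon_def)

lemma homogeneous_mdeg: "homogeneous d p \<longleftrightarrow> (\<forall>a \<in> keys p. mdeg a = d)"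
  by (simp add: homogeneous_def mdeg_def)

lemma peval_superset:
  assumes "finite A" "keys p \<subseteq> A"
  shows "peval p x = (\<Sum>a \<in> A. lookup p a * mon a x)"
  unfolding peval_mon by (rule sum.mono_neutral_left) (use assms in \<open>auto simp: in_keys_iff\<close>)

lemma peval_add: "peval (p + q) x = peval p x + peval q x"
proof -
  let ?A = "keys p \<union> keys q"
  have "keys (p + q) \<subseteq> ?A" by (rule keys_add)
  then show ?thesis
    by (simp add: peval_superset[of ?A] lookup_add sum.distrib distrib_right)
qed

lemma peval_0 [simp]: "peval 0 x = 0"
  by (simp add: peval_def)

lemma peval_single [simp]: "peval (single a c) x = c * mon a x"
  by (cases "c = 0") (auto simp: peval_mon)

lemma peval_sum: "peval (\<Sum>i\<in>I. p i) x = (\<Sum>i\<in>I. peval (p i) x)"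
  by (induction I rule: infinite_finite_induct) (auto simp: peval_add)

lemma sum_singles: "(\<Sum>a \<in> keys p. single a (lookup p a)) = p"
  by (rule poly_mapping_eqI)
     (auto simp: lookup_sum lookup_single when_def not_in_keys_iff_lookup_eq_zero)

lemma peval_mult: "peval (p * q) x = peval p x * peval q x"
proof -
  have "p * q = (\<Sum>a \<in> keys p. single a (lookup p a)) *
                (\<Sum>b \<in> keys q. single b (lookup q b))"
    by (simp add: sum_singles)
  also have "\<dots> = (\<Sum>a \<in> keys p. \<Sum>b \<in> keys q.
      single (a + b) (lookup p a * lookup q b))"
    by (simp add: sum_product mult_single)
  finally have "peval (p * q) x = (\<Sum>a \<in> keys p. \<Sum>b \<in> keys q.
      lookup p a * lookup q b * (mon a x * mon b x))"
    by (simp only: peval_sum peval_single mon_add)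
  then show ?thesis
    by (simp add: peval_mon sum_product algebra_simps)
qed

section \<open>Forms as functions\<close>

text \<open>
  Over an infinite field nothing is lost by treating a form as a function, and products and sums of
  forms are then pointwise.
\<close>

definition form :: "'v set \<Rightarrow> nat \<Rightarrow> (('v \<Rightarrow> 'k::comm_ring_1) \<Rightarrow> 'k) \<Rightarrow> bool" where
  "form S d g \<longleftrightarrow> (\<exists>p \<in> polys_over S. homogeneous d p \<and> g = peval p)"

lemma form_mon: "keys a \<subseteq> S \<Longrightarrow> form S (mdeg a) (\<lambda>x. c * mon a x)"
  unfolding form_def
  by (rule bexI[of _ "single a c"])
     (auto simp: polys_over_def homogeneous_mdeg split: if_splits)

lemma form_add: "form S d g \<Longrightarrow> form S d h \<Longrightarrow> form S d (\<lambda>x. g x + h x)"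
  unfolding form_def
proof (elim bexE conjE, goal_cases)
  case (1 p q)
  have "keys (p + q) \<subseteq> keys p \<union> keys q" by (rule keys_add)
  with 1 show ?case
    by (intro bexI[of _ "p + q"]) (fastforce simp: polys_over_def homogeneous_mdeg peval_add)+
qed

lemma form_mult: "form S d g \<Longrightarrow> form S e h \<Longrightarrow> form S (d + e) (\<lambda>x. g x * h x)"
  unfolding form_def
proof (elim bexE conjE, goal_cases)
  case (1 p q)
  have "\<exists>b c. a = b + c \<and> b \<in> keys p \<and> c \<in> keys q"
    if "a \<in> keys (p * q)" for a
    using that keys_mult[of p q] by auto
  with 1 show ?case
    by (intro bexI[of _ "p * q"])
       (fastforce simp: polys_over_def homogeneous_mdeg peval_mult mdeg_add keys_add_nat)+
qed

lemma form_const: "form S 0 (\<lambda>x. c)"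
  using form_mon[of 0 S c] by simp

lemma form_cmult: "form S d g \<Longrightarrow> form S d (\<lambda>x. c * g x)"
  using form_mult[OF form_const[of S c]] by fastforce

lemma form_zero: "form S d (\<lambda>x. 0)"
  unfolding form_def by (intro bexI[of _ 0]) (auto simp: polys_over_def homogeneous_mdeg)

lemma form_sum: "(\<And>i. i \<in> I \<Longrightarrow> form S d (g i)) \<Longrightarrow> form S d (\<lambda>x. \<Sum>i\<in>I. g i x)"
  by (induction I rule: infinite_finite_induct) (auto simp: form_zero form_add)

lemma form_coord: "v \<in> S \<Longrightarrow> form S 1 (\<lambda>x. x v)"
  using form_mon[of "single v 1" S 1] by simp

lemma form_power: "form S d g \<Longrightarrow> form S (k * d) (\<lambda>x. g x ^ k)"
  by (induction k) (auto simp: form_const intro: form_mult)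

lemma form_scale:
  assumes "form S d g"
  shows "g (\<lambda>v. c * x v) = c ^ d * g x"
proof -
  obtain p where "homogeneous d p" "g = peval p"
    using assms by (auto simp: form_def)
  then show ?thesis
    by (simp add: peval_mon mon_scale homogeneous_mdeg sum_distrib_left mult_ac cong: sum.cong)
qed

section \<open>The Zariski topology\<close>

lemma proj_point_self: "x \<in> proj_point x"
  unfolding proj_point_def by (intro CollectI exI[of _ 1]) auto

lemma proj_point_scale:
  assumes "c \<noteq> 0"
  shows "proj_point (\<lambda>v. c * x v) = proj_point x"
proof -
  have "\<exists>e. (\<lambda>v. d * x v) = (\<lambda>v. e * (c * x v)) \<and> e \<noteq> 0" if "d \<noteq> 0" for d
    using that assms by (intro exI[of _ "d / c"]) auto
  moreover have "\<exists>e. (\<lambda>v. d * (c * x v)) = (\<lambda>v. e * x v) \<and> e \<noteq> 0" if "d \<noteq> 0" for d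
    using that assms by (intro exI[of _ "d * c"]) (auto simp: mult_ac)
  ultimately show ?thesis unfolding proj_point_def by auto
qed

lemma proj_point_eq: "y \<in> proj_point x \<Longrightarrow> proj_point y = proj_point x"
  by (auto simp: proj_point_def[of x] proj_point_scale)

lemma proj_space_memD:
  assumes "L \<in> proj_space S" "x \<in> L"
  shows "L = proj_point x" "x \<in> coord_space S" "x \<noteq> (\<lambda>_. 0)"
proof -
  obtain y where y: "L = proj_point y" "y \<in> coord_space S" "y \<noteq> (\<lambda>_. 0)"
    using assms by (auto simp: proj_space_def)
  then show "L = proj_point x" using assms proj_point_eq by blast
  obtain c where "x = (\<lambda>v. c * y v)" "c \<noteq> 0" using assms y by (auto simp: proj_point_def)
  with y show "x \<in> coord_space S" "x \<noteq> (\<lambda>_. 0)" by (auto simp: coord_space_def fun_eq_iff)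
qed

lemma proj_point_in_proj_space:
  "x \<in> coord_space S \<Longrightarrow> x \<noteq> (\<lambda>_. 0) \<Longrightarrow> proj_point x \<in> proj_space S"
  by (auto simp: proj_space_def)

lemma form_nonzero_on_class:
  assumes "form S d g" "x \<in> proj_point y"
  shows "g x = 0 \<longleftrightarrow> g y = 0"
proof -
  obtain c where "x = (\<lambda>v. c * y v)" "c \<noteq> 0" using assms by (auto simp: proj_point_def)
  with form_scale[OF assms(1)] show ?thesis by auto
qed

definition nonvanishing :: "'v set \<Rightarrow> (('v \<Rightarrow> 'k::field) \<Rightarrow> 'k) \<Rightarrow> ('v \<Rightarrow> 'k) set set" where
  "nonvanishing S g = {L \<in> proj_space S. \<forall>x \<in> L. g x \<noteq> 0}"

lemma zariski_forms:
  "zariski S = topology_generated_by {nonvanishing S (g :: ('v \<Rightarrow> 'k::field) \<Rightarrow> 'k) | g d. form S d g}"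
proof -
  have "{{L \<in> proj_space S. \<forall>x \<in> L. peval p x \<noteq> (0::'k)} | p d. p \<in> polys_over S \<and> homogeneous d p}
      = {nonvanishing S (g :: ('v \<Rightarrow> 'k::field) \<Rightarrow> 'k) | g d. form S d g}"
    unfolding nonvanishing_def form_def by blast
  then show ?thesis unfolding zariski_def by (rule arg_cong)
qed

lemma topspace_zariski: "topspace (zariski S :: ('v \<Rightarrow> 'k::field) set topology) = proj_space S"
proof -
  have "nonvanishing S (\<lambda>_::'v \<Rightarrow> 'k. 1) = proj_space S" by (auto simp: nonvanishing_def)
  moreover have "form S 0 (\<lambda>_::'v \<Rightarrow> 'k. 1)" by (rule form_const)
  ultimately have "proj_space S \<in> {nonvanishing S (g :: ('v \<Rightarrow> 'k) \<Rightarrow> 'k) | g d. form S d g}"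
    by blast
  then show ?thesis unfolding zariski_forms topology_generated_by_topspace
    by (auto simp: nonvanishing_def)
qed

lemma openin_nonvanishing: "form S d g \<Longrightarrow> openin (zariski S) (nonvanishing S g)"
  unfolding zariski_forms by (rule topology_generated_by_Basis) blast

text \<open>The subbasis is closed under intersection, hence a basis: \<open>D(g) \<inter> D(h) = D(g h)\<close>.\<close>

lemma openin_zariski_basis:
  assumes "openin (zariski S) U" "L \<in> U"
  shows "\<exists>d g. form S d g \<and> L \<in> nonvanishing S g \<and> nonvanishing S g \<subseteq> U"
proof -
  have "generate_topology_on {nonvanishing S g | g d. form S d g} U"
    using assms(1) unfolding zariski_forms by (rule openin_topology_generated_by)
  then show ?thesis using assms(2)
  proof (induction arbitrary: L)
    case Empty
    then show ?case by simp
  next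
    case (Int A B)
    obtain d g where g: "form S d g" "L \<in> nonvanishing S g" "nonvanishing S g \<subseteq> A"
      using Int by blast
    obtain e h where h: "form S e h" "L \<in> nonvanishing S h" "nonvanishing S h \<subseteq> B"
      using Int by blast
    have "form S (d + e) (\<lambda>x. g x * h x)" using g h by (simp add: form_mult)
    moreover have "nonvanishing S (\<lambda>x. g x * h x) = nonvanishing S g \<inter> nonvanishing S h"
      by (auto simp: nonvanishing_def)
    ultimately show ?case using g h by (intro exI[of _ "d + e"] exI[of _ "\<lambda>x. g x * h x"]) auto
  next
    case (UN K)
    then obtain A where "A \<in> K" "L \<in> A" by blast
    then obtain d g where "form S d g" "L \<in> nonvanishing S g" "nonvanishing S g \<subseteq> A"
      using UN(2) by blast
    with \<open>A \<in> K\<close> show ?case by (intro exI[of _ d] exI[of _ g]) auto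
  next
    case (Basis s)
    then obtain d g where "form S d g" "s = nonvanishing S g" by blast
    with Basis show ?case by (intro exI[of _ d] exI[of _ g]) simp
  qed
qed

definition vanishes_on :: "(('v \<Rightarrow> 'k::field) \<Rightarrow> 'k) \<Rightarrow> ('v \<Rightarrow> 'k) set set \<Rightarrow> bool" where
  "vanishes_on g Z \<longleftrightarrow> (\<forall>L\<in>Z. \<forall>x\<in>L. g x = 0)"

lemma form_vanishes_or_nonvanishing:
  assumes "form S d g" "L \<in> proj_space S"
  shows "(\<forall>x\<in>L. g x = 0) \<longleftrightarrow> L \<notin> nonvanishing S g"
proof -
  obtain y where "L = proj_point y" "y \<in> L"
    using assms proj_point_self by (auto simp: proj_space_def)
  then have "\<And>x. x \<in> L \<Longrightarrow> g x = 0 \<longleftrightarrow> g y = 0" using form_nonzero_on_class assms by blast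
  with \<open>y \<in> L\<close> assms(2) show ?thesis unfolding nonvanishing_def by blast
qed

lemma closedin_zariski_separate:
  assumes "closedin (zariski S) C" "L \<in> proj_space S" "L \<notin> C"
  obtains d g where "form S d g" "vanishes_on g C" "\<forall>x\<in>L. g x \<noteq> 0"
proof -
  have C: "C \<subseteq> proj_space S" using assms closedin_subset topspace_zariski by metis
  have "openin (zariski S) (proj_space S - C)"
    using assms(1) by (metis closedin_def topspace_zariski)
  then obtain d g where "form S d g" "L \<in> nonvanishing S g" "nonvanishing S g \<subseteq> proj_space S - C"
    using openin_zariski_basis assms by (metis DiffI)
  moreover from this C have "vanishes_on g C"
    unfolding vanishes_on_def using form_vanishes_or_nonvanishing[of S d g] by blast
  ultimately show thesis using that by (auto simp: nonvanishing_def)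
qed

lemma closedin_zero_locus:
  assumes "form S d g"
  shows "closedin (zariski S) {L \<in> proj_space S. \<forall>x\<in>L. g x = 0}"
proof -
  have "{L \<in> proj_space S. \<forall>x\<in>L. g x = 0} = proj_space S - nonvanishing S g"
    using form_vanishes_or_nonvanishing[OF assms] by blast
  then show ?thesis
    using openin_nonvanishing[OF assms] topspace_zariski by (metis openin_closedin_eq closedin_diff closedin_topspace)
qed

text \<open>
  The zero loci of the two factors are closed and cover \<open>Z\<close>: the forms vanishing on an irreducible
  set generate a homogeneous prime ideal.
\<close>

lemma irreducible_vanishes_prime:
  assumes "irreducible_in (zariski S) Z" "form S d g" "form S e h"
    and "vanishes_on (\<lambda>x. g x * h x) Z"
  shows "vanishes_on g Z \<or> vanishes_on h Z"
proof -
  let ?C = "{L \<in> proj_space S. \<forall>x\<in>L. g x = 0}" and ?D = "{L \<in> proj_space S. \<forall>x\<in>L. h x = 0}"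
  have Z: "Z \<subseteq> proj_space S" using assms(1) by (simp add: irreducible_in_def topspace_zariski)
  have "Z \<subseteq> ?C \<union> ?D"
  proof
    fix L assume L: "L \<in> Z"
    with Z have LP: "L \<in> proj_space S" by blast
    then obtain y where y: "L = proj_point y" "y \<in> L"
      using proj_point_self by (auto simp: proj_space_def)
    have "g y * h y = 0" using assms(4) L y(2) by (simp add: vanishes_on_def)
    then consider "g y = 0" | "h y = 0" by auto
    then show "L \<in> ?C \<union> ?D"
    proof cases
      case 1
      then have "\<forall>x\<in>L. g x = 0" using form_nonzero_on_class[OF assms(2), of _ y] y by metis
      with LP show ?thesis by simp
    next
      case 2
      then have "\<forall>x\<in>L. h x = 0" using form_nonzero_on_class[OF assms(3), of _ y] y by metis
      with LP show ?thesis by simp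
    qed
  qed
  moreover have "closedin (zariski S) ?C" "closedin (zariski S) ?D"
    by (rule closedin_zero_locus[OF assms(2)], rule closedin_zero_locus[OF assms(3)])
  ultimately have "Z \<subseteq> ?C \<or> Z \<subseteq> ?D"
    using assms(1)[unfolded irreducible_in_def, THEN conjunct2, THEN conjunct2, rule_format, of ?C ?D]
    by simp
  then show ?thesis
  proof
    assume "Z \<subseteq> ?C"
    then show ?thesis by (auto simp: vanishes_on_def)
  next
    assume "Z \<subseteq> ?D"
    then show ?thesis by (auto simp: vanishes_on_def)
  qed
qed

section \<open>Chains of irreducible sets and independent forms\<close>

text \<open>
  The Hilbert function of \<open>Z\<close> in degree \<open>d\<close> is at least \<open>N\<close>.
\<close>

definition indep_forms :: "'v set \<Rightarrow> ('v \<Rightarrow> 'k::field) set set \<Rightarrow> nat \<Rightarrow> nat \<Rightarrow> bool" where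
  "indep_forms S Z d N \<longleftrightarrow> (\<exists>b. (\<forall>i<N. form S d (b i)) \<and>
     (\<forall>c. vanishes_on (\<lambda>x. \<Sum>i<N. c i * b i x) Z \<longrightarrow> (\<forall>i<N. c i = 0)))"

lemma sum_lessThan_add: "(\<Sum>i<m + n. f i) = (\<Sum>i<m. f i) + (\<Sum>i<n. f (m + i :: nat))"
  for f :: "nat \<Rightarrow> 'b::comm_monoid_add"
  by (induction n) (auto simp: add.assoc)

lemma indep_forms_mono:
  assumes "indep_forms S Z d N" "M \<le> N"
  shows "indep_forms S Z d M"
proof -
  obtain b where b: "\<forall>i<N. form S d (b i)"
    "\<And>c. vanishes_on (\<lambda>x. \<Sum>i<N. c i * b i x) Z \<Longrightarrow> \<forall>i<N. c i = 0"
    using assms by (auto simp: indep_forms_def)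
  have "\<forall>i<M. c i = 0" if "vanishes_on (\<lambda>x. \<Sum>i<M. c i * b i x) Z" for c
  proof -
    let ?c = "\<lambda>i. if i < M then c i else 0"
    have "(\<Sum>i<N. ?c i * b i x) = (\<Sum>i<M. c i * b i x)" for x
      by (rule sum.mono_neutral_cong_right) (use assms(2) in auto)
    with that b(2)[of ?c] assms(2) show ?thesis by (auto split: if_splits)
  qed
  with b(1) assms(2) show ?thesis unfolding indep_forms_def by (intro exI[of _ b]) auto
qed

lemma indep_forms_subset:
  assumes "indep_forms S Z d N" "Z \<subseteq> Y"
  shows "indep_forms S Y d N"
proof -
  obtain b where b: "\<forall>i<N. form S d (b i)"
    "\<And>c. vanishes_on (\<lambda>x. \<Sum>i<N. c i * b i x) Z \<Longrightarrow> \<forall>i<N. c i = 0"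
    using assms by (auto simp: indep_forms_def)
  have "vanishes_on g Y \<Longrightarrow> vanishes_on g Z" for g
    using assms(2) by (auto simp: vanishes_on_def)
  then have "\<And>c. vanishes_on (\<lambda>x. \<Sum>i<N. c i * b i x) Y \<Longrightarrow> \<forall>i<N. c i = 0"
    using b(2) by blast
  with b(1) show ?thesis unfolding indep_forms_def by (intro exI[of _ b] conjI allI impI) auto
qed

text \<open>
  If \<open>f\<close> vanishes on \<open>Z'\<close> but not on \<open>Z\<close>, a relation between forms that are independent on \<open>Z'\<close>
  and multiples of \<open>f\<close> restricts to a relation on \<open>Z'\<close> between the former; what remains is divisible
  by \<open>f\<close>, which can be cancelled as \<open>Z\<close> is irreducible.
\<close>

lemma indep_forms_step:
  assumes irr: "irreducible_in (zariski S) Z" and sub: "Z' \<subseteq> Z"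
    and f: "form S e f" "vanishes_on f Z'" "\<not> vanishes_on f Z"
    and Z': "indep_forms S Z' (d + e) N'" and Z: "indep_forms S Z d N"
  shows "indep_forms S Z (d + e) (N' + N)"
proof -
  obtain b' where b': "\<forall>i<N'. form S (d + e) (b' i)"
    "\<And>c. vanishes_on (\<lambda>x. \<Sum>i<N'. c i * b' i x) Z' \<Longrightarrow> \<forall>i<N'. c i = 0"
    using Z' by (auto simp: indep_forms_def)
  obtain b where b: "\<forall>i<N. form S d (b i)"
    "\<And>c. vanishes_on (\<lambda>x. \<Sum>i<N. c i * b i x) Z \<Longrightarrow> \<forall>i<N. c i = 0"
    using Z by (auto simp: indep_forms_def)
  define B where "B i = (if i < N' then b' i else (\<lambda>x. b (i - N') x * f x))" for i
  have "form S (d + e) (B i)" if "i < N' + N" for i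
    using that b'(1) form_mult[OF _ f(1)] b(1) by (auto simp: B_def)
  moreover have "\<forall>i<N' + N. c i = 0" if c: "vanishes_on (\<lambda>x. \<Sum>i<N' + N. c i * B i x) Z" for c
  proof -
    have split: "(\<Sum>i<N' + N. c i * B i x) =
        (\<Sum>i<N'. c i * b' i x) + (\<Sum>i<N. c (N' + i) * b i x) * f x" for x
      by (simp add: sum_lessThan_add B_def sum_distrib_right mult.assoc)
    have "vanishes_on (\<lambda>x. \<Sum>i<N'. c i * b' i x) Z'"
      unfolding vanishes_on_def
    proof (intro ballI)
      fix L x assume "L \<in> Z'" "x \<in> L"
      then have "f x = 0" "(\<Sum>i<N' + N. c i * B i x) = 0"
        using f(2) c sub by (auto simp: vanishes_on_def)
      then show "(\<Sum>i<N'. c i * b' i x) = 0" using split[of x] by simp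
    qed
    then have c': "\<forall>i<N'. c i = 0" by (rule b'(2))
    have "vanishes_on (\<lambda>x. (\<Sum>i<N. c (N' + i) * b i x) * f x) Z"
      using c split c' unfolding vanishes_on_def by simp
    moreover have "form S d (\<lambda>x. \<Sum>i<N. c (N' + i) * b i x)"
      by (rule form_sum, rule form_cmult) (use b(1) in auto)
    ultimately have "vanishes_on (\<lambda>x. \<Sum>i<N. c (N' + i) * b i x) Z"
      using irreducible_vanishes_prime[OF irr _ f(1)] f(3) by blast
    then have "\<forall>i<N. c (N' + i) = 0" by (rule b(2))
    with c' show ?thesis
      by (metis add_diff_inverse_nat nat_add_left_cancel_less)
  qed
  ultimately show ?thesis unfolding indep_forms_def by blast
qed

lemma indep_forms_one:
  assumes "form S d g" "\<not> vanishes_on g Z"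
  shows "indep_forms S Z d 1"
  unfolding indep_forms_def
  using assms by (intro exI[of _ "\<lambda>_. g"]) (auto simp: vanishes_on_def)

lemma irreducible_obtain_point:
  assumes "irreducible_in (zariski S) Z"
  obtains L x v where "L \<in> Z" "x \<in> L" "v \<in> S" "x v \<noteq> 0"
proof -
  obtain L where L: "L \<in> Z" "L \<in> proj_space S"
    using assms by (auto simp: irreducible_in_def topspace_zariski)
  then obtain x where x: "L = proj_point x" "x \<in> coord_space S" "x \<noteq> (\<lambda>_. 0)"
    by (auto simp: proj_space_def)
  then obtain v where "x v \<noteq> 0" by auto
  with x L that proj_point_self show thesis by (metis (mono_tags, lifting) coord_space_def mem_Collect_eq)
qed

text \<open>
  The Hilbert function of the top of a chain of length \<open>k\<close> grows at least like a polynomial of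
  degree \<open>k\<close>. A form that vanishes on one member of the chain but not on the next turns Pascal's rule
  into a bound, by summation over \<open>m\<close>. Passing to powers, the separating forms of all steps get
  degrees dividing a common \<open>E\<close>.
\<close>

lemma irr_chain_indep_forms:
  fixes Z :: "nat \<Rightarrow> ('v \<Rightarrow> 'k::field) set set"
  assumes "irr_chain (zariski S) k Z"
  shows "\<exists>E\<ge>1. \<forall>m. indep_forms S (Z k) (m * E) ((m + k) choose k)"
  using assms
proof (induction k)
  case 0
  then have "irreducible_in (zariski S) (Z 0)" by (auto simp: irr_chain_def irr_closed_def)
  then obtain L x v where L: "L \<in> Z 0" "x \<in> L" "v \<in> S" "x v \<noteq> 0"
    by (rule irreducible_obtain_point)
  have "indep_forms S (Z 0) m 1" for m
  proof (rule indep_forms_one)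
    show "form S m (\<lambda>x. x v ^ m)" using form_power[OF form_coord[OF L(3)], of m] by simp
    show "\<not> vanishes_on (\<lambda>x. x v ^ m) (Z 0)" using L by (auto simp: vanishes_on_def)
  qed
  then show ?case by (intro exI[of _ 1]) auto
next
  case (Suc k)
  then have "irr_chain (zariski S) k Z" by (auto simp: irr_chain_def)
  with Suc obtain E where E: "E \<ge> 1" "\<And>m. indep_forms S (Z k) (m * E) ((m + k) choose k)" by blast
  have irr: "irreducible_in (zariski S) (Z (Suc k))" "irr_closed (zariski S) (Z k)"
      "Z k \<subset> Z (Suc k)"
    using Suc.prems by (auto simp: irr_chain_def irr_closed_def)
  then obtain L where L: "L \<in> Z (Suc k)" "L \<notin> Z k" by blast
  have "L \<in> proj_space S" using irr(1) L(1) by (auto simp: irreducible_in_def topspace_zariski)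
  moreover have "closedin (zariski S) (Z k)" using irr(2) by (simp add: irr_closed_def)
  ultimately obtain e g where g: "form S e g" "vanishes_on g (Z k)" "\<forall>x\<in>L. g x \<noteq> 0"
    using closedin_zariski_separate L(2) by blast
  obtain y where y: "y \<in> L" using \<open>L \<in> proj_space S\<close> proj_point_self by (auto simp: proj_space_def)
  \<comment> \<open>A form of degree \<open>0\<close> is constant, so it cannot separate \<open>L\<close> from the nonempty set \<open>Z k\<close>.\<close>
  have "e \<noteq> 0"
  proof
    assume "e = 0"
    have "irreducible_in (zariski S) (Z k)" using irr(2) by (simp add: irr_closed_def)
    then obtain L' x v where L': "L' \<in> Z k" "x \<in> L'"
      by (rule irreducible_obtain_point)
    have "g (\<lambda>v. 0 * x v) = g x" "g (\<lambda>v. 0 * y v) = g y"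
      using form_scale[OF g(1), of 0] \<open>e = 0\<close> by simp_all
    moreover have "g x = 0" "g y \<noteq> 0" using g L' y by (auto simp: vanishes_on_def)
    ultimately show False by simp
  qed
  define F where "F x = g x ^ E" for x
  have F: "form S (E * e) F" "vanishes_on F (Z k)" "\<not> vanishes_on F (Z (Suc k))"
    using form_power[OF g(1), of E] g(2,3) E(1) L(1) y unfolding F_def[abs_def] vanishes_on_def
    by (auto intro!: bexI[of _ L] bexI[of _ y])
  have low: "indep_forms S (Z k) (m * (E * e)) ((m + k) choose k)" for m
  proof -
    have "(m + k) choose k \<le> (m * e + k) choose k"
      using \<open>e \<noteq> 0\<close> by (intro binomial_right_mono) auto
    with E(2)[of "m * e"] show ?thesis by (auto simp: mult_ac intro: indep_forms_mono)
  qed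
  have "indep_forms S (Z (Suc k)) (m * (E * e)) ((m + Suc k) choose Suc k)" for m
  proof (induction m)
    case 0
    have "indep_forms S (Z (Suc k)) 0 1"
      using L(1) y by (intro indep_forms_one[OF form_const[of _ 1]]) (auto simp: vanishes_on_def)
    then show ?case by simp
  next
    case (Suc m)
    have "indep_forms S (Z k) (m * (E * e) + E * e) ((Suc m + k) choose k)"
      using low[of "Suc m"] by (simp add: add.commute)
    then have "indep_forms S (Z (Suc k)) (m * (E * e) + E * e)
        (((Suc m + k) choose k) + ((m + Suc k) choose Suc k))"
      using indep_forms_step[OF irr(1) _ F _ Suc] irr(3) by blast
    then show ?case by (simp add: add.commute)
  qed
  then show ?case using E(1) \<open>e \<noteq> 0\<close> by (intro exI[of _ "E * e"]) auto
qed

text \<open>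
  Gaussian elimination: an equation with a nonzero coefficient is solved for the corresponding
  unknown \<open>j\<close>, which is then eliminated from the other equations; \<open>s\<close> renumbers the remaining unknowns.
\<close>

lemma underdetermined_system:
  fixes \<gamma> :: "nat \<Rightarrow> 'w \<Rightarrow> 'k::field"
  assumes "finite W" "card W < N"
  shows "\<exists>c. (\<exists>i<N. c i \<noteq> 0) \<and> (\<forall>\<omega>\<in>W. (\<Sum>i<N. c i * \<gamma> i \<omega>) = 0)"
  using assms
proof (induction W arbitrary: N \<gamma> rule: finite_induct)
  case empty
  then show ?case by (intro exI[of _ "\<lambda>_. 1"]) auto
next
  case (insert \<omega> W)
  then obtain M where M: "N = Suc M" "card W < M" by (cases N) auto
  show ?case
  proof (cases "\<exists>j<N. \<gamma> j \<omega> \<noteq> 0")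
    case False
    then show ?thesis using insert.IH[of N \<gamma>] insert.prems insert.hyps by auto
  next
    case True
    then obtain j where j: "j < N" "\<gamma> j \<omega> \<noteq> 0" by blast
    define s where "s i = (if i < j then i else Suc i)" for i
    have s: "bij_betw s {..<M} ({..<N} - {j})"
      by (rule bij_betw_byWitness[where f' = "\<lambda>i. if i < j then i else i - 1"])
         (use j M in \<open>auto simp: s_def\<close>)
    define \<delta> where "\<delta> i \<psi> = \<gamma> (s i) \<psi> - \<gamma> (s i) \<omega> / \<gamma> j \<omega> * \<gamma> j \<psi>" for i \<psi>
    obtain c where c: "\<exists>i<M. c i \<noteq> 0" "\<forall>\<psi>\<in>W. (\<Sum>i<M. c i * \<delta> i \<psi>) = 0"
      using insert.IH[of M \<delta>] M by blast
    define C where "C = (\<Sum>i<M. c i * \<gamma> (s i) \<omega>) / \<gamma> j \<omega>"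
    define c' where "c' i = (if i = j then - C else c (the_inv_into {..<M} s i))" for i
    have inv: "the_inv_into {..<M} s (s i) = i" "s i \<noteq> j" if "i < M" for i
      using the_inv_into_f_f[OF bij_betw_imp_inj_on[OF s], of i] that by (simp_all add: s_def)
    have sum: "(\<Sum>i<N. c' i * \<gamma> i \<psi>) = (\<Sum>i<M. c i * \<gamma> (s i) \<psi>) - C * \<gamma> j \<psi>" for \<psi>
    proof -
      have "(\<Sum>i<N. c' i * \<gamma> i \<psi>) = c' j * \<gamma> j \<psi> + (\<Sum>i\<in>{..<N} - {j}. c' i * \<gamma> i \<psi>)"
        using j by (intro sum.remove) auto
      also have "(\<Sum>i\<in>{..<N} - {j}. c' i * \<gamma> i \<psi>) = (\<Sum>i<M. c' (s i) * \<gamma> (s i) \<psi>)"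
        using sum.reindex_bij_betw[OF s, of "\<lambda>i. c' i * \<gamma> i \<psi>"] by simp
      also have "\<dots> = (\<Sum>i<M. c i * \<gamma> (s i) \<psi>)"
        by (intro sum.cong) (auto simp: c'_def inv)
      finally show ?thesis by (simp add: c'_def)
    qed
    have "(\<Sum>i<N. c' i * \<gamma> i \<psi>) = 0" if "\<psi> \<in> insert \<omega> W" for \<psi>
    proof (cases "\<psi> = \<omega>")
      case True
      then show ?thesis using j by (simp add: sum C_def)
    next
      case False
      then have "(\<Sum>i<M. c i * \<delta> i \<psi>) = 0" using c that by auto
      moreover have "(\<Sum>i<M. c i * \<delta> i \<psi>) = (\<Sum>i<M. c i * \<gamma> (s i) \<psi>) - C * \<gamma> j \<psi>"
        by (simp add: \<delta>_def C_def algebra_simps sum_subtractf sum_distrib_left sum_divide_distrib)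
      ultimately show ?thesis by (simp add: sum)
    qed
    moreover obtain i where "i < M" "c i \<noteq> 0" using c by blast
    then have "c' (s i) \<noteq> 0" "s i < N"
      using inv[of i] s M by (auto simp: c'_def bij_betw_def)
    ultimately show ?thesis by blast
  qed
qed

section \<open>Characters of the extended torus\<close>

text \<open>
  Dedekind's argument: comparing a relation at \<open>x\<close> and at \<open>x y\<close> eliminates the character \<open>v\<close>, and
  multiplies the coefficient of \<open>w\<close> by a factor that is nonzero if \<open>y\<close> separates \<open>w\<close> from \<open>v\<close>.
\<close>

lemma dedekind_independence:
  fixes ch :: "'w \<Rightarrow> 'g \<Rightarrow> 'k::field"
  assumes mult: "\<And>w x y. x \<in> G \<Longrightarrow> y \<in> G \<Longrightarrow> ch w (mul x y) = ch w x * ch w y"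
    and closed: "\<And>x y. x \<in> G \<Longrightarrow> y \<in> G \<Longrightarrow> mul x y \<in> G"
    and nonzero: "\<And>w. \<exists>x\<in>G. ch w x \<noteq> 0"
    and distinct: "\<And>w w'. w \<noteq> w' \<Longrightarrow> \<exists>x\<in>G. ch w x \<noteq> ch w' x"
    and "finite W" "\<forall>x\<in>G. (\<Sum>w\<in>W. c w * ch w x) = 0"
  shows "\<forall>w\<in>W. c w = 0"
  using assms(5,6)
proof (induction W arbitrary: c rule: finite_induct)
  case empty
  then show ?case by simp
next
  case (insert v W)
  have W0: "c w = 0" if w: "w \<in> W" for w
  proof -
    have "w \<noteq> v" using w insert.hyps by blast
    then obtain y where y: "y \<in> G" "ch w y \<noteq> ch v y" using distinct by blast
    have "(\<Sum>w\<in>W. c w * (ch w y - ch v y) * ch w x) = 0" if x: "x \<in> G" for x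
    proof -
      have "(\<Sum>w\<in>insert v W. c w * ch w (mul x y)) = 0"
        "(\<Sum>w\<in>insert v W. c w * ch w x) = 0"
        using insert.prems closed x y(1) by blast+
      then have "c v * ch v x * ch v y + (\<Sum>w\<in>W. c w * ch w x * ch w y) = 0"
        "c v * ch v x + (\<Sum>w\<in>W. c w * ch w x) = 0"
        using insert.hyps mult[OF x y(1)] by (simp_all add: mult.assoc)
      moreover have "(\<Sum>w\<in>W. c w * (ch w y - ch v y) * ch w x)
          = (\<Sum>w\<in>W. c w * ch w x * ch w y) - (\<Sum>w\<in>W. c w * ch w x) * ch v y"
        by (simp add: sum_distrib_left sum_distrib_right left_diff_distrib right_diff_distrib
            sum_subtractf mult_ac)
      ultimately show ?thesis by algebra
    qed
    then have "\<forall>w\<in>W. c w * (ch w y - ch v y) = 0" by (intro insert.IH) auto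
    with w y show ?thesis by auto
  qed
  moreover have "c v = 0"
  proof -
    obtain x where "x \<in> G" "ch v x \<noteq> 0" using nonzero by blast
    with insert.prems insert.hyps W0 show ?thesis by auto
  qed
  ultimately show ?case by auto
qed

definition ext_mult :: "'k::field \<times> ('k ^ 'n) \<Rightarrow> 'k \<times> ('k ^ 'n) \<Rightarrow> 'k \<times> ('k ^ 'n)" where
  "ext_mult s s' = (fst s * fst s', \<chi> i. snd s $ i * snd s' $ i)"

lemma ext_torus_iff: "(c, t) \<in> ext_torus \<longleftrightarrow> c \<noteq> 0 \<and> t \<in> torus"
  by (simp add: ext_torus_def)

lemma character_nonzero: "t \<in> torus \<Longrightarrow> character \<omega> t \<noteq> 0"
  by (simp add: character_def torus_def)

lemma character_0: "character 0 t = 1"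
  by (simp add: character_def)

lemma character_add: "t \<in> torus \<Longrightarrow> character (\<omega> + \<psi>) t = character \<omega> t * character \<psi> t"
  by (simp add: character_def torus_def power_int_add prod.distrib)

lemma character_sum:
  "t \<in> torus \<Longrightarrow> character (\<Sum>i\<in>I. g i) t = (\<Prod>i\<in>I. character (g i) t)"
  by (induction I rule: infinite_finite_induct) (auto simp: character_0 character_add)

lemma character_scale:
  "character (int k *s \<omega>) t = character \<omega> t ^ k"
  by (simp add: character_def prod_power_distrib mult.commute[of "int k"] power_int_mult)

lemma ext_character_mult:
  assumes "s \<in> ext_torus" "s' \<in> ext_torus"
  shows "ext_character w (ext_mult s s') = ext_character w s * ext_character w s'"
  by (cases w; cases s; cases s')
     (simp add: ext_character_def ext_mult_def character_def power_int_mult_distrib prod.distrib)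

text \<open>
  In characteristic zero \<open>2\<close> has infinite order, so it separates the characters of the torus.
\<close>

lemma two_powi_inj:
  assumes "(2 :: 'k::field_char_0) powi a = 2 powi b"
  shows "a = b"
proof -
  have *: False if "a < b" "(2::'k) powi a = 2 powi b" for a b
  proof -
    have "(2::'k) powi b = 2 powi a * 2 ^ nat (b - a)"
      using that(1) by (simp flip: power_int_of_nat power_int_add)
    with that(2) have "(2::'k) ^ nat (b - a) = 1" by simp
    then have "(of_nat (2 ^ nat (b - a)) :: 'k) = of_nat 1" by simp
    then have "(2::nat) ^ nat (b - a) = 1" by (simp only: of_nat_eq_iff)
    with that(1) show False by simp
  qed
  show ?thesis using *[of a b] *[of b a] assms by (metis linorder_neqE)
qed

lemma ext_characters_distinct:
  assumes "w \<noteq> w'"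
  shows "\<exists>s\<in>ext_torus. ext_character w s \<noteq> (ext_character w' s :: 'k::field_char_0)"
proof -
  obtain d \<omega> d' \<omega>' where w: "w = (d, \<omega>)" "w' = (d', \<omega>')" by (cases w, cases w') auto
  show ?thesis
  proof (cases "d = d'")
    case False
    then show ?thesis using two_powi_inj[of d d', where 'k = 'k] w
      by (intro bexI[of _ "(2, \<chi> i. 1)"])
         (auto simp: ext_character_def character_def ext_torus_def torus_def)
  next
    case True
    with assms w obtain i where i: "\<omega> $ i \<noteq> \<omega>' $ i" by (auto simp: vec_eq_iff)
    define t :: "'k ^ _" where "t = (\<chi> j. if j = i then 2 else 1)"
    have "character \<psi> t = 2 powi (\<psi> $ i)" for \<psi>
    proof -
      have "character \<psi> t = (\<Prod>j\<in>UNIV. if j = i then 2 powi (\<psi> $ i) else 1)"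
        unfolding character_def t_def by (intro prod.cong) auto
      then show ?thesis by simp
    qed
    then show ?thesis using two_powi_inj[of "\<omega> $ i" "\<omega>' $ i", where 'k = 'k] w True i
      by (intro bexI[of _ "(1, t)"]) (auto simp: ext_character_def ext_torus_def torus_def t_def)
  qed
qed

lemma ext_characters_independent:
  fixes c :: "int \<times> (int ^ 'n::finite) \<Rightarrow> 'k::field_char_0"
  assumes "finite W" "\<forall>s\<in>ext_torus. (\<Sum>w\<in>W. c w * ext_character w s) = 0"
  shows "\<forall>w\<in>W. c w = 0"
proof (rule dedekind_independence[where G = ext_torus and mul = ext_mult and ch = ext_character])
  fix w :: "int \<times> (int ^ 'n)"
  show "\<exists>x\<in>ext_torus. ext_character w x \<noteq> (0::'k)"
    by (rule bexI[of _ "(1, \<chi> i. 1)"])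
       (cases w, auto simp: ext_character_def character_def ext_torus_def torus_def)
next
  fix s s' :: "'k \<times> ('k ^ 'n)"
  assume "s \<in> ext_torus" "s' \<in> ext_torus"
  then show "ext_mult s s' \<in> ext_torus" by (auto simp: ext_torus_def ext_mult_def torus_def)
qed (use assms in \<open>simp_all add: ext_character_mult ext_characters_distinct\<close>)

section \<open>Weights of monomials\<close>

definition wt :: "(int ^ 'n \<Rightarrow>\<^sub>0 nat) \<Rightarrow> int ^ 'n" where
  "wt a = (\<Sum>v \<in> keys a. int (lookup a v) *s v)"

text \<open>
  On the cone over the orbit of a face, a monomial in the coordinates of the face restricts to the
  character \<open>ewt a\<close> of the extended torus; as a function it has the opposite weight.
\<close>

definition ewt :: "(int ^ 'n \<Rightarrow>\<^sub>0 nat) \<Rightarrow> int \<times> (int ^ 'n)" where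
  "ewt a = (int (mdeg a), wt a)"

lemma wt_superset:
  assumes "finite A" "keys a \<subseteq> A"
  shows "wt a = (\<Sum>v \<in> A. int (lookup a v) *s v)"
  unfolding wt_def by (rule sum.mono_neutral_left) (use assms in \<open>auto simp: in_keys_iff vec_eq_iff\<close>)

lemma wt_add: "wt (a + b) = wt a + wt b"
proof -
  let ?A = "keys a \<union> keys b"
  show ?thesis
    by (simp add: wt_superset[of ?A] keys_add_nat lookup_add sum.distrib vector_sadd_rdistrib)
qed

lemma wt_zero [simp]: "wt 0 = 0"
  by (simp add: wt_def)

lemma wt_single [simp]: "wt (single v k) = int k *s v"
  by (cases "k = 0") (auto simp: wt_def vec_eq_iff)

lemma wt_sum: "wt (\<Sum>i\<in>I. a i) = (\<Sum>i\<in>I. wt (a i))"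
  by (induction I rule: infinite_finite_induct) (auto simp: wt_add)

text \<open>
  The first component of the parameter scales, so that the extended torus sweeps out the cone over
  the orbit of \<open>\<sigma>\<close>.
\<close>

definition orbit_point :: "(real ^ 'n::finite) set \<Rightarrow> 'k::field \<times> ('k ^ 'n) \<Rightarrow> int ^ 'n \<Rightarrow> 'k" where
  "orbit_point \<sigma> s = (\<lambda>\<omega>. if \<omega> \<in> lattice_points \<sigma> then fst s * character \<omega> (snd s) else 0)"

lemma mon_orbit_point:
  assumes "s \<in> ext_torus"
  shows "mon a (orbit_point \<sigma> s) =
    (if keys a \<subseteq> lattice_points \<sigma> then ext_character (ewt a) s else 0)"
proof (cases "keys a \<subseteq> lattice_points \<sigma>")
  case True
  obtain c t where s: "s = (c, t)" "t \<in> torus" using assms by (cases s) (auto simp: ext_torus_iff)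
  have "mon a (orbit_point \<sigma> s) =
      (\<Prod>v\<in>keys a. (c * character v t) ^ lookup a v)"
    unfolding mon_def orbit_point_def s by (rule prod.cong) (use True in auto)
  also have "\<dots> = c ^ mdeg a * (\<Prod>v\<in>keys a. character v t ^ lookup a v)"
    by (simp add: mdeg_def power_mult_distrib prod.distrib power_sum)
  also have "\<dots> = ext_character (ewt a) s"
    by (simp add: ext_character_def ewt_def s wt_def character_sum character_scale)
  finally show ?thesis using True by simp
next
  case False
  then obtain v where "v \<in> keys a" "v \<notin> lattice_points \<sigma>" by blast
  then have "mon a (orbit_point \<sigma> s) = 0"
    unfolding mon_eq_0_iff by (intro bexI[of _ v]) (auto simp: orbit_point_def)
  with False show ?thesis by simp
qed

text \<open>
  The coefficient of the character \<open>w\<close> in the restriction of \<open>p\<close> to the cone over the orbit of \<open>\<sigma>\<close>: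
  the coordinates outside \<open>\<sigma>\<close> vanish there, and the monomials of weight \<open>w\<close> coincide.
\<close>

definition weight_coeff ::
    "(real ^ 'n::finite) set \<Rightarrow> (int ^ 'n, 'k::comm_ring_1) mpoly \<Rightarrow> int \<times> (int ^ 'n) \<Rightarrow> 'k" where
  "weight_coeff \<sigma> p w =
     (\<Sum>a \<in> {a \<in> keys p. keys a \<subseteq> lattice_points \<sigma> \<and> ewt a = w}.
        lookup p a)"

lemma peval_by_weights:
  assumes "\<And>a. a \<in> keys p \<Longrightarrow> mon a x =
      (if keys a \<subseteq> lattice_points \<sigma> then h (ewt a) else 0)"
  shows "peval p x = (\<Sum>w \<in> ewt ` keys p. weight_coeff \<sigma> p w * h w)"
proof -
  let ?K = "{a \<in> keys p. keys a \<subseteq> lattice_points \<sigma>}"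
  have "peval p x = (\<Sum>a \<in> ?K. lookup p a * h (ewt a))"
    unfolding peval_mon by (rule sum.mono_neutral_cong_right) (use assms in auto)
  also have "\<dots> = (\<Sum>w \<in> ewt ` keys p. \<Sum>a \<in> {a \<in> ?K. ewt a = w}.
      lookup p a * h (ewt a))"
    by (rule sum.group[symmetric]) auto
  also have "\<dots> = (\<Sum>w \<in> ewt ` keys p. weight_coeff \<sigma> p w * h w)"
    unfolding weight_coeff_def sum_distrib_right by (intro sum.cong) auto
  finally show ?thesis .
qed

lemma peval_orbit_point:
  assumes "s \<in> ext_torus"
  shows "peval p (orbit_point \<sigma> s) =
    (\<Sum>w \<in> ewt ` keys p. weight_coeff \<sigma> p w * ext_character w s)"
  by (rule peval_by_weights) (simp add: mon_orbit_point assms)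

lemma weight_coeff_zero:
  fixes p :: "(int ^ 'n::finite, 'k::field_char_0) mpoly"
  assumes "\<And>s. s \<in> ext_torus \<Longrightarrow> peval p (orbit_point \<sigma> s) = 0"
  shows "weight_coeff \<sigma> p w = 0"
proof (cases "w \<in> ewt ` keys p")
  case True
  then show ?thesis
    using ext_characters_independent[of "ewt ` keys p" "weight_coeff \<sigma> p"] assms
      peval_orbit_point[of _ p \<sigma>] by fastforce
next
  case False
  then have "{a \<in> keys p. keys a \<subseteq> lattice_points \<sigma> \<and> ewt a = w} = {}"
    by auto
  then show ?thesis unfolding weight_coeff_def by (simp only: sum.empty)
qed

text \<open>
  The cone cut out by the binomial relations and by the vanishing of the coordinates outside \<open>\<sigma>\<close>;
  it turns out to be the affine cone of the orbit closure.
\<close>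

definition toric_cone :: "(real ^ 'n::finite) set \<Rightarrow> (real ^ 'n) set \<Rightarrow> (int ^ 'n \<Rightarrow> 'k::field) set" where
  "toric_cone P \<sigma> = {x \<in> coord_space (lattice_points P).
     (\<forall>\<omega>. x \<omega> \<noteq> 0 \<longrightarrow> \<omega> \<in> lattice_points \<sigma>) \<and>
     (\<forall>a b. keys a \<subseteq> lattice_points P \<longrightarrow> keys b \<subseteq> lattice_points P \<longrightarrow>
        ewt a = ewt b \<longrightarrow> mon a x = mon b x)}"

lemma toric_coneD:
  assumes "x \<in> toric_cone P \<sigma>"
  shows toric_cone_coord_space: "x \<in> coord_space (lattice_points P)"
    and toric_cone_support: "x \<omega> \<noteq> 0 \<Longrightarrow> \<omega> \<in> lattice_points \<sigma>"
    and toric_cone_binomial: "keys a \<subseteq> lattice_points P \<Longrightarrow>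
      keys b \<subseteq> lattice_points P \<Longrightarrow> ewt a = ewt b \<Longrightarrow> mon a x = mon b x"
  using assms unfolding toric_cone_def by blast+

text \<open>
  A polynomial vanishing on the orbit has, in every weight, coefficients that sum to zero; as all
  monomials of a given weight agree at a point of the cone, it vanishes there, too.
\<close>

lemma vanish_orbit_imp_vanish_cone:
  fixes p :: "(int ^ 'n::finite, 'k::field_char_0) mpoly"
  assumes "p \<in> polys_over (lattice_points P)"
    and "\<And>s. s \<in> ext_torus \<Longrightarrow> peval p (orbit_point \<sigma> s) = 0"
    and x: "x \<in> toric_cone P \<sigma>"
  shows "peval p x = 0"
proof -
  define h where "h w = mon (SOME a. keys a \<subseteq> lattice_points P \<and> ewt a = w) x" for w
  have "mon a x = (if keys a \<subseteq> lattice_points \<sigma> then h (ewt a) else 0)"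
    if "a \<in> keys p" for a
  proof (cases "keys a \<subseteq> lattice_points \<sigma>")
    case True
    have a: "keys a \<subseteq> lattice_points P" using assms(1) that by (auto simp: polys_over_def)
    define b where "b = (SOME b. keys b \<subseteq> lattice_points P \<and> ewt b = ewt a)"
    have "keys b \<subseteq> lattice_points P \<and> ewt b = ewt a"
      unfolding b_def by (rule someI[of _ a]) (use a in simp)
    then have "mon a x = mon b x" using toric_cone_binomial[OF x a, of b] by simp
    with True show ?thesis by (simp add: h_def b_def)
  next
    case False
    then obtain v where "v \<in> keys a" "v \<notin> lattice_points \<sigma>" by blast
    then have "mon a x = 0"
    proof (unfold mon_eq_0_iff, intro bexI[of _ v])
      show "x v = 0" using toric_cone_support[OF x, of v] \<open>v \<notin> lattice_points \<sigma>\<close> by blast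
    qed
    with False show ?thesis by simp
  qed
  then have "peval p x = (\<Sum>w \<in> ewt ` keys p. weight_coeff \<sigma> p w * h w)"
    by (rule peval_by_weights)
  then show ?thesis by (simp add: weight_coeff_zero assms(2))
qed

section \<open>Substituting polynomials in one variable\<close>

lemma keys_map_const:
  "keys (Poly_Mapping.map (\<lambda>c. [:c:]) p) = keys p"
  by (auto simp: in_keys_iff Poly_Mapping.map.rep_eq when_def)

lemma lookup_map_const:
  "lookup (Poly_Mapping.map (\<lambda>c. [:c:]) p) a = [:lookup p a:]"
  by (auto simp: Poly_Mapping.map.rep_eq when_def)

lemma peval_map_const:
  "peval (Poly_Mapping.map (\<lambda>c. [:c:]) p) Y =
    (\<Sum>a \<in> keys p. [:lookup p a:] * mon a Y)"
  by (simp add: peval_mon keys_map_const lookup_map_const)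

lemma poly_mon: "poly (mon a Y) z = mon a (\<lambda>v. poly (Y v) z)"
  by (simp add: mon_def poly_prod)

lemma poly_peval:
  "poly (peval (Poly_Mapping.map (\<lambda>c. [:c:]) p) Y) z = peval p (\<lambda>v. poly (Y v) z)"
  unfolding peval_map_const by (simp add: poly_sum poly_mon peval_mon)

section \<open>Lattice points of normal polytopes\<close>

lemma lattice_vec_add: "lattice_vec (\<omega> + \<psi>) = lattice_vec \<omega> + lattice_vec \<psi>"
  by (simp add: lattice_vec_def vec_eq_iff)

lemma lattice_vec_0 [simp]: "lattice_vec 0 = 0"
  by (simp add: lattice_vec_def vec_eq_iff)

lemma lattice_vec_scale: "lattice_vec (k *s \<omega>) = real_of_int k *\<^sub>R lattice_vec \<omega>"
  by (simp add: lattice_vec_def vec_eq_iff)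

lemma lattice_vec_sum: "lattice_vec (\<Sum>i\<in>I. g i) = (\<Sum>i\<in>I. lattice_vec (g i))"
  by (induction I rule: infinite_finite_induct) (auto simp: lattice_vec_add)

lemma lattice_vec_inj: "lattice_vec \<omega> = lattice_vec \<psi> \<longleftrightarrow> \<omega> = \<psi>"
  by (simp add: lattice_vec_def vec_eq_iff)

lemma mem_lattice_points: "\<omega> \<in> lattice_points S \<longleftrightarrow> lattice_vec \<omega> \<in> S"
  by (simp add: lattice_points_def)

lemma finite_card_vec_box:
  assumes "finite A"
  shows "finite {\<omega> :: 'a ^ 'n::finite. \<forall>i. \<omega> $ i \<in> A}"
    and "card {\<omega> :: 'a ^ 'n::finite. \<forall>i. \<omega> $ i \<in> A} \<le> card A ^ CARD('n)"
proof -
  have eq: "{\<omega> :: 'a ^ 'n. \<forall>i. \<omega> $ i \<in> A} = vec_lambda ` (PiE UNIV (\<lambda>_. A))"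
  proof (intro equalityI subsetI)
    fix \<omega> :: "'a ^ 'n" assume "\<omega> \<in> {\<omega>. \<forall>i. \<omega> $ i \<in> A}"
    then show "\<omega> \<in> vec_lambda ` (PiE UNIV (\<lambda>_. A))"
      by (intro image_eqI[of _ _ "vec_nth \<omega>"]) auto
  qed auto
  have fin: "finite (PiE (UNIV :: 'n set) (\<lambda>_. A))" using assms by (simp add: finite_PiE)
  show "finite {\<omega> :: 'a ^ 'n. \<forall>i. \<omega> $ i \<in> A}" unfolding eq using fin by simp
  have "card (PiE (UNIV :: 'n set) (\<lambda>_. A)) = card A ^ CARD('n)"
    by (simp add: card_PiE)
  then show "card {\<omega> :: 'a ^ 'n. \<forall>i. \<omega> $ i \<in> A} \<le> card A ^ CARD('n)"
    unfolding eq using card_image_le[OF fin] by metis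
qed

lemma lattice_vec_wt:
  "lattice_vec (wt a) = (\<Sum>v\<in>keys a. real (lookup a v) *\<^sub>R lattice_vec v)"
  by (simp add: wt_def lattice_vec_sum lattice_vec_scale)

text \<open>
  The steps have the form \<open>1 / N\<close> so that multiplication by \<open>N\<close> takes the points reached to lattice
  points.
\<close>

lemma rel_interior_extend:
  fixes S :: "'a::euclidean_space set"
  assumes "convex S" "z \<in> rel_interior S" "z + v \<in> affine hull S"
  shows "\<exists>N0::nat. N0 > 0 \<and> (\<forall>N\<ge>N0. z + (1 / real N) *\<^sub>R v \<in> S)"
proof -
  have "z \<in> affine hull S" using assms(2) by (meson hull_inc rel_interior_subset subsetD)
  then have "2 *\<^sub>R z + (-1) *\<^sub>R (z + v) \<in> affine hull S"
    using assms(3) by (intro mem_affine[OF affine_affine_hull]) auto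
  then have "z - v \<in> affine hull S" by (simp add: scaleR_2)
  then obtain m where m: "m > 1" "\<And>e. e > 1 \<Longrightarrow> e \<le> m \<Longrightarrow> (1 - e) *\<^sub>R (z - v) + e *\<^sub>R z \<in> S"
    using convex_rel_interior_if[OF assms(1,2)] by blast
  obtain N0 :: nat where N0: "N0 > 0" "inverse (real N0) < m - 1"
    using m(1) real_arch_inverse[of "m - 1"] by auto
  have "z + (1 / real N) *\<^sub>R v \<in> S" if "N \<ge> N0" for N
  proof -
    have "inverse (real N) \<le> inverse (real N0)" using that N0(1) by (simp add: le_imp_inverse_le)
    then have "(1 - (1 + 1 / real N)) *\<^sub>R (z - v) + (1 + 1 / real N) *\<^sub>R z \<in> S"
      using that N0 by (intro m(2)) (auto simp: inverse_eq_divide)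
    moreover have "(1 - (1 + 1 / real N)) *\<^sub>R (z - v) + (1 + 1 / real N) *\<^sub>R z = z + (1 / real N) *\<^sub>R v"
      by (simp add: algebra_simps)
    ultimately show ?thesis by simp
  qed
  with N0(1) show ?thesis by blast
qed

locale normal_lattice_polytope =
  fixes P :: "(real ^ 'n::finite) set"
  assumes lattice: "lattice_polytope P"
    and full_dim: "aff_dim P = int CARD('n)"
    and normal: "normal_polytope P"
begin

lemma polytope_P: "polytope P"
  using lattice unfolding lattice_polytope_def polytope_def by blast

lemma polyhedron_P: "polyhedron P" and convex_P: "convex P" and bounded_P: "bounded P"
  using polytope_P by (auto simp: polytope_imp_polyhedron polytope_imp_convex polytope_imp_bounded)

lemma P_face: "P \<in> faces P"
  using full_dim convex_P by (auto simp: faces_def face_of_refl)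

lemma coordinate_bound: "\<exists>B::nat. B > 0 \<and> (\<forall>x\<in>P. \<forall>i. \<bar>x $ i\<bar> \<le> real B)"
proof -
  obtain b where b: "b > 0" "\<And>x. x \<in> P \<Longrightarrow> norm x \<le> b" using bounded_P bounded_pos by blast
  obtain B :: nat where B: "b \<le> real B" using real_arch_simple by blast
  show ?thesis
  proof (intro exI conjI ballI allI)
    show "B > 0" using B b(1) by (cases B) auto
    fix x i assume "x \<in> P"
    then show "\<bar>x $ i\<bar> \<le> real B" using b(2)[of x] B component_le_norm_cart[of x i] by linarith
  qed
qed

lemma finite_lattice_points: "finite (lattice_points P)"
proof -
  obtain B :: nat where B: "\<forall>x\<in>P. \<forall>i. \<bar>x $ i\<bar> \<le> real B"
    using coordinate_bound by blast
  have "lattice_points P \<subseteq> {\<omega>. \<forall>i. \<omega> $ i \<in> {- int B..int B}}"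
  proof (clarify)
    fix \<omega> i assume "\<omega> \<in> lattice_points P"
    then have "\<bar>real_of_int (\<omega> $ i)\<bar> \<le> real B"
      using B[rule_format, of "lattice_vec \<omega>" i] by (simp add: mem_lattice_points lattice_vec_def)
    then have "real_of_int \<bar>\<omega> $ i\<bar> \<le> real_of_int (int B)" by simp
    then have "\<bar>\<omega> $ i\<bar> \<le> int B" by (simp only: of_int_le_iff)
    then show "\<omega> $ i \<in> {- int B..int B}" by (simp add: abs_le_iff)
  qed
  then show ?thesis by (rule finite_subset) (rule finite_card_vec_box(1), simp)
qed

lemma face_subset: "\<sigma> \<in> faces P \<Longrightarrow> \<sigma> \<subseteq> P"
  by (auto simp: faces_def dest: face_of_imp_subset)

lemma face_convex: "\<sigma> \<in> faces P \<Longrightarrow> convex \<sigma>"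
  by (auto simp: faces_def dest: face_of_imp_convex)

lemma face_polyhedron: "\<sigma> \<in> faces P \<Longrightarrow> polyhedron \<sigma>"
  by (metis (no_types, lifting) faces_def mem_Collect_eq face_of_polytope_polytope polytope_P polytope_imp_polyhedron)

lemma face_of_face_iff: "\<sigma> \<in> faces P \<Longrightarrow> \<tau> face_of \<sigma> \<and> \<tau> \<noteq> {} \<longleftrightarrow> \<tau> \<in> faces P \<and> \<tau> \<subseteq> \<sigma>"
  unfolding faces_def using face_of_face[of \<sigma> P \<tau>] by auto

lemma finite_faces: "finite (faces P)"
  using finite_polytope_faces[OF polytope_P] by (rule finite_subset[rotated]) (auto simp: faces_def)

lemma lattice_points_face_subset: "\<sigma> \<in> faces P \<Longrightarrow> lattice_points \<sigma> \<subseteq> lattice_points P"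
  using face_subset[of \<sigma>] by (auto simp: mem_lattice_points)

text \<open>
  All faces of a polytope are exposed.
\<close>

lemma face_functional:
  assumes "\<sigma> \<in> faces P"
  obtains u \<beta> where "\<And>x. x \<in> P \<Longrightarrow> u \<bullet> x \<le> \<beta>" "\<And>x. x \<in> P \<Longrightarrow> x \<in> \<sigma> \<longleftrightarrow> u \<bullet> x = \<beta>"
proof -
  have "\<sigma> exposed_face_of P"
    using assms exposed_face_of_polyhedron[OF polyhedron_P] by (auto simp: faces_def)
  then obtain u \<beta> where "P \<subseteq> {x. u \<bullet> x \<le> \<beta>}" "\<sigma> = P \<inter> {x. u \<bullet> x = \<beta>}"
    unfolding exposed_face_of_def by blast
  then show thesis using that[of u \<beta>] by blast
qed

lemma face_hull:
  assumes "\<sigma> \<in> faces P"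
  shows "\<sigma> = convex hull (lattice_vec ` lattice_points \<sigma>)"
proof -
  obtain F where F: "finite F" "P = convex hull (lattice_vec ` F)"
    using lattice by (auto simp: lattice_polytope_def)
  then have "compact (lattice_vec ` F)" by (simp add: finite_imp_compact)
  moreover have "\<sigma> face_of convex hull (lattice_vec ` F)" using assms F(2) by (simp add: faces_def)
  ultimately obtain S' where S': "S' \<subseteq> lattice_vec ` F" "\<sigma> = convex hull S'"
    by (rule face_of_convex_hull_subset)
  have "S' \<subseteq> lattice_vec ` lattice_points \<sigma>"
  proof
    fix x assume "x \<in> S'"
    then obtain \<omega> where "x = lattice_vec \<omega>" using S'(1) by blast
    moreover have "x \<in> \<sigma>" unfolding S'(2) using \<open>x \<in> S'\<close> by (rule hull_inc)
    ultimately show "x \<in> lattice_vec ` lattice_points \<sigma>" by (auto simp: mem_lattice_points)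
  qed
  then have "convex hull S' \<subseteq> convex hull (lattice_vec ` lattice_points \<sigma>)" by (rule hull_mono)
  then have "\<sigma> \<subseteq> convex hull (lattice_vec ` lattice_points \<sigma>)" unfolding S'(2)[symmetric] .
  moreover have "convex hull (lattice_vec ` lattice_points \<sigma>) \<subseteq> \<sigma>"
    by (rule hull_minimal) (use face_convex[OF assms] in \<open>auto simp: mem_lattice_points\<close>)
  ultimately show ?thesis by blast
qed

lemma face_subset_iff:
  assumes "\<sigma> \<in> faces P" "\<tau> \<in> faces P"
  shows "\<sigma> \<subseteq> \<tau> \<longleftrightarrow> lattice_points \<sigma> \<subseteq> lattice_points \<tau>"
proof
  assume "lattice_points \<sigma> \<subseteq> lattice_points \<tau>"
  then have "lattice_vec ` lattice_points \<sigma> \<subseteq> lattice_vec ` lattice_points \<tau>" by blast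
  then show "\<sigma> \<subseteq> \<tau>" using face_hull assms hull_mono by metis
qed (auto simp: mem_lattice_points)

lemma lattice_points_face_nonempty: "\<sigma> \<in> faces P \<Longrightarrow> lattice_points \<sigma> \<noteq> {}"
  using face_hull[of \<sigma>] by (auto simp: faces_def)

text \<open>
  The functional \<open>\<beta> - u \<bullet> x\<close> is nonnegative on \<open>P\<close>, so the sum of its values over the factors of the
  monomial vanishes only if each factor lies on \<open>\<sigma>\<close>.
\<close>

lemma keys_subset_face_iff:
  assumes "keys a \<subseteq> lattice_points P"
    and u: "\<And>x. x \<in> P \<Longrightarrow> u \<bullet> x \<le> \<beta>" "\<And>x. x \<in> P \<Longrightarrow> x \<in> \<sigma> \<longleftrightarrow> u \<bullet> x = \<beta>"
  shows "keys a \<subseteq> lattice_points \<sigma> \<longleftrightarrow> u \<bullet> lattice_vec (wt a) = \<beta> * real (mdeg a)"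
proof -
  let ?t = "\<lambda>v. real (lookup a v) * (\<beta> - u \<bullet> lattice_vec v)"
  have eq: "\<beta> * real (mdeg a) - u \<bullet> lattice_vec (wt a) = (\<Sum>v\<in>keys a. ?t v)"
    by (simp add: lattice_vec_wt inner_sum_right mdeg_def sum_distrib_left sum_subtractf algebra_simps)
  have P: "lattice_vec v \<in> P" if "v \<in> keys a" for v
    using that assms(1) by (auto simp: mem_lattice_points)
  have "(\<Sum>v\<in>keys a. ?t v) = 0 \<longleftrightarrow> (\<forall>v\<in>keys a. ?t v = 0)"
    by (rule sum_nonneg_eq_0_iff) (use P u(1) in auto)
  also have "\<dots> \<longleftrightarrow> (\<forall>v\<in>keys a. lattice_vec v \<in> \<sigma>)"
    using P u(2) by (intro ball_cong) (auto simp: in_keys_iff)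
  finally show ?thesis unfolding eq[symmetric] by (auto simp: mem_lattice_points)
qed

text \<open>
  The functional that exposes a face reads off from the weight whether a monomial is supported in it.
\<close>

lemma keys_subset_face_cong:
  assumes "\<sigma> \<in> faces P" "keys a \<subseteq> lattice_points P"
    "keys b \<subseteq> lattice_points P" "ewt a = ewt b"
  shows "keys a \<subseteq> lattice_points \<sigma> \<longleftrightarrow> keys b \<subseteq> lattice_points \<sigma>"
proof -
  obtain u \<beta> where u: "\<And>x. x \<in> P \<Longrightarrow> u \<bullet> x \<le> \<beta>" "\<And>x. x \<in> P \<Longrightarrow> x \<in> \<sigma> \<longleftrightarrow> u \<bullet> x = \<beta>"
    using face_functional[OF assms(1)] by blast
  show ?thesis
    using keys_subset_face_iff[OF assms(2) u] keys_subset_face_iff[OF assms(3) u] assms(4)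
    by (simp add: ewt_def)
qed

lemma wt_average_in:
  assumes "convex S" "keys a \<subseteq> lattice_points S" "mdeg a \<ge> 1"
  shows "(1 / real (mdeg a)) *\<^sub>R lattice_vec (wt a) \<in> S"
proof -
  have "(\<Sum>v\<in>keys a. (real (lookup a v) / real (mdeg a)) *\<^sub>R lattice_vec v) \<in> S"
  proof (rule convex_sum[OF _ assms(1)])
    show "(\<Sum>v\<in>keys a. real (lookup a v) / real (mdeg a)) = 1"
      unfolding sum_divide_distrib[symmetric] of_nat_sum[symmetric] mdeg_def[symmetric]
      using assms(3) by simp
  qed (use assms(2) in \<open>auto simp: mem_lattice_points\<close>)
  then show ?thesis by (simp add: lattice_vec_wt scaleR_sum_right)
qed

lemma wt_average_in_face_iff:
  assumes "\<sigma> \<in> faces P" "keys a \<subseteq> lattice_points P" "mdeg a \<ge> 1"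
  shows "(1 / real (mdeg a)) *\<^sub>R lattice_vec (wt a) \<in> \<sigma> \<longleftrightarrow> keys a \<subseteq> lattice_points \<sigma>"
proof -
  obtain u \<beta> where u: "\<And>x. x \<in> P \<Longrightarrow> u \<bullet> x \<le> \<beta>" "\<And>x. x \<in> P \<Longrightarrow> x \<in> \<sigma> \<longleftrightarrow> u \<bullet> x = \<beta>"
    using face_functional[OF assms(1)] by blast
  have "(1 / real (mdeg a)) *\<^sub>R lattice_vec (wt a) \<in> P"
    using wt_average_in[OF convex_P] assms(2,3) by blast
  then show ?thesis
    using u(2) keys_subset_face_iff[OF assms(2) u] assms(3) by (simp add: field_simps)
qed

text \<open>
  Normality of \<open>P\<close> yields a monomial supported in \<open>P\<close>, and the position of its weight forces the
  support into the face.
\<close>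

lemma normal_monomial:
  assumes "\<sigma> \<in> faces P" "k \<ge> 1" "(1 / real k) *\<^sub>R lattice_vec \<omega> \<in> \<sigma>"
  obtains a where "keys a \<subseteq> lattice_points \<sigma>" "mdeg a = k" "wt a = \<omega>"
proof -
  have "(1 / real k) *\<^sub>R lattice_vec \<omega> \<in> P" using assms(1,3) face_subset by blast
  then have "lattice_vec \<omega> \<in> (*\<^sub>R) (real k) ` P"
    using assms(2) by (intro image_eqI[of _ _ "(1 / real k) *\<^sub>R lattice_vec \<omega>"]) auto
  then obtain \<psi> where \<psi>: "\<forall>i<k. \<psi> i \<in> lattice_points P" "\<omega> = (\<Sum>i<k. \<psi> i)"
    using normal assms(2) unfolding normal_polytope_def by (metis mem_lattice_points)
  define a where "a = (\<Sum>i<k. single (\<psi> i) (1::nat))"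
  have a: "mdeg a = k" "wt a = \<omega>" by (auto simp: a_def mdeg_sum wt_sum \<psi>)
  have "keys a \<subseteq> (\<Union>i\<in>{..<k}. keys (single (\<psi> i) (1::nat)))"
    unfolding a_def by (rule keys_sum)
  then have "keys a \<subseteq> lattice_points P" using \<psi>(1) by (auto split: if_splits)
  then have "keys a \<subseteq> lattice_points \<sigma>"
    using wt_average_in_face_iff[OF assms(1), of a] assms a by simp
  with a show thesis using that by blast
qed

text \<open>
  The smallest face containing \<open>p\<close> has no facet containing \<open>p\<close>, and a polytope is the union of its
  relative interior and its facets.
\<close>

lemma rel_interior_face:
  assumes "p \<in> P"
  obtains \<tau> where "\<tau> \<in> faces P" "p \<in> rel_interior \<tau>"
proof -
  define \<tau> where "\<tau> = \<Inter>{F. F face_of P \<and> p \<in> F}"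
  have "P \<in> {F. F face_of P \<and> p \<in> F}" using assms convex_P by (simp add: face_of_refl)
  then have "\<tau> face_of P" unfolding \<tau>_def by (intro face_of_Inter) auto
  moreover have "p \<in> \<tau>" by (simp add: \<tau>_def)
  ultimately have \<tau>: "\<tau> \<in> faces P" by (auto simp: faces_def)
  have "p \<notin> F" if F: "F facet_of \<tau>" for F
  proof
    assume "p \<in> F"
    have "F face_of P" using F \<open>\<tau> face_of P\<close> facet_of_imp_face_of face_of_trans by blast
    then have "\<tau> \<subseteq> F" using \<open>p \<in> F\<close> by (auto simp: \<tau>_def)
    then show False using F by (metis facet_of_imp_subset facet_of_irrefl subset_antisym)
  qed
  then have "p \<in> rel_interior \<tau>"
    using \<open>p \<in> \<tau>\<close> rel_interior_of_polyhedron[OF face_polyhedron[OF \<tau>]] by blast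
  with \<tau> show thesis using that by blast
qed

lemma face_subset_of_rel_interior:
  assumes "\<tau> \<in> faces P" "\<sigma> \<in> faces P" "p \<in> rel_interior \<tau>" "p \<in> \<sigma>"
  shows "\<tau> \<subseteq> \<sigma>"
  using subset_of_face_of[of \<sigma> P \<tau>] assms face_subset[OF assms(1)] by (auto simp: faces_def)

definition sum_monomial :: "(int ^ 'n) set \<Rightarrow> (int ^ 'n \<Rightarrow>\<^sub>0 nat)" where
  "sum_monomial F = (\<Sum>\<psi>\<in>F. single \<psi> 1)"

lemma sum_monomial:
  assumes "finite F"
  shows "keys (sum_monomial F) = F" "mdeg (sum_monomial F) = card F"
    "wt (sum_monomial F) = \<Sum>F"
proof -
  have "lookup (sum_monomial F) v = (if v \<in> F then 1 else 0)" for v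
    using assms by (simp add: sum_monomial_def lookup_sum lookup_single when_def)
  then show "keys (sum_monomial F) = F" by (auto simp: in_keys_iff split: if_splits)
  show "mdeg (sum_monomial F) = card F" by (simp add: sum_monomial_def mdeg_sum)
  show "wt (sum_monomial F) = \<Sum>F" by (simp add: sum_monomial_def wt_sum)
qed

text \<open>
  The smallest face containing the barycentre of \<open>F\<close> contains all of \<open>F\<close>.
\<close>

lemma average_rel_interior:
  assumes "F \<subseteq> lattice_points P" "F \<noteq> {}"
  obtains \<tau> where "\<tau> \<in> faces P" "F \<subseteq> lattice_points \<tau>"
    "(1 / real (card F)) *\<^sub>R lattice_vec (\<Sum>F) \<in> rel_interior \<tau>"
proof -
  have fin: "finite F" using assms finite_lattice_points finite_subset by blast
  then have card: "card F \<ge> 1" using assms(2) by (simp add: Suc_le_eq card_gt_0_iff)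
  let ?p = "(1 / real (card F)) *\<^sub>R lattice_vec (\<Sum>F)"
  have "?p \<in> P" using wt_average_in[OF convex_P, of "sum_monomial F"] sum_monomial[OF fin] assms card by simp
  then obtain \<tau> where \<tau>: "\<tau> \<in> faces P" "?p \<in> rel_interior \<tau>" by (rule rel_interior_face)
  then have "?p \<in> \<tau>" using rel_interior_subset by blast
  then have "F \<subseteq> lattice_points \<tau>"
    using wt_average_in_face_iff[OF \<tau>(1), of "sum_monomial F"] sum_monomial[OF fin] assms(1) card by simp
  with \<tau> show thesis using that by blast
qed

lemma face_average_rel_interior:
  assumes "\<tau> \<in> faces P"
  shows "(1 / real (card (lattice_points \<tau>))) *\<^sub>R lattice_vec (\<Sum>(lattice_points \<tau>)) \<in> rel_interior \<tau>"
proof -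
  let ?F = "lattice_points \<tau>"
  let ?p = "(1 / real (card ?F)) *\<^sub>R lattice_vec (\<Sum>?F)"
  have F: "?F \<subseteq> lattice_points P" "?F \<noteq> {}"
    using assms lattice_points_face_subset lattice_points_face_nonempty by auto
  then obtain \<rho> where \<rho>: "\<rho> \<in> faces P" "?F \<subseteq> lattice_points \<rho>" "?p \<in> rel_interior \<rho>"
    by (rule average_rel_interior)
  have fin: "finite ?F" using F finite_lattice_points finite_subset by blast
  then have "card ?F \<ge> 1" using F(2) by (simp add: Suc_le_eq card_gt_0_iff)
  then have "?p \<in> \<tau>"
    using wt_average_in[OF face_convex[OF assms], of "sum_monomial ?F"] sum_monomial[OF fin] by simp
  then have "\<rho> \<subseteq> \<tau>" using face_subset_of_rel_interior \<rho> assms by blast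
  moreover have "\<tau> \<subseteq> \<rho>" using face_subset_iff[OF assms \<rho>(1)] \<rho>(2) by simp
  ultimately show ?thesis using \<rho>(3) by simp
qed

text \<open>
  The support of a nonzero point of the cone is the set of lattice points of a face: the smallest
  face containing the support. By normality, a multiple of the sum of the support is, for every
  lattice point \<open>\<xi>\<close> of the face, the weight of a monomial involving \<open>\<xi>\<close>.
\<close>

lemma toric_cone_support_face:
  assumes "\<sigma> \<in> faces P" and x: "x \<in> toric_cone P \<sigma>" "x \<noteq> (\<lambda>_. 0)"
  obtains \<tau> where "\<tau> \<in> faces P" "\<tau> \<subseteq> \<sigma>" "{\<omega>. x \<omega> \<noteq> 0} = lattice_points \<tau>"
proof -
  define F where "F = {\<omega>. x \<omega> \<noteq> 0}"
  have F: "F \<subseteq> lattice_points \<sigma>" "F \<noteq> {}"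
    using x toric_cone_support[OF x(1)] by (auto simp: F_def)
  then have FP: "F \<subseteq> lattice_points P" using assms(1) lattice_points_face_subset by blast
  then have fin: "finite F" using finite_lattice_points finite_subset by blast
  let ?n = "card F" and ?p = "(1 / real (card F)) *\<^sub>R lattice_vec (\<Sum>F)"
  obtain \<tau> where \<tau>: "\<tau> \<in> faces P" "F \<subseteq> lattice_points \<tau>" "?p \<in> rel_interior \<tau>"
    using average_rel_interior[OF FP F(2)] by blast
  have n: "?n \<ge> 1" using F(2) fin by (simp add: Suc_le_eq card_gt_0_iff)
  have "?p \<in> \<sigma>"
    using wt_average_in_face_iff[OF assms(1), of "sum_monomial F"] sum_monomial[OF fin] F FP n by simp
  then have "\<tau> \<subseteq> \<sigma>" using face_subset_of_rel_interior assms(1) \<tau> by blast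
  moreover have "\<xi> \<in> F" if \<xi>: "\<xi> \<in> lattice_points \<tau>" for \<xi>
  proof -
    have pt: "?p \<in> \<tau>" using \<tau>(3) rel_interior_subset by blast
    have "2 *\<^sub>R ?p + (-1) *\<^sub>R lattice_vec \<xi> \<in> affine hull \<tau>"
      by (rule mem_affine[OF affine_affine_hull]) (use pt \<xi> in \<open>auto simp: mem_lattice_points hull_inc\<close>)
    then have "?p + (?p - lattice_vec \<xi>) \<in> affine hull \<tau>"
      by (simp only: scaleR_2 scaleR_minus1_left add_uminus_conv_diff add_diff_eq)
    then obtain N0 :: nat where N0: "N0 > 0"
      "\<And>N. N \<ge> N0 \<Longrightarrow> ?p + (1 / real N) *\<^sub>R (?p - lattice_vec \<xi>) \<in> \<tau>"
      using rel_interior_extend[OF face_convex[OF \<tau>(1)] \<tau>(3)] by blast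
    \<comment> \<open>\<open>N + 1\<close> is a multiple of \<open>card F\<close>, so \<open>(N + 1) p - \<xi>\<close> is a lattice point, and it lies in \<open>N \<tau>\<close>.\<close>
    define k where "k = Suc N0"
    define N where "N = k * ?n - 1"
    have "k * 1 \<le> k * ?n" using n by (intro mult_le_mono2) auto
    then have N: "N \<ge> N0" "N \<ge> 1" "real N = real k * real ?n - 1"
      using N0(1) by (auto simp: N_def k_def of_nat_diff algebra_simps)
    have "p + (1 / real N) *\<^sub>R (p - q) = (1 / real N) *\<^sub>R ((real N + 1) *\<^sub>R p - q)"
      for p q :: "real ^ 'n" using N(2) by (simp add: vec_eq_iff field_simps)
    then have "?p + (1 / real N) *\<^sub>R (?p - lattice_vec \<xi>)
        = (1 / real N) *\<^sub>R (((real N + 1) *\<^sub>R ?p) - lattice_vec \<xi>)" .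
    also have "(real N + 1) *\<^sub>R ?p = lattice_vec (int k *s \<Sum>F)"
      using N(3) n by (simp add: lattice_vec_scale)
    also have "lattice_vec (int k *s \<Sum>F) - lattice_vec \<xi> = lattice_vec (int k *s \<Sum>F - \<xi>)"
      by (simp add: lattice_vec_def vec_eq_iff)
    finally have "(1 / real N) *\<^sub>R lattice_vec (int k *s \<Sum>F - \<xi>) \<in> \<tau>" using N0(2)[OF N(1)] by simp
    then obtain a where a: "keys a \<subseteq> lattice_points \<tau>" "mdeg a = N"
      "wt a = int k *s \<Sum>F - \<xi>"
      using normal_monomial[OF \<tau>(1) N(2)] by blast
    define b where "b = (\<Sum>\<psi>\<in>F. single \<psi> k)"
    have bl: "lookup b v = (if v \<in> F then k else 0)" for v
      using fin by (simp add: b_def lookup_sum lookup_single when_def)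
    have kb: "keys b = F" using bl by (auto simp: in_keys_iff k_def split: if_splits)
    have "ewt b = ewt (single \<xi> 1 + a)"
    proof -
      have "mdeg b = N + 1" using N(2) by (auto simp: b_def mdeg_sum N_def mult.commute)
      moreover have "wt b = int k *s \<Sum>F"
        by (simp add: b_def wt_sum vec_eq_iff sum_distrib_left)
      ultimately show ?thesis
        by (simp add: ewt_def mdeg_add wt_add a)
    qed
    moreover have "keys (single \<xi> (1::nat) + a) \<subseteq> lattice_points P"
      using a(1) \<xi> lattice_points_face_subset[OF \<tau>(1)] by (auto simp: keys_add_nat)
    ultimately have "mon b x = mon (single \<xi> 1 + a) x"
      by (intro toric_cone_binomial[OF x(1)]) (simp add: kb FP)
    moreover have "mon b x \<noteq> 0" by (simp add: mon_eq_0_iff kb F_def)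
    ultimately have "x \<xi> \<noteq> 0" by (auto simp: mon_add)
    then show ?thesis by (simp add: F_def)
  qed
  ultimately show thesis using that[of \<tau>] \<tau> by (auto simp: F_def)
qed

end

section \<open>Lattice bases adapted to flags of faces\<close>

context normal_lattice_polytope
begin

text \<open>
  A facet \<open>\<tau>\<close> of a face \<open>\<sigma>\<close> has a lattice point \<open>\<xi>\<^sub>1\<close> of \<open>\<sigma>\<close> at lattice distance one: take
  one of smallest positive distance and divide with remainder. Near the barycentre of the
  lattice points of \<open>\<tau>\<close> the cone over \<open>\<sigma>\<close> is a half space, so the remainder becomes a lattice point of
  a multiple of \<open>\<sigma>\<close> after adding a large multiple of the barycentre; normality writes it as a sum of
  lattice points of \<open>\<sigma>\<close>, whose distances to \<open>\<tau>\<close> are too small not to vanish.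
\<close>

lemma facet_lattice_point:
  assumes \<sigma>: "\<sigma> \<in> faces P" and \<tau>: "\<tau> \<in> faces P" "\<tau> \<subseteq> \<sigma>" "aff_dim \<tau> = aff_dim \<sigma> - 1"
  shows "\<exists>\<xi>1 \<in> lattice_points \<sigma> - lattice_points \<tau>. \<forall>\<xi> \<in> lattice_points \<sigma>. \<exists>j a b.
    keys a \<subseteq> lattice_points \<tau> \<and> keys b \<subseteq> lattice_points \<tau> \<and>
    ewt (single \<xi> 1 + b) = ewt (single \<xi>1 j + a)"
proof -
  obtain u \<beta> where u: "\<And>x. x \<in> P \<Longrightarrow> u \<bullet> x \<le> \<beta>" "\<And>x. x \<in> P \<Longrightarrow> x \<in> \<tau> \<longleftrightarrow> u \<bullet> x = \<beta>"
    using face_functional[OF \<tau>(1)] by blast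
  define \<eta> where "\<eta> \<omega> = \<beta> - u \<bullet> lattice_vec \<omega>" for \<omega>
  have \<eta>: "\<eta> \<omega> \<ge> 0" "\<eta> \<omega> = 0 \<longleftrightarrow> \<omega> \<in> lattice_points \<tau>" if "\<omega> \<in> lattice_points P" for \<omega>
    using u[of "lattice_vec \<omega>"] that by (auto simp: \<eta>_def mem_lattice_points)
  define D where "D = lattice_points \<sigma> - lattice_points \<tau>"
  have "\<not> \<sigma> \<subseteq> \<tau>" using \<tau> by auto
  then have D: "D \<noteq> {}" using face_subset_iff[OF \<sigma> \<tau>(1)] by (auto simp: D_def)
  have "finite D"
    using lattice_points_face_subset[OF \<sigma>] finite_lattice_points finite_subset by (auto simp: D_def)
  then have "Min (\<eta> ` D) \<in> \<eta> ` D" using D by simp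
  then obtain \<xi>1 where \<xi>1: "\<xi>1 \<in> D" "\<eta> \<xi>1 = Min (\<eta> ` D)" by auto
  have min: "\<eta> \<xi>1 \<le> \<eta> \<xi>" if "\<xi> \<in> D" for \<xi> using \<open>finite D\<close> that by (simp add: \<xi>1(2))
  have \<xi>1P: "\<xi>1 \<in> lattice_points P" using \<xi>1(1) lattice_points_face_subset[OF \<sigma>] by (auto simp: D_def)
  then have \<eta>1: "\<eta> \<xi>1 > 0" using \<eta>[of \<xi>1] \<xi>1(1) by (auto simp: D_def)
  define F where "F = lattice_points \<tau>"
  have fin: "finite F" using lattice_points_face_subset[OF \<tau>(1)] finite_lattice_points finite_subset
    by (auto simp: F_def)
  have "F \<noteq> {}" using lattice_points_face_nonempty[OF \<tau>(1)] by (simp add: F_def)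
  then obtain \<psi>0 where \<psi>0: "\<psi>0 \<in> F" by blast
  have n: "card F \<ge> 1" using fin \<open>F \<noteq> {}\<close> by (simp add: Suc_le_eq card_gt_0_iff)
  define p where "p = (1 / real (card F)) *\<^sub>R lattice_vec (\<Sum>F)"
  have p: "p \<in> rel_interior \<tau>" using face_average_rel_interior[OF \<tau>(1)] by (simp add: p_def F_def)
  then have p\<tau>: "p \<in> \<tau>" using rel_interior_subset by blast
  then have up: "u \<bullet> p = \<beta>" using u(2) face_subset[OF \<tau>(1)] by blast
  have hull: "x \<in> affine hull \<tau>" if "x \<in> affine hull \<sigma>" "u \<bullet> x = \<beta>" for x
  proof -
    let ?A = "affine hull \<sigma> \<inter> {x. u \<bullet> x = \<beta>}"
    have A: "affine ?A" by (intro affine_Int affine_affine_hull affine_hyperplane)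
    have "\<tau> \<subseteq> ?A" using \<tau>(2) u(2) face_subset[OF \<tau>(1)] by (auto simp: hull_inc)
    then have sub: "affine hull \<tau> \<subseteq> ?A" using A by (rule hull_minimal)
    have "lattice_vec \<xi>1 \<in> affine hull \<sigma>" "lattice_vec \<xi>1 \<notin> ?A"
      using \<xi>1(1) \<eta>1 by (auto simp: D_def mem_lattice_points hull_inc \<eta>_def)
    moreover have "affine hull ?A = ?A" using A by (simp add: affine_hull_eq)
    ultimately have "affine hull ?A \<subset> affine hull \<sigma>" by blast
    then have "aff_dim ?A < aff_dim \<sigma>" by (rule aff_dim_psubset)
    moreover have "aff_dim \<tau> \<le> aff_dim ?A" using \<open>\<tau> \<subseteq> ?A\<close> by (rule aff_dim_subset)
    ultimately have "aff_dim (affine hull \<tau>) = aff_dim ?A" using \<tau>(3) by simp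
    then have "affine hull \<tau> = ?A"
      using affine_dim_equal[OF affine_affine_hull A _ sub] p\<tau> by (auto simp: hull_inc)
    with that show ?thesis by blast
  qed
  show ?thesis
  proof (rule bexI[of _ \<xi>1], rule ballI)
    show "\<xi>1 \<in> lattice_points \<sigma> - lattice_points \<tau>" using \<xi>1 by (simp add: D_def)
  next
    fix \<xi> assume \<xi>: "\<xi> \<in> lattice_points \<sigma>"
    then have \<xi>P: "\<xi> \<in> lattice_points P" using lattice_points_face_subset[OF \<sigma>] by blast
    define j where "j = nat \<lfloor>\<eta> \<xi> / \<eta> \<xi>1\<rfloor>"
    define r where "r = \<eta> \<xi> - real j * \<eta> \<xi>1"
    have "real j \<le> \<eta> \<xi> / \<eta> \<xi>1" "\<eta> \<xi> / \<eta> \<xi>1 < real j + 1"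
      using \<eta>(1)[OF \<xi>P] \<eta>1 by (auto simp: j_def)
    then have r: "0 \<le> r" "r < \<eta> \<xi>1" using \<eta>1 by (auto simp: r_def field_simps)
    \<comment> \<open>\<open>w\<close> is the remainder of the division, moved to a base point in \<open>\<tau>\<close>; \<open>v'\<close> is its part parallel to \<open>\<tau>\<close>.\<close>
    define w where "w = \<xi> - \<psi>0 - int j *s (\<xi>1 - \<psi>0)"
    define v where "v = lattice_vec w"
    have v: "v = (lattice_vec \<xi> - lattice_vec \<psi>0) - real j *\<^sub>R (lattice_vec \<xi>1 - lattice_vec \<psi>0)"
      by (simp add: v_def w_def lattice_vec_def vec_eq_iff right_diff_distrib)
    have u0: "u \<bullet> lattice_vec \<psi>0 = \<beta>"
      using \<eta>(2)[of \<psi>0] \<psi>0 lattice_points_face_subset[OF \<tau>(1)] by (auto simp: \<eta>_def F_def)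
    have uv: "u \<bullet> v = - r" by (simp add: v inner_diff_right u0 r_def \<eta>_def algebra_simps)
    define \<theta> where "\<theta> = r / \<eta> \<xi>1"
    have \<theta>: "0 \<le> \<theta>" "\<theta> < 1" using r \<eta>1 by (auto simp: \<theta>_def)
    define v' where "v' = v - \<theta> *\<^sub>R (lattice_vec \<xi>1 - p)"
    have uv': "u \<bullet> v' = 0"
    proof -
      have "u \<bullet> lattice_vec \<xi>1 = \<beta> - \<eta> \<xi>1" by (simp add: \<eta>_def)
      then have "u \<bullet> v' = - r + \<theta> * \<eta> \<xi>1" by (simp add: v'_def inner_diff_right uv up)
      then show ?thesis using \<eta>1 by (simp add: \<theta>_def)
    qed
    have mem: "lattice_vec \<xi> \<in> affine hull \<sigma>" "lattice_vec \<xi>1 \<in> affine hull \<sigma>"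
      "lattice_vec \<psi>0 \<in> affine hull \<sigma>" "p \<in> affine hull \<sigma>"
      using \<xi> \<xi>1(1) \<psi>0 \<tau>(2) p\<tau> by (auto simp: D_def F_def mem_lattice_points intro: hull_inc)
    have "((p + 2 *\<^sub>R (lattice_vec \<xi> - lattice_vec \<psi>0))
        + (-2 * real j) *\<^sub>R (lattice_vec \<xi>1 - lattice_vec \<psi>0))
        + (-2 * \<theta>) *\<^sub>R (lattice_vec \<xi>1 - p) \<in> affine hull \<sigma>"
      by (intro mem_affine_3_minus affine_affine_hull mem)
    also have "((p + 2 *\<^sub>R (lattice_vec \<xi> - lattice_vec \<psi>0))
        + (-2 * real j) *\<^sub>R (lattice_vec \<xi>1 - lattice_vec \<psi>0))
        + (-2 * \<theta>) *\<^sub>R (lattice_vec \<xi>1 - p) = p + 2 *\<^sub>R v'"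
      by (simp add: v'_def v algebra_simps)
    finally have "p + 2 *\<^sub>R v' \<in> affine hull \<tau>"
      using hull uv' up by (simp add: inner_add_right)
    then obtain N0 :: nat where N0: "N0 > 0" "\<And>N. N \<ge> N0 \<Longrightarrow> p + (1 / real N) *\<^sub>R (2 *\<^sub>R v') \<in> \<tau>"
      using rel_interior_extend[OF face_convex[OF \<tau>(1)] p] by blast
    \<comment> \<open>\<open>M'\<close> is a multiple of \<open>card F\<close>, so \<open>M' p\<close> is a lattice point, and \<open>M' \<ge> 2\<close> bounds \<open>t\<close> by \<open>1\<close>.\<close>
    define M where "M = N0 + 2"
    define M' where "M' = M * card F"
    have "M * 1 \<le> M'" unfolding M'_def using n by (intro mult_le_mono2) auto
    then have M': "M' \<ge> N0" "M' \<ge> 2" and M: "M > 0" by (auto simp: M_def)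
    have "p + (1 / real M') *\<^sub>R v \<in> \<sigma>"
    proof -
      define t where "t = 2 * \<theta> / real M'"
      have "2 * \<theta> \<le> 2 * 1" using \<theta> by simp
      also have "\<dots> \<le> real M'" using M'(2) by simp
      finally have t: "0 \<le> t" "t \<le> 1" using \<theta> M'(2) by (auto simp: t_def divide_le_eq)
      have 1: "(1 - t) *\<^sub>R p + t *\<^sub>R lattice_vec \<xi>1 \<in> \<sigma>"
        using t p\<tau> \<tau>(2) \<xi>1(1) face_convex[OF \<sigma>]
        by (intro convexD) (auto simp: D_def mem_lattice_points)
      have 2: "p + (1 / real M') *\<^sub>R (2 *\<^sub>R v') \<in> \<sigma>" using N0(2)[OF M'(1)] \<tau>(2) by blast
      have "(1/2) *\<^sub>R ((1 - t) *\<^sub>R p + t *\<^sub>R lattice_vec \<xi>1)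
          + (1/2) *\<^sub>R (p + (1 / real M') *\<^sub>R (2 *\<^sub>R v')) \<in> \<sigma>"
        by (rule convexD[OF face_convex[OF \<sigma>] 1 2]) auto
      also have "(1/2) *\<^sub>R ((1 - t) *\<^sub>R p + t *\<^sub>R lattice_vec \<xi>1)
          + (1/2) *\<^sub>R (p + (1 / real M') *\<^sub>R (2 *\<^sub>R v')) = p + (1 / real M') *\<^sub>R v"
        using M'(2) by (simp add: t_def v'_def vec_eq_iff field_simps)
      finally show ?thesis .
    qed
    also have "p + (1 / real M') *\<^sub>R v = (1 / real M') *\<^sub>R lattice_vec (int M *s \<Sum>F + w)"
      using n M by (simp add: p_def v_def M'_def lattice_vec_add lattice_vec_scale scaleR_add_right)
    finally have "(1 / real M') *\<^sub>R lattice_vec (int M *s \<Sum>F + w) \<in> \<sigma>" .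
    moreover have "1 \<le> M'" using M'(2) by simp
    ultimately obtain a where a: "keys a \<subseteq> lattice_points \<sigma>" "mdeg a = M'"
      "wt a = int M *s \<Sum>F + w"
      using normal_monomial[OF \<sigma>] by blast
    have aP: "keys a \<subseteq> lattice_points P" using a(1) lattice_points_face_subset[OF \<sigma>] by blast
    have "(\<Sum>\<omega>\<in>keys a. real (lookup a \<omega>) * \<eta> \<omega>) = r"
    proof -
      have "(\<Sum>\<omega>\<in>keys a. real (lookup a \<omega>) * \<eta> \<omega>)
          = \<beta> * real (mdeg a) - u \<bullet> lattice_vec (wt a)"
        by (simp add: \<eta>_def lattice_vec_wt inner_sum_right mdeg_def sum_distrib_left sum_subtractf algebra_simps)
      also have "lattice_vec (\<Sum>F) = real (card F) *\<^sub>R p" using n by (simp add: p_def)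
      then have "lattice_vec (wt a) = real M' *\<^sub>R p + v"
        by (simp add: a(3) lattice_vec_add lattice_vec_scale v_def M'_def)
      finally show ?thesis by (simp add: a(2) inner_add_right up uv)
    qed
    have a\<tau>: "keys a \<subseteq> lattice_points \<tau>"
    proof
      fix \<omega> assume \<omega>: "\<omega> \<in> keys a"
      show "\<omega> \<in> lattice_points \<tau>"
      proof (rule ccontr)
        assume "\<omega> \<notin> lattice_points \<tau>"
        then have "\<eta> \<xi>1 \<le> \<eta> \<omega>" using min \<omega> a(1) by (auto simp: D_def)
        moreover have "real (lookup a \<omega>) \<ge> 1" using \<omega> by (simp add: in_keys_iff)
        ultimately have "1 * \<eta> \<xi>1 \<le> real (lookup a \<omega>) * \<eta> \<omega>"
          using \<eta>1 by (intro mult_mono) auto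
        also have "\<dots> \<le> (\<Sum>\<omega>\<in>keys a. real (lookup a \<omega>) * \<eta> \<omega>)"
          using \<omega> \<eta>(1) aP by (intro member_le_sum) auto
        finally show False using r(2) \<open>_ = r\<close> by simp
      qed
    qed
    define b where "b = (\<Sum>\<psi>\<in>F. single \<psi> M) + single \<psi>0 j"
    have "keys (\<Sum>\<psi>\<in>F. single \<psi> M) \<subseteq> lattice_points \<tau>"
      using keys_sum[of "\<lambda>\<psi>. single \<psi> M" F] by (auto simp: F_def split: if_splits)
    then have "keys b \<subseteq> lattice_points \<tau>"
      using \<psi>0 by (auto simp: b_def keys_add_nat F_def split: if_splits)
    moreover have "keys (a + single \<psi>0 1) \<subseteq> lattice_points \<tau>"
      using a\<tau> \<psi>0 by (auto simp: keys_add_nat F_def)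
    moreover have "ewt (single \<xi> 1 + b)
        = ewt (single \<xi>1 j + (a + single \<psi>0 1))"
    proof -
      have "(\<Sum>\<psi>\<in>F. int M *s \<psi>) = int M *s \<Sum>F" by (simp add: vec_eq_iff sum_distrib_left)
      then show ?thesis
        by (simp add: ewt_def mdeg_add wt_add mdeg_sum wt_sum b_def a w_def M'_def vec_eq_iff algebra_simps)
    qed
    ultimately show "\<exists>j a b. keys a \<subseteq> lattice_points \<tau> \<and> keys b \<subseteq> lattice_points \<tau> \<and>
        ewt (single \<xi> 1 + b) = ewt (single \<xi>1 j + a)" by blast
  qed
qed

end

text \<open>
  The vectors \<open>(1, \<psi>\<^sub>i)\<close> form a basis of the group generated by all \<open>(1, \<xi>)\<close> with \<open>\<xi>\<close> a lattice point of
  \<open>\<sigma>\<close>, and \<open>\<kappa>\<close> gives the coordinates.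
\<close>

definition affine_lattice_basis ::
    "(real ^ 'n::finite) set \<Rightarrow> nat \<Rightarrow> (nat \<Rightarrow> int ^ 'n) \<Rightarrow> (int ^ 'n \<Rightarrow> nat \<Rightarrow> int) \<Rightarrow> bool" where
  "affine_lattice_basis \<sigma> r \<psi> \<kappa> \<longleftrightarrow>
     (\<forall>i\<le>r. \<psi> i \<in> lattice_points \<sigma>) \<and>
     (\<forall>\<xi>\<in>lattice_points \<sigma>. (\<Sum>i\<le>r. \<kappa> \<xi> i) = 1 \<and> (\<Sum>i\<le>r. \<kappa> \<xi> i *s \<psi> i) = \<xi>) \<and>
     (\<forall>k. (\<Sum>i\<le>r. k i) = 0 \<longrightarrow> (\<Sum>i\<le>r. k i *s \<psi> i) = 0 \<longrightarrow> (\<forall>i\<le>r. k i = 0))"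

text \<open>
  The coordinates of the weight of a monomial with respect to a lattice basis.
\<close>

definition coord :: "(int ^ 'n \<Rightarrow> nat \<Rightarrow> int) \<Rightarrow> (int ^ 'n \<Rightarrow>\<^sub>0 nat) \<Rightarrow> nat \<Rightarrow> int" where
  "coord \<kappa> a i = (\<Sum>v\<in>keys a. int (lookup a v) * \<kappa> v i)"

lemma coord_superset:
  assumes "finite A" "keys a \<subseteq> A"
  shows "coord \<kappa> a i = (\<Sum>v \<in> A. int (lookup a v) * \<kappa> v i)"
  unfolding coord_def by (rule sum.mono_neutral_left) (use assms in \<open>auto simp: in_keys_iff\<close>)

lemma coord_expansion:
  assumes "affine_lattice_basis \<sigma> r \<psi> \<kappa>" "keys a \<subseteq> lattice_points \<sigma>"
  shows "(\<Sum>i\<le>r. coord \<kappa> a i) = int (mdeg a)" "(\<Sum>i\<le>r. coord \<kappa> a i *s \<psi> i) = wt a"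
proof -
  have \<kappa>: "(\<Sum>i\<le>r. \<kappa> v i) = 1" "(\<Sum>i\<le>r. \<kappa> v i *s \<psi> i) = v" if "v \<in> keys a" for v
    using assms that unfolding affine_lattice_basis_def by blast+
  have "(\<Sum>i\<le>r. coord \<kappa> a i) = (\<Sum>v\<in>keys a. int (lookup a v) * (\<Sum>i\<le>r. \<kappa> v i))"
    unfolding coord_def sum_distrib_left by (rule sum.swap)
  then show "(\<Sum>i\<le>r. coord \<kappa> a i) = int (mdeg a)" by (simp add: \<kappa> mdeg_def)
  have "(\<Sum>i\<le>r. coord \<kappa> a i *s \<psi> i) =
      (\<Sum>i\<le>r. \<Sum>v\<in>keys a. int (lookup a v) *s (\<kappa> v i *s \<psi> i))"
    by (simp add: coord_def vec_eq_iff sum_distrib_right mult.assoc)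
  also have "\<dots> = (\<Sum>v\<in>keys a. \<Sum>i\<le>r. int (lookup a v) *s (\<kappa> v i *s \<psi> i))"
    by (rule sum.swap)
  also have "\<dots> = (\<Sum>v\<in>keys a. int (lookup a v) *s (\<Sum>i\<le>r. \<kappa> v i *s \<psi> i))"
    by (simp add: vec_eq_iff sum_distrib_left mult.assoc)
  finally show "(\<Sum>i\<le>r. coord \<kappa> a i *s \<psi> i) = wt a" by (simp add: \<kappa> wt_def)
qed

lemma coord_cong:
  assumes "affine_lattice_basis \<sigma> r \<psi> \<kappa>" "keys a \<subseteq> lattice_points \<sigma>"
    "keys b \<subseteq> lattice_points \<sigma>" "ewt a = ewt b" "i \<le> r"
  shows "coord \<kappa> a i = coord \<kappa> b i"
proof -
  let ?k = "\<lambda>i. coord \<kappa> a i - coord \<kappa> b i"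
  have "(\<Sum>i\<le>r. ?k i) = 0"
    using coord_expansion(1)[OF assms(1,2)] coord_expansion(1)[OF assms(1,3)] assms(4)
    by (simp add: sum_subtractf ewt_def)
  moreover have "(\<Sum>i\<le>r. ?k i *s \<psi> i) = 0"
  proof -
    have "(\<Sum>i\<le>r. ?k i *s \<psi> i) = (\<Sum>i\<le>r. coord \<kappa> a i *s \<psi> i) - (\<Sum>i\<le>r. coord \<kappa> b i *s \<psi> i)"
      by (simp add: vec_eq_iff sum_subtractf algebra_simps)
    then show ?thesis
      using coord_expansion(2)[OF assms(1,2)] coord_expansion(2)[OF assms(1,3)] assms(4)
      by (simp add: ewt_def)
  qed
  ultimately have "\<forall>i\<le>r. ?k i = 0" using assms(1) unfolding affine_lattice_basis_def by blast
  then show ?thesis using assms(5) by simp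
qed

lemma basis_coord_basis:
  assumes "affine_lattice_basis \<sigma> r \<psi> \<kappa>" "i \<le> r" "l \<le> r"
  shows "\<kappa> (\<psi> l) i = (if i = l then 1 else 0)"
proof -
  let ?k = "\<lambda>i. \<kappa> (\<psi> l) i - (if i = l then 1 else 0)"
  have l: "\<psi> l \<in> lattice_points \<sigma>" using assms by (simp add: affine_lattice_basis_def)
  then have "(\<Sum>i\<le>r. ?k i) = 0"
    using assms by (simp add: affine_lattice_basis_def sum_subtractf)
  moreover have "(\<Sum>i\<le>r. ?k i *s \<psi> i) = 0"
  proof -
    have "(\<Sum>i\<le>r. ?k i *s \<psi> i) = (\<Sum>i\<le>r. \<kappa> (\<psi> l) i *s \<psi> i) - (\<Sum>i\<le>r. if i = l then \<psi> i else 0)"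
      unfolding sum_subtractf[symmetric] by (rule sum.cong) (auto simp: vec_eq_iff algebra_simps)
    then show ?thesis using assms l by (simp add: affine_lattice_basis_def)
  qed
  ultimately have "\<forall>i\<le>r. ?k i = 0" using assms(1) unfolding affine_lattice_basis_def by blast
  then show ?thesis using assms(2) by simp
qed

context normal_lattice_polytope
begin

text \<open>
  A basis for a facet is completed by a lattice point at lattice distance one; the new coordinate is
  the lattice distance from the facet.
\<close>

lemma affine_lattice_basis_step:
  assumes \<sigma>: "\<sigma> \<in> faces P" and \<tau>: "\<tau> \<in> faces P" "\<tau> \<subseteq> \<sigma>" "aff_dim \<tau> = aff_dim \<sigma> - 1"
    and basis: "affine_lattice_basis \<tau> r \<psi> \<kappa>"
  obtains \<psi>' \<kappa>' where "affine_lattice_basis \<sigma> (Suc r) \<psi>' \<kappa>'"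
    "\<And>i. i \<le> r \<Longrightarrow> \<psi>' i \<in> lattice_points \<tau>"
    "\<And>\<xi>. \<xi> \<in> lattice_points \<sigma> \<Longrightarrow> \<kappa>' \<xi> (Suc r) \<ge> 0"
    "\<And>\<xi>. \<xi> \<in> lattice_points \<sigma> \<Longrightarrow> \<kappa>' \<xi> (Suc r) = 0 \<longleftrightarrow> \<xi> \<in> lattice_points \<tau>"
proof -
  obtain \<xi>1 where \<xi>1: "\<xi>1 \<in> lattice_points \<sigma>" "\<xi>1 \<notin> lattice_points \<tau>"
    and "\<forall>\<xi> \<in> lattice_points \<sigma>. \<exists>j a b.
      keys a \<subseteq> lattice_points \<tau> \<and> keys b \<subseteq> lattice_points \<tau> \<and>
      ewt (single \<xi> 1 + b) = ewt (single \<xi>1 j + a)"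
    using facet_lattice_point[OF \<sigma> \<tau>] by blast
  then obtain j a b where jab: "\<And>\<xi>. \<xi> \<in> lattice_points \<sigma> \<Longrightarrow> keys (a \<xi>) \<subseteq> lattice_points \<tau>"
    "\<And>\<xi>. \<xi> \<in> lattice_points \<sigma> \<Longrightarrow> keys (b \<xi>) \<subseteq> lattice_points \<tau>"
    "\<And>\<xi>. \<xi> \<in> lattice_points \<sigma> \<Longrightarrow>
      ewt (single \<xi> 1 + b \<xi>) = ewt (single \<xi>1 (j \<xi>) + a \<xi>)"
    by metis
  define \<psi>' where "\<psi>' = \<psi>(Suc r := \<xi>1)"
  define \<kappa>' where "\<kappa>' \<xi> i = (if i = Suc r then int (j \<xi>) else coord \<kappa> (a \<xi>) i - coord \<kappa> (b \<xi>) i)" for \<xi> i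
  have \<psi>\<tau>: "\<psi> i \<in> lattice_points \<tau>" if "i \<le> r" for i using basis that by (simp add: affine_lattice_basis_def)
  have \<psi>': "\<psi>' i = \<psi> i" if "i \<le> r" for i using that by (simp add: \<psi>'_def)
  have sub: "lattice_points \<tau> \<subseteq> lattice_points \<sigma>" using \<tau>(2) by (auto simp: mem_lattice_points)
  have "affine_lattice_basis \<sigma> (Suc r) \<psi>' \<kappa>'"
    unfolding affine_lattice_basis_def
  proof (intro conjI allI impI ballI)
    fix i assume "i \<le> Suc r"
    then show "\<psi>' i \<in> lattice_points \<sigma>" using \<psi>\<tau>[of i] sub \<xi>1 by (auto simp: \<psi>'_def le_Suc_eq)
  next
    fix \<xi> assume \<xi>: "\<xi> \<in> lattice_points \<sigma>"
    note E = jab(3)[OF \<xi>]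
    have "(\<Sum>i\<le>r. \<kappa>' \<xi> i) = int (mdeg (a \<xi>)) - int (mdeg (b \<xi>))"
      using coord_expansion(1)[OF basis jab(1)[OF \<xi>]] coord_expansion(1)[OF basis jab(2)[OF \<xi>]]
      by (simp add: \<kappa>'_def sum_subtractf)
    then show "(\<Sum>i\<le>Suc r. \<kappa>' \<xi> i) = 1"
      using E by (simp add: \<kappa>'_def ewt_def mdeg_add)
    have "(\<Sum>i\<le>r. \<kappa>' \<xi> i *s \<psi>' i) = (\<Sum>i\<le>r. coord \<kappa> (a \<xi>) i *s \<psi> i) - (\<Sum>i\<le>r. coord \<kappa> (b \<xi>) i *s \<psi> i)"
      unfolding sum_subtractf[symmetric] by (rule sum.cong) (auto simp: vec_eq_iff algebra_simps \<kappa>'_def \<psi>')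
    also have "\<dots> = wt (a \<xi>) - wt (b \<xi>)"
      using coord_expansion(2)[OF basis jab(1)[OF \<xi>]] coord_expansion(2)[OF basis jab(2)[OF \<xi>]] by simp
    finally have 1: "(\<Sum>i\<le>Suc r. \<kappa>' \<xi> i *s \<psi>' i) = wt (a \<xi>) - wt (b \<xi>) + int (j \<xi>) *s \<xi>1"
      by (simp add: \<kappa>'_def \<psi>'_def)
    have "\<xi> + wt (b \<xi>) = int (j \<xi>) *s \<xi>1 + wt (a \<xi>)"
      using E by (simp add: ewt_def wt_add)
    then have "wt (a \<xi>) - wt (b \<xi>) + int (j \<xi>) *s \<xi>1 = \<xi>" by (simp add: algebra_simps)
    with 1 show "(\<Sum>i\<le>Suc r. \<kappa>' \<xi> i *s \<psi>' i) = \<xi>" by (rule trans)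
  next
    fix k i assume k: "(\<Sum>i\<le>Suc r. k i) = 0" "(\<Sum>i\<le>Suc r. k i *s \<psi>' i) = 0" and i: "i \<le> Suc r"
    obtain u \<beta> where u: "\<And>x. x \<in> P \<Longrightarrow> u \<bullet> x \<le> \<beta>" "\<And>x. x \<in> P \<Longrightarrow> x \<in> \<tau> \<longleftrightarrow> u \<bullet> x = \<beta>"
      using face_functional[OF \<tau>(1)] by blast
    have u\<psi>: "u \<bullet> lattice_vec (\<psi> i) = \<beta>" if "i \<le> r" for i
      using \<psi>\<tau>[OF that] u(2) face_subset[OF \<tau>(1)] by (auto simp: mem_lattice_points)
    have u1: "u \<bullet> lattice_vec \<xi>1 \<noteq> \<beta>"
      using \<xi>1 u(2) face_subset[OF \<sigma>] by (auto simp: mem_lattice_points)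
    have \<psi>'1: "\<psi>' (Suc r) = \<xi>1" by (simp add: \<psi>'_def)
    have "u \<bullet> lattice_vec (\<Sum>i\<le>Suc r. k i *s \<psi>' i) = 0" using k(2) by simp
    moreover have "(\<Sum>i\<le>r. real_of_int (k i) * (u \<bullet> lattice_vec (\<psi>' i))) = (\<Sum>i\<le>r. real_of_int (k i) * \<beta>)"
      by (rule sum.cong) (auto simp: \<psi>' u\<psi>)
    ultimately have "(\<Sum>i\<le>r. real_of_int (k i) * \<beta>) + real_of_int (k (Suc r)) * (u \<bullet> lattice_vec \<xi>1) = 0"
      by (simp add: lattice_vec_add lattice_vec_sum lattice_vec_scale inner_add_right inner_sum_right
          \<psi>'1)
    moreover have "(\<Sum>i\<le>r. real_of_int (k i)) = - real_of_int (k (Suc r))"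
    proof -
      have "(\<Sum>i\<le>r. k i) = - k (Suc r)" using k(1) by simp
      then show ?thesis by (simp flip: of_int_sum)
    qed
    ultimately have "real_of_int (k (Suc r)) * (u \<bullet> lattice_vec \<xi>1 - \<beta>) = 0"
      by (simp add: algebra_simps flip: sum_distrib_left)
    then have k0: "k (Suc r) = 0" using u1 by simp
    have "(\<Sum>i\<le>r. k i *s \<psi> i) = (\<Sum>i\<le>r. k i *s \<psi>' i)" by (rule sum.cong) (auto simp: \<psi>')
    with k k0 have "(\<Sum>i\<le>r. k i) = 0" "(\<Sum>i\<le>r. k i *s \<psi> i) = 0" by simp_all
    then have "\<forall>i\<le>r. k i = 0" using basis unfolding affine_lattice_basis_def by blast
    then show "k i = 0" using k0 i by (auto simp: le_Suc_eq)
  qed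
  moreover have "\<kappa>' \<xi> (Suc r) = 0 \<longleftrightarrow> \<xi> \<in> lattice_points \<tau>" if \<xi>: "\<xi> \<in> lattice_points \<sigma>" for \<xi>
  proof -
    have "keys (single \<xi> (1::nat) + b \<xi>) \<subseteq> lattice_points \<tau> \<longleftrightarrow>
      keys (single \<xi>1 (j \<xi>) + a \<xi>) \<subseteq> lattice_points \<tau>"
      using jab(1,2)[OF \<xi>] \<xi> \<xi>1(1) sub lattice_points_face_subset[OF \<sigma>]
      by (intro keys_subset_face_cong[OF \<tau>(1) _ _ jab(3)[OF \<xi>]]) (auto simp: keys_add_nat split: if_splits)
    then show ?thesis using jab(1,2)[OF \<xi>] \<xi>1 by (auto simp: keys_add_nat \<kappa>'_def split: if_splits)
  qed
  moreover have "\<kappa>' \<xi> (Suc r) \<ge> 0" for \<xi> by (simp add: \<kappa>'_def)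
  moreover have "\<psi>' i \<in> lattice_points \<tau>" if "i \<le> r" for i using \<psi>\<tau>[OF that] \<psi>'[OF that] by simp
  ultimately show thesis using that by blast
qed

lemma facet_between:
  assumes "\<sigma> \<in> faces P" "\<tau> \<in> faces P" "\<tau> \<subset> \<sigma>"
  obtains \<rho> where "\<rho> \<in> faces P" "\<tau> \<subseteq> \<rho>" "\<rho> \<subset> \<sigma>" "aff_dim \<rho> = aff_dim \<sigma> - 1"
proof -
  have "\<tau> face_of \<sigma>" "\<tau> \<noteq> {}" using face_of_face_iff[OF assms(1)] assms by blast+
  then obtain \<rho> where \<rho>: "\<rho> facet_of \<sigma>" "\<tau> \<subseteq> \<rho>"
    using face_of_polyhedron_subset_facet[OF face_polyhedron[OF assms(1)]] assms(3) by blast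
  then have "\<rho> \<in> faces P \<and> \<rho> \<subseteq> \<sigma>" "aff_dim \<rho> = aff_dim \<sigma> - 1"
    using face_of_face_iff[OF assms(1), of \<rho>] by (auto simp: facet_of_def)
  moreover from this have "\<rho> \<noteq> \<sigma>" by auto
  ultimately show thesis using that[of \<rho>] \<rho>(2) by auto
qed

lemma face_aff_dim_nonneg: "\<sigma> \<in> faces P \<Longrightarrow> aff_dim \<sigma> \<ge> 0"
  using aff_dim_empty[of \<sigma>] aff_dim_geq[of \<sigma>] by (auto simp: faces_def)

lemma face_vertex:
  assumes "\<sigma> \<in> faces P"
  obtains \<tau> where "\<tau> \<in> faces P" "\<tau> \<subseteq> \<sigma>" "aff_dim \<tau> = 0"
proof -
  have "compact \<sigma>"
    using assms face_of_polytope_polytope[OF polytope_P] polytope_imp_compact by (auto simp: faces_def)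
  moreover have "\<sigma> \<noteq> {}" "convex \<sigma>" using assms face_convex by (auto simp: faces_def)
  ultimately obtain x where "x extreme_point_of \<sigma>" using extreme_point_exists_convex by blast
  then have "{x} face_of \<sigma> \<and> {x} \<noteq> {}" by (simp add: face_of_singleton)
  then have "{x} \<in> faces P" "{x} \<subseteq> \<sigma>" using face_of_face_iff[OF assms] by blast+
  then show thesis using that[of "{x}"] by simp
qed

text \<open>
  The basis is built up along a flag of faces that starts at a vertex.
\<close>

lemma affine_lattice_basis_exists:
  assumes "\<sigma> \<in> faces P" "aff_dim \<sigma> = int r"
  shows "\<exists>\<psi> \<kappa>. affine_lattice_basis \<sigma> r \<psi> \<kappa>"
  using assms
proof (induction r arbitrary: \<sigma>)
  case 0
  then obtain z where z: "\<sigma> = {z}" by (auto simp: aff_dim_eq_0)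
  obtain \<omega> where "\<omega> \<in> lattice_points \<sigma>" using lattice_points_face_nonempty[OF 0(1)] by blast
  then have "lattice_points \<sigma> = {\<omega>}" using z by (auto simp: mem_lattice_points simp flip: lattice_vec_inj)
  then show ?case
    by (intro exI[of _ "\<lambda>_. \<omega>"] exI[of _ "\<lambda>_ _. 1"]) (auto simp: affine_lattice_basis_def)
next
  case (Suc r)
  obtain \<tau> where \<tau>: "\<tau> \<in> faces P" "\<tau> \<subseteq> \<sigma>" "aff_dim \<tau> = 0" using face_vertex[OF Suc(2)] by blast
  then have "\<tau> \<subset> \<sigma>" using Suc(3) by auto
  then obtain \<rho> where \<rho>: "\<rho> \<in> faces P" "\<rho> \<subset> \<sigma>" "aff_dim \<rho> = aff_dim \<sigma> - 1"
    using facet_between Suc(2) \<tau>(1) by metis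
  then obtain \<psi> \<kappa> where basis: "affine_lattice_basis \<rho> r \<psi> \<kappa>" using Suc by force
  obtain \<psi>' \<kappa>' where "affine_lattice_basis \<sigma> (Suc r) \<psi>' \<kappa>'"
    by (rule affine_lattice_basis_step[OF Suc(2) \<rho>(1) psubset_imp_subset[OF \<rho>(2)] \<rho>(3) basis]) blast
  then show ?case by blast
qed

lemma face_chain:
  assumes "\<sigma> \<in> faces P" "\<tau> \<in> faces P" "\<tau> \<subseteq> \<sigma>" "aff_dim \<sigma> = aff_dim \<tau> + int k"
  shows "\<exists>Z. Z 0 = \<tau> \<and> Z k = \<sigma> \<and> (\<forall>i\<le>k. Z i \<in> faces P) \<and> (\<forall>i<k. Z i \<subset> Z (Suc i))"
  using assms
proof (induction k arbitrary: \<sigma>)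
  case 0
  then have "\<tau> = \<sigma>"
    using face_of_aff_dim_lt[OF face_convex[OF 0(1)], of \<tau>] face_of_face_iff[OF 0(1), of \<tau>] by auto
  with 0 show ?case by (intro exI[of _ "\<lambda>_. \<tau>"]) auto
next
  case (Suc k)
  then have "\<tau> \<subset> \<sigma>" by auto
  then obtain \<rho> where \<rho>: "\<rho> \<in> faces P" "\<tau> \<subseteq> \<rho>" "\<rho> \<subset> \<sigma>" "aff_dim \<rho> = aff_dim \<sigma> - 1"
    using facet_between Suc.prems by metis
  then obtain Z where "Z 0 = \<tau>" "Z k = \<rho>" "\<forall>i\<le>k. Z i \<in> faces P" "\<forall>i<k. Z i \<subset> Z (Suc i)"
    using Suc.IH[of \<rho>] Suc.prems by auto
  then show ?case using \<rho> Suc.prems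
    by (intro exI[of _ "Z(Suc k := \<sigma>)"]) (auto simp: le_Suc_eq less_Suc_eq)
qed

end

section \<open>Orbit closures\<close>

lemma toric_coneI:
  assumes "x \<in> coord_space (lattice_points P)" "\<And>\<omega>. x \<omega> \<noteq> 0 \<Longrightarrow> \<omega> \<in> lattice_points \<sigma>"
    "\<And>a b. keys a \<subseteq> lattice_points P \<Longrightarrow> keys b \<subseteq> lattice_points P \<Longrightarrow>
      ewt a = ewt b \<Longrightarrow> mon a x = mon b x"
  shows "x \<in> toric_cone P \<sigma>"
  using assms unfolding toric_cone_def by blast

lemma toric_cone_scale:
  assumes x: "x \<in> toric_cone P \<sigma>"
  shows "(\<lambda>v. c * x v) \<in> toric_cone P \<sigma>"
proof (rule toric_coneI)
  show "(\<lambda>v. c * x v) \<in> coord_space (lattice_points P)"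
    using toric_cone_coord_space[OF x] by (simp add: coord_space_def)
  show "\<omega> \<in> lattice_points \<sigma>" if "c * x \<omega> \<noteq> 0" for \<omega>
    using that toric_cone_support[OF x, of \<omega>] by simp
  fix a b :: "int ^ 'a \<Rightarrow>\<^sub>0 nat"
  assume ab: "keys a \<subseteq> lattice_points P" "keys b \<subseteq> lattice_points P"
    "ewt a = ewt b"
  have "mon a x = mon b x" by (rule toric_cone_binomial[OF x ab])
  moreover have "mdeg a = mdeg b" using ab(3) by (simp add: ewt_def)
  ultimately show "mon a (\<lambda>v. c * x v) = mon b (\<lambda>v. c * x v)" by (simp add: mon_scale)
qed

lemma toric_cone_mono_iff:
  assumes "x \<in> toric_cone P \<sigma>"
  shows "x \<in> toric_cone P \<tau> \<longleftrightarrow> {\<omega>. x \<omega> \<noteq> 0} \<subseteq> lattice_points \<tau>"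
proof
  assume "x \<in> toric_cone P \<tau>"
  then show "{\<omega>. x \<omega> \<noteq> 0} \<subseteq> lattice_points \<tau>" using toric_cone_support by blast
next
  assume "{\<omega>. x \<omega> \<noteq> 0} \<subseteq> lattice_points \<tau>"
  then show "x \<in> toric_cone P \<tau>"
    by (intro toric_coneI[OF toric_cone_coord_space[OF assms]] toric_cone_binomial[OF assms]) auto
qed

text \<open>
  A relation between monomials involves monomials of the same degree, so it holds at the origin.
\<close>

lemma zero_in_toric_cone: "(\<lambda>_. 0 :: 'b::field) \<in> toric_cone P (\<sigma> :: (real ^ 'a::finite) set)"
proof (rule toric_coneI)
  fix a b :: "int ^ 'a \<Rightarrow>\<^sub>0 nat" assume "ewt a = ewt b"
  then have "mdeg a = mdeg b" by (simp add: ewt_def)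
  moreover have "mon c (\<lambda>_. 0::'b) = 0 ^ mdeg c" for c :: "int ^ 'a \<Rightarrow>\<^sub>0 nat"
    using mon_scale[of c 0 "\<lambda>_. 1::'b"] by (simp add: mon_def[of c "\<lambda>_. 1"])
  ultimately show "mon a (\<lambda>_. 0::'b) = mon b (\<lambda>_. 0)" by simp
qed (auto simp: coord_space_def)

lemma orbit_point_scale: "orbit_point \<sigma> (c, t) = (\<lambda>v. c * orbit_point \<sigma> (1, t) v)"
  by (auto simp: orbit_point_def)

lemma orbit_point_nonzero_iff:
  "s \<in> ext_torus \<Longrightarrow> orbit_point \<sigma> s \<omega> \<noteq> 0 \<longleftrightarrow> \<omega> \<in> lattice_points \<sigma>"
  by (cases s) (auto simp: orbit_point_def ext_torus_iff character_nonzero)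

context normal_lattice_polytope
begin

lemma orbit_point_in_cone:
  assumes "\<sigma> \<in> faces P" "s \<in> ext_torus"
  shows "orbit_point \<sigma> s \<in> toric_cone P \<sigma>"
proof (rule toric_coneI)
  show "orbit_point \<sigma> s \<in> coord_space (lattice_points P)"
    using lattice_points_face_subset[OF assms(1)] by (auto simp: coord_space_def orbit_point_def)
  show "\<omega> \<in> lattice_points \<sigma>" if "orbit_point \<sigma> s \<omega> \<noteq> 0" for \<omega>
    using that by (auto simp: orbit_point_def split: if_splits)
  fix a b :: "int ^ 'n \<Rightarrow>\<^sub>0 nat"
  assume ab: "keys a \<subseteq> lattice_points P" "keys b \<subseteq> lattice_points P"
    "ewt a = ewt b"
  show "mon a (orbit_point \<sigma> s) = mon b (orbit_point \<sigma> s)"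
    unfolding mon_orbit_point[OF assms(2)] keys_subset_face_cong[OF assms(1) ab] ab(3) ..
qed

lemma orbit_point_nonzero:
  assumes "\<sigma> \<in> faces P" "s \<in> ext_torus"
  shows "orbit_point \<sigma> s \<noteq> (\<lambda>_. 0)"
proof -
  obtain \<omega> where "\<omega> \<in> lattice_points \<sigma>" using lattice_points_face_nonempty[OF assms(1)] by blast
  then have "orbit_point \<sigma> s \<omega> \<noteq> 0" using orbit_point_nonzero_iff[OF assms(2)] by blast
  then show ?thesis by auto
qed

lemma one_in_ext_torus: "(1, \<chi> i. 1) \<in> ext_torus" "(1, t) \<in> ext_torus \<longleftrightarrow> t \<in> torus"
  by (auto simp: ext_torus_def torus_def)

lemma orbit_class:
  assumes "\<sigma> \<in> faces P" "s \<in> ext_torus"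
  shows "proj_point (orbit_point \<sigma> s) \<in> proj_space (lattice_points P)"
  using orbit_point_nonzero[OF assms] toric_cone_coord_space[OF orbit_point_in_cone[OF assms]]
  by (rule proj_point_in_proj_space[rotated])

lemma form_nonzero_on_orbit:
  fixes g :: "(int ^ 'n \<Rightarrow> 'k::field_char_0) \<Rightarrow> 'k"
  assumes "form (lattice_points P) d g" "x \<in> toric_cone P \<sigma>" "g x \<noteq> 0"
  obtains t where "t \<in> torus" "g (orbit_point \<sigma> (1, t)) \<noteq> 0"
proof -
  obtain p where p: "p \<in> polys_over (lattice_points P)" "g = peval p"
    using assms(1) by (auto simp: form_def)
  have "\<exists>s\<in>ext_torus. peval p (orbit_point \<sigma> s) \<noteq> 0"
    using vanish_orbit_imp_vanish_cone[OF p(1) _ assms(2)] assms(3) p(2) by blast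
  then obtain c t where ct: "(c, t) \<in> ext_torus" "g (orbit_point \<sigma> (c, t)) \<noteq> 0" using p(2) by auto
  have "g (orbit_point \<sigma> (c, t)) = c ^ d * g (orbit_point \<sigma> (1, t))"
    using form_scale[OF assms(1)] orbit_point_scale[of \<sigma> c t] by simp
  with ct that show thesis by (auto simp: ext_torus_iff)
qed

text \<open>
  The orbit closure consists of the classes in the cone: the coordinates and binomials that define
  the cone are forms vanishing on the orbit, and conversely a form that does not vanish at a point of
  the cone does not vanish on the orbit.
\<close>

lemma orbit_closure_eq:
  assumes \<sigma>: "\<sigma> \<in> faces P"
  shows "(orbit_closure P \<sigma> :: (int ^ 'n \<Rightarrow> 'k::field_char_0) set set) =
    {L \<in> proj_space (lattice_points P). L \<subseteq> toric_cone P \<sigma>}"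
proof -
  let ?Z = "zariski (lattice_points P) :: (int ^ 'n \<Rightarrow> 'k) set topology"
  let ?O = "{proj_point (orbit_point \<sigma> (1, t)) | t. t \<in> (torus :: ('k ^ 'n) set)}"
  have OC: "orbit_closure P \<sigma> = ?Z closure_of ?O"
  proof -
    have "lattice_points P \<inter> lattice_points \<sigma> = lattice_points \<sigma>"
      using lattice_points_face_subset[OF \<sigma>] by blast
    then show ?thesis unfolding orbit_closure_def orbit_point_def fst_conv snd_conv mult_1_left by simp
  qed
  show ?thesis
  proof (intro equalityI subsetI)
    fix L :: "(int ^ 'n \<Rightarrow> 'k) set" assume L: "L \<in> orbit_closure P \<sigma>"
    then have LP: "L \<in> proj_space (lattice_points P)"
      using OC closure_of_subset_topspace[of ?Z ?O] topspace_zariski by blast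
    have vanish: "g x = 0" if g: "form (lattice_points P) d g" and x: "x \<in> L"
      and 0: "\<And>t. t \<in> torus \<Longrightarrow> g (orbit_point \<sigma> (1, t)) = 0" for d x and g :: "(int ^ 'n \<Rightarrow> 'k) \<Rightarrow> 'k"
    proof (rule ccontr)
      assume "g x \<noteq> 0"
      then have "L \<in> nonvanishing (lattice_points P) g"
        using form_vanishes_or_nonvanishing[OF g LP] x by blast
      then obtain L' where "L' \<in> ?O" "L' \<in> nonvanishing (lattice_points P) g"
        using L openin_nonvanishing[OF g] unfolding OC in_closure_of by blast
      then obtain t where "t \<in> torus" "proj_point (orbit_point \<sigma> (1, t)) \<in> nonvanishing (lattice_points P) g"
        by blast
      then show False using 0 proj_point_self by (auto simp: nonvanishing_def)
    qed
    have "x \<in> toric_cone P \<sigma>" if x: "x \<in> L" for x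
    proof (rule toric_coneI)
      show xc: "x \<in> coord_space (lattice_points P)" using proj_space_memD(2)[OF LP x] .
      show "\<omega> \<in> lattice_points \<sigma>" if "x \<omega> \<noteq> 0" for \<omega>
      proof (rule ccontr)
        assume \<omega>: "\<omega> \<notin> lattice_points \<sigma>"
        have "\<omega> \<in> lattice_points P" using that xc by (auto simp: coord_space_def)
        then have "x \<omega> = 0" using vanish[OF form_coord x] \<omega> by (simp add: orbit_point_def)
        with that show False by simp
      qed
      fix a b :: "int ^ 'n \<Rightarrow>\<^sub>0 nat"
      assume ab: "keys a \<subseteq> lattice_points P" "keys b \<subseteq> lattice_points P"
        "ewt a = ewt b"
      then have "mdeg a = mdeg b" by (simp add: ewt_def)
      then have "form (lattice_points P) (mdeg a) (\<lambda>x. 1 * mon a x + (-1) * mon b x :: 'k)"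
        using form_mon[OF ab(1)] form_mon[OF ab(2)] form_add by metis
      then have "1 * mon a x + (-1) * mon b x = 0"
      proof (rule vanish[OF _ x])
        fix t :: "'k ^ 'n" assume "t \<in> torus"
        then have "orbit_point \<sigma> (1, t) \<in> toric_cone P \<sigma>"
          using orbit_point_in_cone[OF \<sigma>] one_in_ext_torus by blast
        then have "mon a (orbit_point \<sigma> (1, t)) = mon b (orbit_point \<sigma> (1, t))"
          by (rule toric_cone_binomial[OF _ ab])
        then show "1 * mon a (orbit_point \<sigma> (1, t)) + (-1) * mon b (orbit_point \<sigma> (1, t)) = 0" by simp
      qed
      then show "mon a x = mon b x" by simp
    qed
    with LP show "L \<in> {L \<in> proj_space (lattice_points P). L \<subseteq> toric_cone P \<sigma>}" by blast
  next
    fix L :: "(int ^ 'n \<Rightarrow> 'k) set"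
    assume L: "L \<in> {L \<in> proj_space (lattice_points P). L \<subseteq> toric_cone P \<sigma>}"
    have "\<exists>y. y \<in> ?O \<and> y \<in> U" if U: "L \<in> U" "openin ?Z U" for U
    proof -
      obtain d g where g: "form (lattice_points P) d g" "L \<in> nonvanishing (lattice_points P) g"
        "nonvanishing (lattice_points P) g \<subseteq> U"
        using openin_zariski_basis[OF U(2,1)] by blast
      obtain x where x: "x \<in> L" using L proj_point_self by (auto simp: proj_space_def)
      then have "g x \<noteq> 0" "x \<in> toric_cone P \<sigma>" using g(2) L by (auto simp: nonvanishing_def)
      then obtain t where t: "t \<in> torus" "g (orbit_point \<sigma> (1, t)) \<noteq> 0"
        using form_nonzero_on_orbit[OF g(1)] by blast
      have "proj_point (orbit_point \<sigma> (1, t)) \<in> nonvanishing (lattice_points P) g"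
        using form_vanishes_or_nonvanishing[OF g(1) orbit_class[OF \<sigma>]] t one_in_ext_torus proj_point_self
        by blast
      with t(1) g(3) show ?thesis by blast
    qed
    then show "L \<in> orbit_closure P \<sigma>"
      using L topspace_zariski unfolding OC in_closure_of by blast
  qed
qed

lemma proj_point_in_orbit_closure_iff:
  fixes x :: "int ^ 'n \<Rightarrow> 'k::field_char_0"
  assumes "\<sigma> \<in> faces P" "x \<in> coord_space (lattice_points P)" "x \<noteq> (\<lambda>_. 0)"
  shows "proj_point x \<in> orbit_closure P \<sigma> \<longleftrightarrow> x \<in> toric_cone P \<sigma>"
proof
  assume "x \<in> toric_cone P \<sigma>"
  then have "proj_point x \<subseteq> toric_cone P \<sigma>"
    using toric_cone_scale by (fastforce simp: proj_point_def)
  then show "proj_point x \<in> orbit_closure P \<sigma>"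
    using assms proj_point_in_proj_space by (simp add: orbit_closure_eq)
next
  assume "proj_point x \<in> orbit_closure P \<sigma>"
  then have "proj_point x \<subseteq> toric_cone P \<sigma>" using assms(1) by (simp add: orbit_closure_eq)
  then show "x \<in> toric_cone P \<sigma>" using proj_point_self by blast
qed

lemma orbit_closureE:
  fixes L :: "(int ^ 'n \<Rightarrow> 'k::field_char_0) set"
  assumes "\<sigma> \<in> faces P" "L \<in> orbit_closure P \<sigma>"
  obtains x where "x \<in> toric_cone P \<sigma>" "x \<noteq> (\<lambda>_. 0)" "x \<in> coord_space (lattice_points P)" "L = proj_point x"
proof -
  have L: "L \<in> proj_space (lattice_points P)" "L \<subseteq> toric_cone P \<sigma>"
    using assms by (auto simp: orbit_closure_eq)
  obtain x where "x \<in> L" using L(1) proj_point_self by (auto simp: proj_space_def)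
  then show thesis using that[of x] L proj_space_memD[OF L(1)] by blast
qed

lemma affine_cone_orbit_closure:
  assumes "\<sigma> \<in> faces P"
  shows "affine_cone (orbit_closure P \<sigma> :: (int ^ 'n \<Rightarrow> 'k::field_char_0) set set) = toric_cone P \<sigma>"
proof (intro equalityI subsetI)
  fix x :: "int ^ 'n \<Rightarrow> 'k"
  assume "x \<in> affine_cone (orbit_closure P \<sigma>)"
  then show "x \<in> toric_cone P \<sigma>"
    using zero_in_toric_cone by (auto simp: affine_cone_def orbit_closure_eq[OF assms])
next
  fix x :: "int ^ 'n \<Rightarrow> 'k"
  assume x: "x \<in> toric_cone P \<sigma>"
  show "x \<in> affine_cone (orbit_closure P \<sigma>)"
  proof (cases "x = (\<lambda>_. 0)")
    case False
    then have "proj_point x \<in> orbit_closure P \<sigma>"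
      using proj_point_in_orbit_closure_iff[OF assms toric_cone_coord_space[OF x]] x by blast
    then show ?thesis using proj_point_self by (auto simp: affine_cone_def)
  qed (simp add: affine_cone_def)
qed

lemma toric_variety_eq: "toric_variety P = orbit_closure P P"
  by (simp add: toric_variety_def orbit_closure_def)

lemma orbit_closure_subset_iff:
  assumes "\<sigma> \<in> faces P" "\<tau> \<in> faces P"
  shows "(orbit_closure P \<sigma> :: (int ^ 'n \<Rightarrow> 'k::field_char_0) set set) \<subseteq> orbit_closure P \<tau> \<longleftrightarrow> \<sigma> \<subseteq> \<tau>"
proof
  assume "\<sigma> \<subseteq> \<tau>"
  then have *: "lattice_points \<sigma> \<subseteq> lattice_points \<tau>" by (auto simp: mem_lattice_points)
  have "toric_cone P \<sigma> \<subseteq> (toric_cone P \<tau> :: (int ^ 'n \<Rightarrow> 'k) set)"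
  proof
    fix x :: "int ^ 'n \<Rightarrow> 'k" assume x: "x \<in> toric_cone P \<sigma>"
    then have "{\<omega>. x \<omega> \<noteq> 0} \<subseteq> lattice_points \<tau>" using toric_cone_support[OF x] * by blast
    then show "x \<in> toric_cone P \<tau>" using toric_cone_mono_iff[OF x] by blast
  qed
  then show "(orbit_closure P \<sigma> :: (int ^ 'n \<Rightarrow> 'k) set set) \<subseteq> orbit_closure P \<tau>"
    using assms by (auto simp: orbit_closure_eq)
next
  assume sub: "(orbit_closure P \<sigma> :: (int ^ 'n \<Rightarrow> 'k) set set) \<subseteq> orbit_closure P \<tau>"
  let ?x = "orbit_point \<sigma> (1, \<chi> i. 1) :: int ^ 'n \<Rightarrow> 'k"
  have x: "?x \<in> toric_cone P \<sigma>" "?x \<noteq> (\<lambda>_. 0)"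
    using orbit_point_in_cone orbit_point_nonzero assms(1) one_in_ext_torus(1) by blast+
  then have "proj_point ?x \<in> orbit_closure P \<tau>"
    using sub proj_point_in_orbit_closure_iff[OF assms(1) toric_cone_coord_space[OF x(1)]] by blast
  then have "?x \<in> toric_cone P \<tau>"
    using proj_point_in_orbit_closure_iff[OF assms(2) toric_cone_coord_space[OF x(1)]] x(2) by blast
  then have "{\<omega>. ?x \<omega> \<noteq> 0} \<subseteq> lattice_points \<tau>" using toric_cone_mono_iff[OF x(1)] by blast
  moreover have "{\<omega>. ?x \<omega> \<noteq> 0} = lattice_points \<sigma>"
    using orbit_point_nonzero_iff[OF one_in_ext_torus(1)] by blast
  ultimately show "\<sigma> \<subseteq> \<tau>" using face_subset_iff assms by blast
qed

lemma orbit_closure_eq_iff: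
  assumes "\<sigma> \<in> faces P" "\<tau> \<in> faces P"
  shows "(orbit_closure P \<sigma> :: (int ^ 'n \<Rightarrow> 'k::field_char_0) set set) = orbit_closure P \<tau> \<longleftrightarrow> \<sigma> = \<tau>"
  using orbit_closure_subset_iff[OF assms, where 'k = 'k]
    orbit_closure_subset_iff[OF assms(2,1), where 'k = 'k] by auto

lemma orbit_closure_psubset_iff:
  assumes "\<sigma> \<in> faces P" "\<tau> \<in> faces P"
  shows "(orbit_closure P \<sigma> :: (int ^ 'n \<Rightarrow> 'k::field_char_0) set set) \<subset> orbit_closure P \<tau> \<longleftrightarrow> \<sigma> \<subset> \<tau>"
  using orbit_closure_subset_iff[OF assms, where 'k = 'k] orbit_closure_eq_iff[OF assms, where 'k = 'k]
  by auto

text \<open>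
  Two forms that do not vanish on the orbit have a common point of nonvanishing on it: restrict to a
  line in \<open>K\<^sup>n\<close> through a point of nonvanishing of each. Clearing denominators, the forms and the
  coordinates become nonzero polynomials in one variable, which have a common nonroot.
\<close>

lemma orbit_forms_common_point:
  fixes g h :: "(int ^ 'n \<Rightarrow> 'k::field_char_0) \<Rightarrow> 'k"
  assumes g: "form (lattice_points P) d g" "t1 \<in> torus" "g (orbit_point \<sigma> (1, t1)) \<noteq> 0"
    and h: "form (lattice_points P) e h" "t2 \<in> torus" "h (orbit_point \<sigma> (1, t2)) \<noteq> 0"
    and \<sigma>: "\<sigma> \<in> faces P"
  obtains t where "t \<in> torus" "g (orbit_point \<sigma> (1, t)) \<noteq> 0" "h (orbit_point \<sigma> (1, t)) \<noteq> 0"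
proof -
  obtain B :: nat where B: "\<forall>x\<in>P. \<forall>i. \<bar>x $ i\<bar> \<le> real B" using coordinate_bound by blast
  have N: "\<omega> $ i + int B \<ge> 0" if "\<omega> \<in> lattice_points \<sigma>" for \<omega> i
  proof -
    have "\<bar>real_of_int (\<omega> $ i)\<bar> \<le> real B"
      using B[rule_format, of "lattice_vec \<omega>" i] that face_subset[OF \<sigma>]
      by (auto simp: mem_lattice_points lattice_vec_def)
    then have "- real_of_int (\<omega> $ i) \<le> real_of_int (int B)" by simp
    then have "- (\<omega> $ i) \<le> int B" by (simp only: flip: of_int_minus of_int_le_iff)
    then show ?thesis by simp
  qed
  \<comment> \<open>\<open>l\<close> runs through the line from \<open>t1\<close> to \<open>t2\<close>; \<open>Y\<close> is the corresponding point of the orbit, scaled by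
    the \<open>B\<close>-th powers of the coordinates to become polynomial. Homogeneity absorbs the scaling.\<close>
  define l where "l i = [:t1 $ i, t2 $ i - t1 $ i:]" for i
  define Y where "Y \<omega> = (if \<omega> \<in> lattice_points \<sigma> then \<Prod>i\<in>UNIV. l i ^ nat (\<omega> $ i + int B) else 0)" for \<omega>
  have Y: "(\<lambda>v. poly (Y v) z) = (\<lambda>v. (\<Prod>i\<in>UNIV. poly (l i) z ^ B) * orbit_point \<sigma> (1, \<chi> i. poly (l i) z) v)"
    if z: "\<And>i. poly (l i) z \<noteq> 0" for z
  proof
    fix v
    have "poly (l i) z ^ nat (v $ i + int B) = poly (l i) z ^ B * poly (l i) z powi (v $ i)"
      if "v \<in> lattice_points \<sigma>" for i
    proof -
      have "poly (l i) z ^ nat (v $ i + int B) = poly (l i) z powi (v $ i + int B)"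
        using N[OF that, of i] by (simp add: power_int_def)
      then show ?thesis using z by (simp add: power_int_add mult.commute)
    qed
    then show "poly (Y v) z = (\<Prod>i\<in>UNIV. poly (l i) z ^ B) * orbit_point \<sigma> (1, \<chi> i. poly (l i) z) v"
      by (simp add: Y_def orbit_point_def poly_prod character_def prod.distrib)
  qed
  have sub: "\<exists>G. \<forall>z. (\<forall>i. poly (l i) z \<noteq> 0) \<longrightarrow>
      (poly G z = 0 \<longleftrightarrow> f (orbit_point \<sigma> (1, \<chi> i. poly (l i) z)) = 0)"
    if f: "form (lattice_points P) m f" for m and f :: "(int ^ 'n \<Rightarrow> 'k) \<Rightarrow> 'k"
  proof -
    obtain p where p: "f = peval p" using f by (auto simp: form_def)
    have "poly (peval (Poly_Mapping.map (\<lambda>c. [:c:]) p) Y) z = 0 \<longleftrightarrow>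
        f (orbit_point \<sigma> (1, \<chi> i. poly (l i) z)) = 0" if z: "\<And>i. poly (l i) z \<noteq> 0" for z
    proof -
      have "poly (peval (Poly_Mapping.map (\<lambda>c. [:c:]) p) Y) z = f (\<lambda>v. poly (Y v) z)"
        by (simp add: poly_peval p)
      also have "\<dots> = (\<Prod>i\<in>UNIV. poly (l i) z ^ B) ^ m * f (orbit_point \<sigma> (1, \<chi> i. poly (l i) z))"
        unfolding Y[OF z] by (rule form_scale[OF f])
      finally show ?thesis using z by simp
    qed
    then show ?thesis by blast
  qed
  obtain G where G: "\<And>z. (\<And>i. poly (l i) z \<noteq> 0) \<Longrightarrow>
      (poly G z = 0 \<longleftrightarrow> g (orbit_point \<sigma> (1, \<chi> i. poly (l i) z)) = 0)" using sub[OF g(1)] by blast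
  obtain H where H: "\<And>z. (\<And>i. poly (l i) z \<noteq> 0) \<Longrightarrow>
      (poly H z = 0 \<longleftrightarrow> h (orbit_point \<sigma> (1, \<chi> i. poly (l i) z)) = 0)" using sub[OF h(1)] by blast
  have l0: "poly (l i) 0 = t1 $ i" "poly (l i) 1 = t2 $ i" for i by (simp_all add: l_def)
  have "poly G 0 \<noteq> 0" using G[of 0] g(2,3) by (simp add: l0 torus_def vec_lambda_eta)
  then have "G \<noteq> 0" by auto
  have "poly H 1 \<noteq> 0" using H[of 1] h(2,3) by (simp add: l0 torus_def vec_lambda_eta)
  then have "H \<noteq> 0" by auto
  have "l i \<noteq> 0" for i using g(2) by (auto simp: l_def torus_def)
  then have "G * H * (\<Prod>i\<in>UNIV. l i) \<noteq> 0" using \<open>G \<noteq> 0\<close> \<open>H \<noteq> 0\<close> by simp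
  then have "finite {z. poly (G * H * (\<Prod>i\<in>UNIV. l i)) z = 0}" by (rule poly_roots_finite)
  then obtain z where "poly (G * H * (\<Prod>i\<in>UNIV. l i)) z \<noteq> 0"
    using infinite_UNIV_char_0[where 'a = 'k] by (metis (mono_tags, lifting) UNIV_eq_I mem_Collect_eq)
  then have z: "poly G z \<noteq> 0" "poly H z \<noteq> 0" "\<And>i. poly (l i) z \<noteq> 0" by (auto simp: poly_prod)
  show thesis
    by (rule that[of "\<chi> i. poly (l i) z"]) (use z G[OF z(3)] H[OF z(3)] in \<open>auto simp: torus_def\<close>)
qed

lemma orbit_closure_irr_closed:
  assumes \<sigma>: "\<sigma> \<in> faces P"
  shows "irr_closed (zariski (lattice_points P)) (orbit_closure P \<sigma> :: (int ^ 'n \<Rightarrow> 'k::field_char_0) set set)"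
  unfolding irr_closed_def
proof
  let ?Z = "zariski (lattice_points P) :: (int ^ 'n \<Rightarrow> 'k) set topology"
  let ?X = "orbit_closure P \<sigma> :: (int ^ 'n \<Rightarrow> 'k) set set"
  show closed: "closedin ?Z ?X" unfolding orbit_closure_def by simp
  have O: "proj_point (orbit_point \<sigma> (1, t)) \<in> ?X" if "t \<in> torus" for t :: "'k ^ 'n"
  proof -
    have s: "(1, t) \<in> ext_torus" using that by (simp add: ext_torus_iff)
    have x: "orbit_point \<sigma> (1, t) \<in> toric_cone P \<sigma>" by (rule orbit_point_in_cone[OF \<sigma> s])
    show ?thesis
      using proj_point_in_orbit_closure_iff[OF \<sigma> toric_cone_coord_space[OF x] orbit_point_nonzero[OF \<sigma> s]] x
      by blast
  qed
  have sub: "?X \<subseteq> proj_space (lattice_points P)" using orbit_closure_eq[OF \<sigma>] by blast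
  show "irreducible_in ?Z ?X"
    unfolding irreducible_in_def
  proof (intro conjI allI impI)
    show "?X \<subseteq> topspace ?Z" using sub by (simp add: topspace_zariski)
    have "(\<chi> i. 1) \<in> (torus :: ('k ^ 'n) set)" by (simp add: torus_def)
    then show "?X \<noteq> {}" using O by blast
    fix C D assume CD: "closedin ?Z C \<and> closedin ?Z D \<and> ?X \<subseteq> C \<union> D"
    have *: "\<exists>d g t. form (lattice_points P) d g \<and> vanishes_on g E \<and> t \<in> torus \<and> g (orbit_point \<sigma> (1, t)) \<noteq> 0"
      if E: "closedin ?Z E" "\<not> ?X \<subseteq> E" for E
    proof -
      obtain L where L: "L \<in> ?X" "L \<notin> E" using E(2) by blast
      obtain d g where g: "form (lattice_points P) d g" "vanishes_on g E" "\<forall>x\<in>L. g x \<noteq> 0"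
        using closedin_zariski_separate[OF E(1) _ L(2)] L(1) sub by blast
      obtain x where x: "x \<in> toric_cone P \<sigma>" "L = proj_point x" using orbit_closureE[OF \<sigma> L(1)] by blast
      then have "g x \<noteq> 0" using g(3) proj_point_self by blast
      then obtain t where "t \<in> torus" "g (orbit_point \<sigma> (1, t)) \<noteq> 0"
        using form_nonzero_on_orbit[OF g(1) x(1)] by blast
      with g show ?thesis by blast
    qed
    show "?X \<subseteq> C \<or> ?X \<subseteq> D"
    proof (rule ccontr)
      assume neg: "\<not> (?X \<subseteq> C \<or> ?X \<subseteq> D)"
      obtain d g t1 where g: "form (lattice_points P) d g" "vanishes_on g C" "t1 \<in> torus"
        "g (orbit_point \<sigma> (1, t1)) \<noteq> 0" using *[of C] CD neg by blast
      obtain e h t2 where h: "form (lattice_points P) e h" "vanishes_on h D" "t2 \<in> torus"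
        "h (orbit_point \<sigma> (1, t2)) \<noteq> 0" using *[of D] CD neg by blast
      obtain t where t: "t \<in> torus" "g (orbit_point \<sigma> (1, t)) \<noteq> 0" "h (orbit_point \<sigma> (1, t)) \<noteq> 0"
        using orbit_forms_common_point[OF g(1,3,4) h(1,3,4) \<sigma>] by blast
      have "proj_point (orbit_point \<sigma> (1, t)) \<in> C \<union> D" using O[OF t(1)] CD by blast
      then show False
        using g(2) h(2) t(2,3) proj_point_self[of "orbit_point \<sigma> (1, t)"] unfolding vanishes_on_def by blast
    qed
  qed
qed

end

section \<open>Dimension of orbit closures\<close>

lemma irr_chain_append:
  assumes Z: "irr_chain T k Z" and Y: "irr_chain T l Y" and sub: "Z k \<subseteq> Y 0"
  shows "irr_chain T (k + l) (\<lambda>i. if i < k then Z i else Y (i - k))"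
  unfolding irr_chain_def
proof (intro conjI allI impI)
  fix i assume i: "i \<le> k + l"
  show "irr_closed T (if i < k then Z i else Y (i - k))"
    using Z Y i by (auto simp: irr_chain_def)
next
  fix i assume i: "i < k + l"
  consider "Suc i < k" | "Suc i = k" | "k \<le> i" by linarith
  then show "(if i < k then Z i else Y (i - k)) \<subset> (if Suc i < k then Z (Suc i) else Y (Suc i - k))"
  proof cases
    case 1
    then show ?thesis using Z by (auto simp: irr_chain_def)
  next
    case 2
    then have "Z i \<subset> Z k" using Z by (auto simp: irr_chain_def)
    then show ?thesis using 2 sub by auto
  next
    case 3
    then show ?thesis using Y i by (auto simp: irr_chain_def Suc_diff_le)
  qed
qed

lemma binomial_power_bound: "m ^ k \<le> k ^ k * ((m + k) choose k)"
proof (cases "k = 0")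
  case False
  have "(real (m + k) / real k) ^ k \<le> real ((m + k) choose k)"
    using binomial_ge_n_over_k_pow_k[of k "m + k", where 'a = real] by simp
  then have "real (m + k) ^ k \<le> real k ^ k * real ((m + k) choose k)"
    using False by (simp add: power_divide field_simps)
  moreover have "real m ^ k \<le> real (m + k) ^ k" by (intro power_mono) auto
  ultimately have "real (m ^ k) \<le> real (k ^ k * ((m + k) choose k))" by simp
  then show ?thesis by (simp only: of_nat_le_iff)
qed simp

text \<open>The binomial coefficient is at least \<open>(m / k)\<^sup>k\<close>, so it grows faster than \<open>m\<^sup>n\<close> if \<open>n < k\<close>.\<close>

lemma binomial_growth:
  assumes "\<And>m. (m + k) choose k \<le> (C * m + 1) ^ n"
  shows "k \<le> n"
proof (rule ccontr)
  assume "\<not> k \<le> n"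
  define m where "m = k ^ k * (C + 1) ^ n + 1"
  have "m ^ Suc n \<le> m ^ k" using \<open>\<not> k \<le> n\<close> by (intro power_increasing) (auto simp: m_def)
  also have "\<dots> \<le> k ^ k * ((m + k) choose k)" by (rule binomial_power_bound)
  also have "\<dots> \<le> k ^ k * (C * m + 1) ^ n" using assms by simp
  also have "\<dots> \<le> k ^ k * ((C + 1) * m) ^ n"
    by (intro mult_le_mono2 power_mono) (auto simp: m_def)
  also have "\<dots> = (k ^ k * (C + 1) ^ n) * m ^ n" by (simp only: power_mult_distrib mult.assoc)
  finally have "m * m ^ n \<le> (k ^ k * (C + 1) ^ n) * m ^ n" by simp
  moreover have "m ^ n > 0" by (simp add: m_def)
  ultimately have "m \<le> k ^ k * (C + 1) ^ n" by (simp only: mult_le_cancel2)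
  then show False by (simp add: m_def)
qed

context normal_lattice_polytope
begin

text \<open>
  On the open orbit a form of degree \<open>D\<close> is a combination of the characters of the lattice points
  of \<open>D P\<close>, of which there are at most \<open>(2 B D + 1)\<^sup>n\<close> if \<open>B\<close> bounds the coordinates on \<open>P\<close>.
\<close>

lemma indep_forms_bound:
  assumes "indep_forms (lattice_points P) (orbit_closure P P :: (int ^ 'n \<Rightarrow> 'k::field_char_0) set set) D N"
    and B: "\<forall>x\<in>P. \<forall>i. \<bar>x $ i\<bar> \<le> real B"
  shows "N \<le> (2 * B * D + 1) ^ CARD('n)"
proof (rule ccontr)
  assume N: "\<not> N \<le> (2 * B * D + 1) ^ CARD('n)"
  obtain b where b: "\<forall>i<N. form (lattice_points P) D (b i)"
    "\<And>c. vanishes_on (\<lambda>x. \<Sum>i<N. c i * b i x) (orbit_closure P P :: (int ^ 'n \<Rightarrow> 'k) set set) \<Longrightarrow>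
      \<forall>i<N. c i = 0"
    using assms(1) unfolding indep_forms_def by blast
  obtain p where p: "\<And>i. i < N \<Longrightarrow> p i \<in> polys_over (lattice_points P)"
    "\<And>i. i < N \<Longrightarrow> homogeneous D (p i)" "\<And>i. i < N \<Longrightarrow> b i = peval (p i)"
    using b(1) unfolding form_def by metis
  let ?A = "{- int (B * D)..int (B * D)}"
  define W where "W = Pair (int D) ` {\<omega> :: int ^ 'n. \<forall>i. \<omega> $ i \<in> ?A}"
  have finW: "finite W" unfolding W_def by (intro finite_imageI finite_card_vec_box(1)) simp
  have "card W \<le> card {\<omega> :: int ^ 'n. \<forall>i. \<omega> $ i \<in> ?A}"
    unfolding W_def by (intro card_image_le finite_card_vec_box(1)) simp
  also have "\<dots> \<le> card ?A ^ CARD('n)" by (rule finite_card_vec_box(2)) simp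
  also have "card ?A = 2 * B * D + 1" by (simp add: nat_add_distrib nat_mult_distrib)
  finally have "card W < N" using N by simp
  then obtain c where c: "\<exists>i<N. c i \<noteq> 0"
    "\<forall>w\<in>W. (\<Sum>i<N. c i * weight_coeff P (p i) w) = 0"
    using underdetermined_system[OF finW, of N "\<lambda>i. weight_coeff P (p i)"] by blast
  have W: "ewt a \<in> W" if i: "i < N" and a: "a \<in> keys (p i)" for i a
  proof -
    have a': "mdeg a = D" "keys a \<subseteq> lattice_points P"
      using p(1,2)[OF i] a by (auto simp: homogeneous_mdeg polys_over_def)
    have "wt a $ l \<in> ?A" for l
    proof -
      have "\<bar>v $ l\<bar> \<le> int B" if "v \<in> keys a" for v
      proof -
        have "lattice_vec v \<in> P" using a'(2) that by (auto simp: mem_lattice_points)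
        then have "\<bar>lattice_vec v $ l\<bar> \<le> real B" using B by blast
        then have "real_of_int \<bar>v $ l\<bar> \<le> real_of_int (int B)" by (simp add: lattice_vec_def)
        then show ?thesis by (simp only: of_int_le_iff)
      qed
      note vl = this
      have "\<bar>wt a $ l\<bar> \<le> (\<Sum>v\<in>keys a. \<bar>int (lookup a v) * v $ l\<bar>)"
        by (simp add: wt_def sum_abs)
      also have "\<dots> \<le> (\<Sum>v\<in>keys a. int (lookup a v) * int B)"
        by (rule sum_mono) (auto simp: abs_mult intro!: mult_left_mono vl)
      also have "\<dots> = int (B * D)" using a'(1) by (auto simp: mdeg_def simp flip: sum_distrib_right of_nat_sum)
      finally show ?thesis by (simp add: abs_le_iff)
    qed
    then show ?thesis using a'(1) by (auto simp: W_def ewt_def)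
  qed
  have form: "form (lattice_points P) D (\<lambda>x. \<Sum>i<N. c i * b i x)"
    by (rule form_sum, rule form_cmult) (use b(1) in auto)
  have zero: "(\<Sum>i<N. c i * b i (orbit_point P s)) = 0" if s: "s \<in> ext_torus" for s
  proof -
    have "b i (orbit_point P s) = (\<Sum>w\<in>W. weight_coeff P (p i) w * ext_character w s)" if i: "i < N" for i
    proof -
      have "b i (orbit_point P s) =
          (\<Sum>w\<in>ewt ` keys (p i). weight_coeff P (p i) w * ext_character w s)"
        unfolding p(3)[OF i] by (rule peval_orbit_point[OF s])
      also have "\<dots> = (\<Sum>w\<in>W. weight_coeff P (p i) w * ext_character w s)"
      proof (rule sum.mono_neutral_left[OF finW])
        show "ewt ` keys (p i) \<subseteq> W" using W[OF i] by blast
        show "\<forall>w\<in>W - ewt ` keys (p i). weight_coeff P (p i) w * ext_character w s = 0"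
        proof
          fix w assume "w \<in> W - ewt ` keys (p i)"
          then have "{a \<in> keys (p i). keys a \<subseteq> lattice_points P \<and> ewt a = w} = {}"
            by blast
          then show "weight_coeff P (p i) w * ext_character w s = 0"
            unfolding weight_coeff_def by (simp only: sum.empty mult_zero_left)
        qed
      qed
      finally show ?thesis .
    qed
    then have "(\<Sum>i<N. c i * b i (orbit_point P s)) =
        (\<Sum>i<N. \<Sum>w\<in>W. c i * weight_coeff P (p i) w * ext_character w s)"
      by (intro sum.cong) (auto simp: sum_distrib_left mult.assoc)
    also have "\<dots> = (\<Sum>w\<in>W. (\<Sum>i<N. c i * weight_coeff P (p i) w) * ext_character w s)"
      by (subst sum.swap) (simp add: sum_distrib_right)
    also have "\<dots> = 0" using c(2) by (intro sum.neutral) simp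
    finally show ?thesis .
  qed
  have "vanishes_on (\<lambda>x. \<Sum>i<N. c i * b i x) (orbit_closure P P :: (int ^ 'n \<Rightarrow> 'k) set set)"
    unfolding vanishes_on_def
  proof (intro ballI, rule ccontr)
    fix L and x :: "int ^ 'n \<Rightarrow> 'k"
    assume L: "L \<in> orbit_closure P P" "x \<in> L" and nz: "(\<Sum>i<N. c i * b i x) \<noteq> 0"
    then have "x \<in> toric_cone P P" using orbit_closure_eq[OF P_face] by blast
    then obtain t where "t \<in> torus" "(\<Sum>i<N. c i * b i (orbit_point P (1, t))) \<noteq> 0"
      using form_nonzero_on_orbit[OF form _ nz] by blast
    then show False using zero one_in_ext_torus by blast
  qed
  then show False using b(2) c(1) by blast
qed

lemma chain_length_le:
  assumes "irr_chain (zariski (lattice_points P)) k (Z :: nat \<Rightarrow> (int ^ 'n \<Rightarrow> 'k::field_char_0) set set)"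
    and "Z k \<subseteq> orbit_closure P P"
  shows "k \<le> CARD('n)"
proof -
  obtain B :: nat where B: "\<forall>x\<in>P. \<forall>i. \<bar>x $ i\<bar> \<le> real B" using coordinate_bound by blast
  obtain E where E: "\<forall>m. indep_forms (lattice_points P) (Z k) (m * E) ((m + k) choose k)"
    using irr_chain_indep_forms[OF assms(1)] by blast
  have "(m + k) choose k \<le> (2 * B * E * m + 1) ^ CARD('n)" for m
  proof -
    have "indep_forms (lattice_points P) (orbit_closure P P :: (int ^ 'n \<Rightarrow> 'k) set set) (m * E) ((m + k) choose k)"
      using indep_forms_subset[OF E[rule_format] assms(2)] .
    from indep_forms_bound[OF this B] show ?thesis by (simp add: mult_ac)
  qed
  then show ?thesis by (rule binomial_growth)
qed

lemma orbit_closure_chain: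
  assumes "\<sigma> \<in> faces P" "\<tau> \<in> faces P" "\<tau> \<subseteq> \<sigma>" "aff_dim \<sigma> = aff_dim \<tau> + int k"
  obtains Z where "irr_chain (zariski (lattice_points P)) k (Z :: nat \<Rightarrow> (int ^ 'n \<Rightarrow> 'k::field_char_0) set set)"
    "Z 0 = orbit_closure P \<tau>" "Z k = orbit_closure P \<sigma>"
proof -
  obtain F where F: "F 0 = \<tau>" "F k = \<sigma>" "\<forall>i\<le>k. F i \<in> faces P" "\<forall>i<k. F i \<subset> F (Suc i)"
    using face_chain[OF assms] by blast
  define Z where "Z i = (orbit_closure P (F i) :: (int ^ 'n \<Rightarrow> 'k) set set)" for i
  have "irr_chain (zariski (lattice_points P)) k Z"
    unfolding irr_chain_def Z_def
  proof (intro conjI allI impI)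
    fix i assume "i \<le> k"
    then show "irr_closed (zariski (lattice_points P)) (orbit_closure P (F i) :: (int ^ 'n \<Rightarrow> 'k) set set)"
      using orbit_closure_irr_closed F(3) by blast
  next
    fix i assume i: "i < k"
    then have "F i \<in> faces P" "F (Suc i) \<in> faces P" using F(3) by auto
    then show "(orbit_closure P (F i) :: (int ^ 'n \<Rightarrow> 'k) set set) \<subset> orbit_closure P (F (Suc i))"
      using orbit_closure_psubset_iff[of "F i" "F (Suc i)", where 'k = 'k] F(4) i by blast
  qed
  with F(1,2) that show thesis by (auto simp: Z_def)
qed

text \<open>
  A chain in \<open>X\<^sub>\<sigma>\<close> is prolonged to one in \<open>X\<^sub>P\<close> by the orbit closures of a saturated chain of faces from
  \<open>\<sigma>\<close> to \<open>P\<close>; thus lattice points have to be counted for \<open>P\<close> only.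
\<close>

lemma chain_length_le_face:
  assumes "\<sigma> \<in> faces P" "aff_dim \<sigma> = int r"
    and Z: "irr_chain (zariski (lattice_points P)) k (Z :: nat \<Rightarrow> (int ^ 'n \<Rightarrow> 'k::field_char_0) set set)"
    "Z k \<subseteq> orbit_closure P \<sigma>"
  shows "k \<le> r"
proof -
  have "aff_dim \<sigma> \<le> aff_dim P" using assms(1) face_subset by (intro aff_dim_subset) auto
  then have r: "r \<le> CARD('n)" using assms(2) full_dim by simp
  obtain Y where Y: "irr_chain (zariski (lattice_points P)) (CARD('n) - r) (Y :: nat \<Rightarrow> (int ^ 'n \<Rightarrow> 'k) set set)"
    "Y 0 = orbit_closure P \<sigma>" "Y (CARD('n) - r) = orbit_closure P P"
    by (rule orbit_closure_chain[OF P_face assms(1) face_subset[OF assms(1)], of "CARD('n) - r"])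
       (use r assms(2) full_dim in auto)
  have "irr_chain (zariski (lattice_points P)) (k + (CARD('n) - r)) (\<lambda>i. if i < k then Z i else Y (i - k))"
    using irr_chain_append[OF Z(1) Y(1)] Z(2) Y(2) by simp
  then have "k + (CARD('n) - r) \<le> CARD('n)"
    by (rule chain_length_le) (simp add: Y(3))
  then show ?thesis using r by simp
qed

lemma krull_dim_orbit_closure:
  assumes "\<sigma> \<in> faces P" "aff_dim \<sigma> = int r"
  shows "krull_dim (zariski (lattice_points P)) (orbit_closure P \<sigma> :: (int ^ 'n \<Rightarrow> 'k::field_char_0) set set) = enat r"
  unfolding krull_dim_def
proof (rule antisym)
  let ?S = "{k. \<exists>Z. irr_chain (zariski (lattice_points P)) k Z \<and> Z k \<subseteq> (orbit_closure P \<sigma> :: (int ^ 'n \<Rightarrow> 'k) set set)}"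
  show "(SUP k\<in>?S. enat k) \<le> enat r"
    by (rule SUP_least) (use chain_length_le_face[OF assms, where 'k = 'k] in auto)
  obtain \<tau> where \<tau>: "\<tau> \<in> faces P" "\<tau> \<subseteq> \<sigma>" "aff_dim \<tau> = 0" using face_vertex[OF assms(1)] by blast
  obtain Z where "irr_chain (zariski (lattice_points P)) r (Z :: nat \<Rightarrow> (int ^ 'n \<Rightarrow> 'k) set set)"
    "Z 0 = orbit_closure P \<tau>" "Z r = orbit_closure P \<sigma>"
    by (rule orbit_closure_chain[OF assms(1) \<tau>(1,2), of r]) (use \<tau>(3) assms(2) in auto)
  then have "r \<in> ?S" by auto
  then show "enat r \<le> (SUP k\<in>?S. enat k)" by (rule SUP_upper)
qed

text \<open>
  A chain between \<open>X\<^sub>\<tau>\<close> and \<open>X\<^sub>\<sigma>\<close> of length greater than one would, prolonged from \<open>\<tau>\<close> down to a vertex,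
  exceed the dimension of \<open>X\<^sub>\<sigma>\<close>.
\<close>

lemma codim_facet_orbit_closure:
  assumes "\<sigma> \<in> faces P" "\<tau> \<in> faces P" "\<tau> \<subset> \<sigma>" "aff_dim \<tau> = aff_dim \<sigma> - 1"
  shows "codim (zariski (lattice_points P)) (orbit_closure P \<sigma> :: (int ^ 'n \<Rightarrow> 'k::field_char_0) set set)
    (orbit_closure P \<tau>) = 1"
proof -
  let ?Z = "zariski (lattice_points P) :: (int ^ 'n \<Rightarrow> 'k) set topology"
  let ?X = "orbit_closure P \<sigma> :: (int ^ 'n \<Rightarrow> 'k) set set"
  let ?Y = "orbit_closure P \<tau> :: (int ^ 'n \<Rightarrow> 'k) set set"
  let ?L = "\<lambda>W. SUP k \<in> {k. \<exists>Z. irr_chain ?Z k Z \<and> Z 0 = W \<and> Z k = ?X}. enat k"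
  have YX: "?Y \<subset> ?X" using orbit_closure_psubset_iff[OF assms(2,1)] assms(3) by blast
  have irr: "irr_closed ?Z ?X" "irr_closed ?Z ?Y" using orbit_closure_irr_closed assms(1,2) by blast+
  have "1 \<le> ?L W" if W: "irr_closed ?Z W" "W \<subseteq> ?Y" for W
  proof -
    have "irr_chain ?Z 1 (\<lambda>i. if i = 0 then W else ?X)"
      using W irr(1) YX by (auto simp: irr_chain_def)
    then have "1 \<in> {k. \<exists>Z. irr_chain ?Z k Z \<and> Z 0 = W \<and> Z k = ?X}"
      by (intro CollectI exI[of _ "\<lambda>i. if i = 0 then W else ?X"]) auto
    then have "enat 1 \<le> ?L W" by (rule SUP_upper)
    then show ?thesis by (simp add: one_enat_def)
  qed
  then have ge: "1 \<le> codim ?Z ?X ?Y" unfolding codim_def by (intro INF_greatest) auto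
  have nonneg: "aff_dim \<tau> \<ge> 0" using face_aff_dim_nonneg assms(2) by blast
  define r where "r = nat (aff_dim \<tau>)"
  have r: "aff_dim \<tau> = int r" "aff_dim \<sigma> = int (Suc r)" using nonneg assms(4) by (auto simp: r_def)
  have "k \<le> 1" if k: "irr_chain ?Z k Z" "Z 0 = ?Y" "Z k = ?X" for k Z
  proof -
    obtain v where v: "v \<in> faces P" "v \<subseteq> \<tau>" "aff_dim v = 0" using face_vertex[OF assms(2)] by blast
    obtain V where V: "irr_chain ?Z r V" "V 0 = orbit_closure P v" "V r = ?Y"
      by (rule orbit_closure_chain[OF assms(2) v(1,2), of r]) (use v(3) r(1) in auto)
    have "irr_chain ?Z (r + k) (\<lambda>i. if i < r then V i else Z (i - r))"
      using irr_chain_append[OF V(1) k(1)] V(3) k(2) by simp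
    then have "r + k \<le> Suc r"
      by (rule chain_length_le_face[OF assms(1) r(2)]) (simp add: k(3))
    then show ?thesis by simp
  qed
  then have "?L ?Y \<le> enat 1" by (intro SUP_least) auto
  moreover have "codim ?Z ?X ?Y \<le> ?L ?Y" unfolding codim_def by (rule INF_lower) (use irr in auto)
  ultimately show ?thesis using ge by (simp add: one_enat_def order_antisym)
qed

lemma irreducible_in_Union:
  assumes "finite F" "irreducible_in T W" "W \<subseteq> \<Union>F" "\<And>C. C \<in> F \<Longrightarrow> closedin T C"
  shows "\<exists>C\<in>F. W \<subseteq> C"
  using assms(1,3,4)
proof (induction F rule: finite_induct)
  case empty
  then show ?case using assms(2) by (simp add: irreducible_in_def)
next
  case (insert C F)
  have "closedin T C" "closedin T (\<Union>F)" using insert by (auto intro: closedin_Union)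
  moreover have "W \<subseteq> C \<union> \<Union>F" using insert.prems by auto
  ultimately have "W \<subseteq> C \<or> W \<subseteq> \<Union>F"
    using assms(2)[unfolded irreducible_in_def, THEN conjunct2, THEN conjunct2, rule_format, of C "\<Union>F"]
    by blast
  then show ?case using insert by blast
qed

text \<open>
  An irreducible subset of \<open>S\<close> lies in a single \<open>X\<^sub>\<tau>\<close>, as there are finitely many faces, and a facet \<open>\<rho>\<close>
  of \<open>\<sigma>\<close> containing \<open>\<tau>\<close> gives the intermediate member \<open>X\<^sub>\<rho>\<close> of a chain of length two.
\<close>

lemma codim_ge_two:
  fixes S :: "(int ^ 'n \<Rightarrow> 'k::field_char_0) set set"
  assumes \<sigma>: "\<sigma> \<in> faces P"
    and S: "\<And>L. L \<in> S \<Longrightarrow> \<exists>\<tau>\<in>faces P. \<tau> \<subseteq> \<sigma> \<and> aff_dim \<tau> < aff_dim \<sigma> - 1 \<and> L \<in> orbit_closure P \<tau>"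
  shows "codim (zariski (lattice_points P)) (orbit_closure P \<sigma>) S \<ge> 2"
  unfolding codim_def
proof (rule INF_greatest)
  let ?Z = "zariski (lattice_points P) :: (int ^ 'n \<Rightarrow> 'k) set topology"
  let ?F = "{\<tau> \<in> faces P. \<tau> \<subseteq> \<sigma> \<and> aff_dim \<tau> < aff_dim \<sigma> - 1}"
  fix W assume "W \<in> {W. irr_closed ?Z W \<and> W \<subseteq> S}"
  then have W: "irr_closed ?Z W" "W \<subseteq> S" by auto
  have "W \<subseteq> \<Union>(orbit_closure P ` ?F)" using W(2) S by blast
  moreover have "finite (orbit_closure P ` ?F :: (int ^ 'n \<Rightarrow> 'k) set set set)" using finite_faces by simp
  moreover have "closedin ?Z C" if "C \<in> orbit_closure P ` ?F" for C
    using that orbit_closure_irr_closed by (auto simp: irr_closed_def)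
  ultimately obtain C where "C \<in> orbit_closure P ` ?F" "W \<subseteq> C"
    using irreducible_in_Union[of "orbit_closure P ` ?F" ?Z W] W(1) by (auto simp: irr_closed_def)
  then obtain \<tau> where \<tau>: "\<tau> \<in> faces P" "\<tau> \<subseteq> \<sigma>" "aff_dim \<tau> < aff_dim \<sigma> - 1" "W \<subseteq> orbit_closure P \<tau>" by blast
  then have "\<tau> \<subset> \<sigma>" by auto
  then obtain \<rho> where \<rho>: "\<rho> \<in> faces P" "\<tau> \<subseteq> \<rho>" "\<rho> \<subset> \<sigma>" "aff_dim \<rho> = aff_dim \<sigma> - 1"
    using facet_between[OF \<sigma> \<tau>(1)] by blast
  have "\<tau> \<subset> \<rho>" using \<rho>(2,4) \<tau>(3) by auto
  then have "W \<subset> orbit_closure P \<rho>" using \<tau>(4) orbit_closure_psubset_iff[OF \<tau>(1) \<rho>(1), where 'k = 'k] by blast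
  moreover have "(orbit_closure P \<rho> :: (int ^ 'n \<Rightarrow> 'k) set set) \<subset> orbit_closure P \<sigma>"
    using orbit_closure_psubset_iff[OF \<rho>(1) \<sigma>] \<rho>(3) by blast
  moreover define Z where "Z i = (if i = 0 then W else if i = 1 then orbit_closure P \<rho> else orbit_closure P \<sigma>)"
    for i :: nat
  ultimately have "irr_chain ?Z 2 Z"
    using W(1) orbit_closure_irr_closed[OF \<rho>(1), where 'k = 'k] orbit_closure_irr_closed[OF \<sigma>, where 'k = 'k]
    by (auto simp: irr_chain_def less_Suc_eq numeral_2_eq_2)
  then have "2 \<in> {k. \<exists>Z. irr_chain ?Z k Z \<and> Z 0 = W \<and> Z k = orbit_closure P \<sigma>}"
    by (intro CollectI exI[of _ Z]) (auto simp: Z_def)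
  then have "enat 2 \<le> (SUP k\<in>{k. \<exists>Z. irr_chain ?Z k Z \<and> Z 0 = W \<and> Z k = orbit_closure P \<sigma>}. enat k)"
    by (rule SUP_upper)
  then show "2 \<le> (SUP k\<in>{k. \<exists>Z. irr_chain ?Z k Z \<and> Z 0 = W \<and> Z k = orbit_closure P \<sigma>}. enat k)"
    by (simp add: numeral_eq_enat)
qed

end

section \<open>Tangent spaces\<close>

text \<open>
  Tangent vectors are computed modulo \<open>z\<^sup>2\<close>: the differential of a monomial at \<open>x\<close> in direction \<open>w\<close> is
  the coefficient of \<open>z\<close> of the monomial at any curve that agrees with \<open>x + z w\<close> to first order.
\<close>

lemma map_const_add:
  "Poly_Mapping.map (\<lambda>c. [:c:]) (p + q) = Poly_Mapping.map (\<lambda>c. [:c:]) p + Poly_Mapping.map (\<lambda>c. [:c:]) q"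
  by (rule poly_mapping_eqI) (simp add: lookup_map_const lookup_add)

lemma map_const_single:
  "Poly_Mapping.map (\<lambda>c. [:c:]) (single a c) = single a [:c:]"
  by (rule poly_mapping_eqI) (simp add: lookup_map_const lookup_single when_def)

lemma coeff_mult_1: "coeff (p * q) (Suc 0) = coeff p 0 * coeff q (Suc 0) + coeff p (Suc 0) * coeff q 0"
  by (simp add: coeff_mult)

lemma coeff_01_power:
  assumes "coeff f 0 = x" "coeff f (Suc 0) = x * u"
  shows "coeff (f ^ k) 0 = x ^ k" "coeff (f ^ k) (Suc 0) = x ^ k * (of_nat k * u :: 'a::comm_ring_1)"
  by (induction k) (auto simp: coeff_mult_0 coeff_mult_1 assms algebra_simps)

lemma coeff_01_prod:
  assumes "\<And>v. v \<in> A \<Longrightarrow> coeff (f v) 0 = b v" "\<And>v. v \<in> A \<Longrightarrow> coeff (f v) (Suc 0) = b v * c v"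
  shows "coeff (\<Prod>v\<in>A. f v) 0 = (\<Prod>v\<in>A. b v)"
    "coeff (\<Prod>v\<in>A. f v) (Suc 0) = (\<Prod>v\<in>A. b v) * (\<Sum>v\<in>A. c v :: 'a::comm_ring_1)"
  using assms
  by (induction A rule: infinite_finite_induct) (auto simp: coeff_mult_0 coeff_mult_1 algebra_simps)

definition log_deriv :: "('v \<Rightarrow> 'a::comm_ring_1) \<Rightarrow> ('v \<Rightarrow>\<^sub>0 nat) \<Rightarrow> 'a" where
  "log_deriv u a = (\<Sum>v\<in>keys a. of_nat (lookup a v) * u v)"

lemma log_deriv_superset:
  assumes "finite A" "keys a \<subseteq> A"
  shows "log_deriv u a = (\<Sum>v \<in> A. of_nat (lookup a v) * u v)"
  unfolding log_deriv_def by (rule sum.mono_neutral_left) (use assms in \<open>auto simp: in_keys_iff\<close>)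

lemma log_deriv_add: "log_deriv u (a + b) = log_deriv u a + log_deriv u b"
proof -
  let ?A = "keys a \<union> keys b"
  show ?thesis
    by (simp add: log_deriv_superset[of ?A] keys_add_nat lookup_add sum.distrib distrib_right)
qed

lemma log_deriv_zero [simp]: "log_deriv u 0 = 0"
  by (simp add: log_deriv_def)

lemma log_deriv_single [simp]: "log_deriv u (single v k) = of_nat k * u v"
  by (cases "k = 0") (auto simp: log_deriv_def)

lemma log_deriv_sum: "log_deriv u (\<Sum>i\<in>I. a i) = (\<Sum>i\<in>I. log_deriv u (a i))"
  by (induction I rule: infinite_finite_induct) (auto simp: log_deriv_add)

text \<open>The product rule in logarithmic form, where the entries of \<open>w\<close> are multiples \<open>u\<close> of those of \<open>x\<close>.\<close>

lemma coeff_1_mon_log: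
  fixes x :: "'v \<Rightarrow> 'k::field"
  assumes "\<And>v. v \<in> keys a \<Longrightarrow> w v = x v * u v"
  shows "coeff (mon a (\<lambda>v. [:x v, w v:])) (Suc 0) = mon a x * log_deriv u a"
  unfolding mon_def log_deriv_def
  by (rule coeff_01_prod(2)[where c = "\<lambda>v. of_nat (lookup a v) * u v"])
    (simp_all add: coeff_01_power[where x = "x v" and u = "u v" for v] assms)

lemma coeff_0_mon: "coeff (mon a Y) 0 = mon a (\<lambda>v. coeff (Y v) 0)"
  using poly_mon[of a Y 0] by (simp add: poly_0_coeff_0)

lemma coeff_01_power_cong:
  assumes "coeff f 0 = coeff g 0" "coeff f (Suc 0) = coeff g (Suc 0)"
  shows "coeff (f ^ k) 0 = coeff (g ^ k) 0 \<and> coeff (f ^ k) (Suc 0) = coeff (g ^ k) (Suc 0)"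
  by (induction k) (auto simp: coeff_mult_0 coeff_mult_1 assms)

lemma coeff_01_prod_cong:
  assumes "\<And>v. v \<in> A \<Longrightarrow> coeff (f v) 0 = coeff (g v) 0 \<and> coeff (f v) (Suc 0) = coeff (g v) (Suc 0)"
  shows "coeff (\<Prod>v\<in>A. f v) 0 = coeff (\<Prod>v\<in>A. g v) 0 \<and>
    coeff (\<Prod>v\<in>A. f v) (Suc 0) = coeff (\<Prod>v\<in>A. g v) (Suc 0)"
  using assms
  by (induction A rule: infinite_finite_induct) (auto simp: coeff_mult_0 coeff_mult_1)

lemma coeff_1_mon_cong:
  assumes "\<And>v. v \<in> keys a \<Longrightarrow>
    coeff (Y v) 0 = coeff (Y' v) 0 \<and> coeff (Y v) (Suc 0) = coeff (Y' v) (Suc 0)"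
  shows "coeff (mon a Y) (Suc 0) = coeff (mon a Y') (Suc 0)"
  unfolding mon_def by (rule coeff_01_prod_cong[THEN conjunct2], rule coeff_01_power_cong)
    (use assms in auto)

lemma differential_eq:
  "differential p x w = (\<Sum>a\<in>keys p.
     lookup p a * coeff (mon a (\<lambda>v. [:x v, w v:])) (Suc 0))"
  unfolding differential_def peval_map_const by (simp add: coeff_sum)

lemma sum_fun_apply: "(\<Sum>i\<in>I. f i) x = (\<Sum>i\<in>I. f i x)"
  for f :: "'i \<Rightarrow> 'v \<Rightarrow> 'b::comm_monoid_add"
  by (induction I rule: infinite_finite_induct) auto

text \<open>
  The entries at \<open>\<psi>\<^sub>i\<close> are, up to scaling, dual to the family \<open>W\<close> and determine the vectors of \<open>T\<close>; so
  \<open>W\<close> is a basis.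
\<close>

lemma dim_dual_coordinates:
  fixes W :: "nat \<Rightarrow> 'v \<Rightarrow> 'k::field" and \<psi> :: "nat \<Rightarrow> 'v"
  assumes dual: "\<And>i l. i \<le> r \<Longrightarrow> l \<le> r \<Longrightarrow> W i (\<psi> l) = 0 \<longleftrightarrow> i \<noteq> l"
    and mem: "\<And>i. i \<le> r \<Longrightarrow> W i \<in> T"
    and expand: "\<And>w v. w \<in> T \<Longrightarrow> w v = (\<Sum>i\<le>r. w (\<psi> i) / W i (\<psi> i) * W i v)"
  shows "vector_space.dim (\<lambda>(c::'k) w v. c * w v) T = Suc r"
proof -
  interpret V: vector_space "\<lambda>(c::'k) (w :: 'v \<Rightarrow> 'k) v. c * w v"
    by unfold_locales (auto simp: fun_eq_iff algebra_simps)
  let ?B = "W ` {..r}"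
  have inj: "inj_on W {..r}"
  proof (rule inj_onI)
    fix i l assume il: "i \<in> {..r}" "l \<in> {..r}" and eq: "W i = W l"
    have "W l (\<psi> l) \<noteq> 0" using dual[of l l] il by simp
    then have "W i (\<psi> l) \<noteq> 0" unfolding eq .
    then show "i = l" using dual[of i l] il by simp
  qed
  have "V.independent ?B"
  proof (rule V.independent_if_scalars_zero)
    fix f b assume 0: "(\<Sum>b\<in>?B. (\<lambda>v. f b * b v)) = 0" and "b \<in> ?B"
    then obtain l where l: "l \<le> r" "b = W l" by auto
    have "0 = (\<Sum>b\<in>?B. (\<lambda>v. f b * b v)) (\<psi> l)" by (simp add: 0)
    also have "\<dots> = (\<Sum>i\<le>r. f (W i) * W i (\<psi> l))"
      by (simp add: sum_fun_apply sum.reindex[OF inj])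
    also have "\<dots> = (\<Sum>i\<in>{l}. f (W i) * W i (\<psi> l))"
      by (rule sum.mono_neutral_right) (use l dual in auto)
    finally show "f b = 0" using l dual[of l l] by simp
  qed simp
  moreover have "V.span ?B = V.span T"
  proof (rule antisym)
    show "V.span ?B \<subseteq> V.span T" by (rule V.span_mono) (use mem in auto)
    have "T \<subseteq> V.span ?B"
    proof
      fix w assume w: "w \<in> T"
      have "w = (\<Sum>i\<le>r. (\<lambda>v. w (\<psi> i) / W i (\<psi> i) * W i v))"
        by (rule ext, unfold sum_fun_apply, rule expand[OF w])
      also have "\<dots> \<in> V.span ?B"
        by (intro V.span_sum V.span_scale V.span_base) auto
      finally show "w \<in> V.span ?B" .
    qed
    then show "V.span T \<subseteq> V.span ?B" by (rule V.span_minimal) (rule V.subspace_span)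
  qed
  ultimately have "V.dim T = card ?B" by (metis V.dim_eq_card)
  then show ?thesis using inj by (simp add: card_image)
qed

context normal_lattice_polytope
begin

abbreviation "tangent_space \<sigma> x \<equiv>
  cone_tangent_space (lattice_points P) (orbit_closure P \<sigma> :: (int ^ 'n \<Rightarrow> 'k::field_char_0) set set) x"

text \<open>
  The differential of a polynomial vanishing on the cone vanishes on \<open>w\<close> as soon as the differentials
  of the monomials at \<open>x\<close> in direction \<open>w\<close> depend on their weights only.
\<close>

lemma tangent_by_weights:
  fixes x w :: "int ^ 'n \<Rightarrow> 'k::field_char_0"
  assumes \<sigma>: "\<sigma> \<in> faces P" and w: "w \<in> coord_space (lattice_points P)"
    and supp: "\<And>v. v \<notin> lattice_points \<sigma> \<Longrightarrow> x v = 0 \<and> w v = 0"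
    and h: "\<And>a. keys a \<subseteq> lattice_points \<sigma> \<Longrightarrow>
      coeff (mon a (\<lambda>v. [:x v, w v:])) (Suc 0) = h a"
    and cong: "\<And>a b. keys a \<subseteq> lattice_points \<sigma> \<Longrightarrow> keys b \<subseteq> lattice_points \<sigma> \<Longrightarrow>
      ewt a = ewt b \<Longrightarrow> h a = h b"
  shows "w \<in> tangent_space \<sigma> x"
  unfolding cone_tangent_space_def
proof (intro CollectI conjI ballI impI)
  show "w \<in> coord_space (lattice_points P)" by (rule w)
  fix p :: "(int ^ 'n, 'k) mpoly"
  assume p: "p \<in> polys_over (lattice_points P)" "\<forall>y\<in>affine_cone (orbit_closure P \<sigma>). peval p y = 0"
  have wc: "weight_coeff \<sigma> p e = 0" for e
    using p(2) orbit_point_in_cone[OF \<sigma>] unfolding affine_cone_orbit_closure[OF \<sigma>]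
    by (intro weight_coeff_zero) blast
  define H where "H e = h (SOME a. keys a \<subseteq> lattice_points \<sigma> \<and> ewt a = e)" for e
  have H: "h a = H (ewt a)" if a: "keys a \<subseteq> lattice_points \<sigma>" for a
  proof -
    define b where "b = (SOME b. keys b \<subseteq> lattice_points \<sigma> \<and> ewt b = ewt a)"
    have "keys b \<subseteq> lattice_points \<sigma> \<and> ewt b = ewt a"
      unfolding b_def by (rule someI[of _ a]) (use a in simp)
    then have "h a = h b" by (intro cong) (use a in auto)
    then show ?thesis by (simp add: H_def b_def)
  qed
  let ?L = "\<lambda>v. [:x v, w v:]"
  let ?K = "{a \<in> keys p. keys a \<subseteq> lattice_points \<sigma>}"
  have "differential p x w = (\<Sum>a\<in>?K. lookup p a * H (ewt a))"
    unfolding differential_eq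
  proof (rule sum.mono_neutral_cong_right)
    show "\<forall>a\<in>keys p - ?K. lookup p a * coeff (mon a ?L) (Suc 0) = 0"
    proof
      fix a assume "a \<in> keys p - ?K"
      then obtain v where "v \<in> keys a" "v \<notin> lattice_points \<sigma>" by blast
      then have "mon a ?L = 0" unfolding mon_eq_0_iff using supp by (intro bexI[of _ v]) auto
      then show "lookup p a * coeff (mon a ?L) (Suc 0) = 0" by simp
    qed
  qed (use h H in auto)
  also have "\<dots> = (\<Sum>e \<in> ewt ` keys p. \<Sum>a \<in> {a \<in> ?K. ewt a = e}.
      lookup p a * H (ewt a))"
    by (rule sum.group[symmetric]) auto
  also have "\<dots> = (\<Sum>e \<in> ewt ` keys p. weight_coeff \<sigma> p e * H e)"
    unfolding weight_coeff_def sum_distrib_right by (intro sum.cong) auto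
  finally show "differential p x w = 0" by (simp add: wc)
qed

lemma tangent_binomial:
  fixes x w :: "int ^ 'n \<Rightarrow> 'k::field_char_0"
  assumes \<sigma>: "\<sigma> \<in> faces P" and w: "w \<in> tangent_space \<sigma> x"
    and ab: "keys a \<subseteq> lattice_points P" "keys b \<subseteq> lattice_points P" "ewt a = ewt b"
  shows "coeff (mon a (\<lambda>v. [:x v, w v:])) (Suc 0) = coeff (mon b (\<lambda>v. [:x v, w v:])) (Suc 0)"
proof -
  define p :: "(int ^ 'n, 'k) mpoly" where "p = single a 1 + single b (-1)"
  have "keys p \<subseteq> {a, b}"
    unfolding p_def using keys_add[of "single a (1::'k)" "single b (-1)"]
    by (auto split: if_splits)
  then have "p \<in> polys_over (lattice_points P)" using ab by (auto simp: polys_over_def)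
  moreover have "peval p y = 0" if y: "y \<in> toric_cone P \<sigma>" for y
    using toric_cone_binomial[OF y ab] unfolding p_def peval_add peval_single by simp
  ultimately have "differential p x w = 0"
    using w unfolding cone_tangent_space_def affine_cone_orbit_closure[OF \<sigma>] by blast
  then show ?thesis
    by (simp add: differential_def p_def map_const_add map_const_single peval_add)
qed

lemma tangent_support:
  fixes x w :: "int ^ 'n \<Rightarrow> 'k::field_char_0"
  assumes \<sigma>: "\<sigma> \<in> faces P" and w: "w \<in> tangent_space \<sigma> x" and v: "v \<notin> lattice_points \<sigma>"
  shows "w v = 0"
proof (cases "v \<in> lattice_points P")
  case False
  then show ?thesis using w by (simp add: cone_tangent_space_def coord_space_def)
next
  case True
  let ?p = "single (single v 1) 1 :: (int ^ 'n, 'k) mpoly"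
  have "?p \<in> polys_over (lattice_points P)" using True by (auto simp: polys_over_def)
  moreover have "peval ?p y = 0" if y: "y \<in> toric_cone P \<sigma>" for y
    using toric_cone_support[OF y, of v] v by auto
  ultimately have "differential ?p x w = 0"
    using w unfolding cone_tangent_space_def affine_cone_orbit_closure[OF \<sigma>] by blast
  then show ?thesis by (simp add: differential_def map_const_single)
qed

end

definition family_monomial :: "(nat \<Rightarrow> 'v) \<Rightarrow> nat set \<Rightarrow> (nat \<Rightarrow> nat) \<Rightarrow> ('v \<Rightarrow>\<^sub>0 nat)" where
  "family_monomial \<psi> I k = (\<Sum>i\<in>I. single (\<psi> i) (k i))"

lemma family_monomial_keys:
  "keys (family_monomial \<psi> I k) \<subseteq> \<psi> ` {i \<in> I. k i \<noteq> 0}"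
  using keys_sum[of "\<lambda>i. single (\<psi> i) (k i)" I]
  by (auto simp: family_monomial_def split: if_splits)

lemma mon_family_monomial: "mon (family_monomial \<psi> I k) x = (\<Prod>i\<in>I. x (\<psi> i) ^ k i)"
  by (simp add: family_monomial_def mon_sum)

lemma log_deriv_family_monomial:
  "log_deriv u (family_monomial \<psi> I k) = (\<Sum>i\<in>I. of_nat (k i) * u (\<psi> i))"
  by (simp add: family_monomial_def log_deriv_sum)

lemma ewt_family_monomial:
  "mdeg (family_monomial \<psi> I k) = (\<Sum>i\<in>I. k i)"
  "wt (family_monomial \<psi> I k) = (\<Sum>i\<in>I. int (k i) *s \<psi> i)"
  by (simp_all add: family_monomial_def mdeg_sum wt_sum)

text \<open>The negative coordinates are moved to the other side, so that both sides are monomials.\<close>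

lemma basis_relation:
  assumes "affine_lattice_basis \<sigma> r \<psi> \<kappa>" "\<xi> \<in> lattice_points \<sigma>"
  shows "ewt (single \<xi> 1 + family_monomial \<psi> {..r} (\<lambda>i. nat (- \<kappa> \<xi> i))) =
    ewt (family_monomial \<psi> {..r} (\<lambda>i. nat (\<kappa> \<xi> i)))"
proof -
  have \<kappa>: "(\<Sum>i\<le>r. \<kappa> \<xi> i) = 1" "(\<Sum>i\<le>r. \<kappa> \<xi> i *s \<psi> i) = \<xi>"
    using assms unfolding affine_lattice_basis_def by blast+
  have n: "int (nat k) - int (nat (- k)) = k" for k by simp
  have "int (\<Sum>i\<le>r. nat (\<kappa> \<xi> i)) - int (\<Sum>i\<le>r. nat (- \<kappa> \<xi> i)) = (\<Sum>i\<le>r. \<kappa> \<xi> i)"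
    unfolding of_nat_sum sum_subtractf[symmetric] n ..
  then have "int (Suc (\<Sum>i\<le>r. nat (- \<kappa> \<xi> i))) = int (\<Sum>i\<le>r. nat (\<kappa> \<xi> i))" using \<kappa>(1) by simp
  then have 1: "Suc (\<Sum>i\<le>r. nat (- \<kappa> \<xi> i)) = (\<Sum>i\<le>r. nat (\<kappa> \<xi> i))" by (simp only: of_nat_eq_iff)
  have "(\<Sum>i\<le>r. int (nat (\<kappa> \<xi> i)) *s \<psi> i) - (\<Sum>i\<le>r. int (nat (- \<kappa> \<xi> i)) *s \<psi> i)
      = (\<Sum>i\<le>r. \<kappa> \<xi> i *s \<psi> i)"
    unfolding sum_subtractf[symmetric] vector_ssub_ldistrib[symmetric]
    by (rule sum.cong) (auto simp: vec_eq_iff simp flip: left_diff_distrib)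
  then have 2: "\<xi> + (\<Sum>i\<le>r. int (nat (- \<kappa> \<xi> i)) *s \<psi> i) = (\<Sum>i\<le>r. int (nat (\<kappa> \<xi> i)) *s \<psi> i)"
    using \<kappa>(2) by (simp add: algebra_simps)
  show ?thesis
    unfolding ewt_def prod.inject mdeg_add wt_add ewt_family_monomial mdeg_single wt_single
    using 1 2 by simp
qed

section \<open>Smoothness in codimension one\<close>

lemma power_nat_split:
  fixes x :: "'k::field"
  assumes "k \<noteq> 0 \<Longrightarrow> x \<noteq> 0"
  shows "x ^ nat k = x powi k * x ^ nat (- k)"
  using assms by (cases "k = 0"; cases "k > 0") (auto simp: power_int_def power_inverse field_simps)

lemma prod_powi:
  fixes x :: "'k::field"
  assumes "x \<noteq> 0"
  shows "(\<Prod>v\<in>A. (x powi k v) ^ n v) = x powi (\<Sum>v\<in>A. int (n v) * k v)"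
proof (induction A rule: infinite_finite_induct)
  case (insert v A)
  have "(x powi k v) ^ n v = x powi (int (n v) * k v)"
    by (simp add: mult.commute[of "int (n v)"] power_int_mult)
  with insert assms show ?case by (simp add: power_int_add)
qed auto

lemma mon_monom:
  "mon a (\<lambda>v. monom (y v) (e v)) = monom (mon a y) (\<Sum>v\<in>keys a. lookup a v * e v)"
proof -
  have "(\<Prod>v\<in>A. monom (y v) (e v) ^ n v) = monom (\<Prod>v\<in>A. y v ^ n v) (\<Sum>v\<in>A. n v * e v)" for A n
    by (induction A rule: infinite_finite_induct) (auto simp: monom_power mult_monom mult.commute)
  then show ?thesis by (simp add: mon_def)
qed

context normal_lattice_polytope
begin

lemma basis_monomials_in_P:
  assumes "\<sigma> \<in> faces P" "affine_lattice_basis \<sigma> r \<psi> \<kappa>" "\<xi> \<in> lattice_points \<sigma>"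
  shows "keys (single \<xi> 1 + family_monomial \<psi> {..r} k) \<subseteq> lattice_points P"
    and "keys (family_monomial \<psi> {..r} k) \<subseteq> lattice_points P"
proof -
  have \<psi>: "\<psi> i \<in> lattice_points P" if "i \<le> r" for i
    using assms(2) that lattice_points_face_subset[OF assms(1)] by (auto simp: affine_lattice_basis_def)
  then show *: "keys (family_monomial \<psi> {..r} k) \<subseteq> lattice_points P"
    using family_monomial_keys[of \<psi> "{..r}" k] by auto
  then show "keys (single \<xi> 1 + family_monomial \<psi> {..r} k) \<subseteq> lattice_points P"
    using assms(3) lattice_points_face_subset[OF assms(1)] by (auto simp: keys_add_nat split: if_splits)
qed

text \<open>
  The relation that expresses \<open>\<xi>\<close> through the basis can be solved for the coordinate at \<open>\<xi>\<close>, and its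
  differential for the entry of a tangent vector at \<open>\<xi>\<close>, where the basis coordinates involved are
  nonzero.
\<close>

lemma cone_point_expansion:
  fixes x :: "int ^ 'n \<Rightarrow> 'k::field_char_0"
  assumes \<sigma>: "\<sigma> \<in> faces P" and basis: "affine_lattice_basis \<sigma> r \<psi> \<kappa>"
    and x: "x \<in> toric_cone P \<sigma>" and \<xi>: "\<xi> \<in> lattice_points \<sigma>"
    and nz: "\<And>i. i \<le> r \<Longrightarrow> \<kappa> \<xi> i \<noteq> 0 \<Longrightarrow> x (\<psi> i) \<noteq> 0"
  shows "x \<xi> = (\<Prod>i\<le>r. x (\<psi> i) powi \<kappa> \<xi> i)"
proof -
  have "mon (single \<xi> 1 + family_monomial \<psi> {..r} (\<lambda>i. nat (- \<kappa> \<xi> i))) x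
      = mon (family_monomial \<psi> {..r} (\<lambda>i. nat (\<kappa> \<xi> i))) x"
    by (rule toric_cone_binomial[OF x basis_monomials_in_P[OF \<sigma> basis \<xi>] basis_relation[OF basis \<xi>]])
  then have "x \<xi> * (\<Prod>i\<le>r. x (\<psi> i) ^ nat (- \<kappa> \<xi> i)) = (\<Prod>i\<le>r. x (\<psi> i) ^ nat (\<kappa> \<xi> i))"
    by (simp add: mon_add mon_family_monomial)
  also have "\<dots> = (\<Prod>i\<le>r. x (\<psi> i) powi \<kappa> \<xi> i * x (\<psi> i) ^ nat (- \<kappa> \<xi> i))"
    by (rule prod.cong) (use nz in \<open>auto intro: power_nat_split\<close>)
  also have "\<dots> = (\<Prod>i\<le>r. x (\<psi> i) powi \<kappa> \<xi> i) * (\<Prod>i\<le>r. x (\<psi> i) ^ nat (- \<kappa> \<xi> i))"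
    by (rule prod.distrib)
  finally have "x \<xi> * (\<Prod>i\<le>r. x (\<psi> i) ^ nat (- \<kappa> \<xi> i)) =
    (\<Prod>i\<le>r. x (\<psi> i) powi \<kappa> \<xi> i) * (\<Prod>i\<le>r. x (\<psi> i) ^ nat (- \<kappa> \<xi> i))" .
  moreover have "(\<Prod>i\<le>r. x (\<psi> i) ^ nat (- \<kappa> \<xi> i)) \<noteq> 0" using nz by (auto simp: nat_eq_iff)
  ultimately show ?thesis by simp
qed

lemma tangent_expansion:
  fixes x w :: "int ^ 'n \<Rightarrow> 'k::field_char_0"
  assumes \<sigma>: "\<sigma> \<in> faces P" and basis: "affine_lattice_basis \<sigma> r \<psi> \<kappa>"
    and x: "x \<in> toric_cone P \<sigma>" and w: "w \<in> tangent_space \<sigma> x" and \<xi>: "\<xi> \<in> lattice_points \<sigma>" "x \<xi> \<noteq> 0"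
    and nz: "\<And>i. i \<le> r \<Longrightarrow> \<kappa> \<xi> i \<noteq> 0 \<Longrightarrow> x (\<psi> i) \<noteq> 0"
  shows "w \<xi> = x \<xi> * (\<Sum>i\<le>r. of_int (\<kappa> \<xi> i) * (w (\<psi> i) / x (\<psi> i)))"
proof -
  let ?u = "\<lambda>v. w v / x v"
  let ?A = "single \<xi> 1 + family_monomial \<psi> {..r} (\<lambda>i. nat (- \<kappa> \<xi> i))"
  let ?B = "family_monomial \<psi> {..r} (\<lambda>i. nat (\<kappa> \<xi> i))"
  have A: "x v \<noteq> 0" if "v \<in> keys ?A" for v
    using that family_monomial_keys[of \<psi> "{..r}" "\<lambda>i. nat (- \<kappa> \<xi> i)"] \<xi>(2) nz
    by (auto simp: keys_add_nat split: if_splits)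
  have B: "x v \<noteq> 0" if "v \<in> keys ?B" for v
    using that family_monomial_keys[of \<psi> "{..r}" "\<lambda>i. nat (\<kappa> \<xi> i)"] nz by auto
  note rel = basis_monomials_in_P[OF \<sigma> basis \<xi>(1)] basis_relation[OF basis \<xi>(1)]
  have "mon ?A x * log_deriv ?u ?A = mon ?B x * log_deriv ?u ?B"
    using tangent_binomial[OF \<sigma> w rel] coeff_1_mon_log[of ?A w x ?u] coeff_1_mon_log[of ?B w x ?u] A B
    by simp
  moreover have "mon ?A x = mon ?B x" by (rule toric_cone_binomial[OF x rel])
  moreover have "mon ?B x \<noteq> 0" using B unfolding mon_eq_0_iff by blast
  ultimately have "log_deriv ?u ?A = log_deriv ?u ?B" by simp
  then have "?u \<xi> = (\<Sum>i\<le>r. of_nat (nat (\<kappa> \<xi> i)) * ?u (\<psi> i)) - (\<Sum>i\<le>r. of_nat (nat (- \<kappa> \<xi> i)) * ?u (\<psi> i))"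
    by (simp add: log_deriv_add log_deriv_family_monomial eq_diff_eq)
  also have "\<dots> = (\<Sum>i\<le>r. of_int (\<kappa> \<xi> i) * ?u (\<psi> i))"
    unfolding sum_subtractf[symmetric]
  proof (rule sum.cong[OF refl])
    fix i
    have "of_nat (nat k) - of_nat (nat (- k)) = (of_int k :: 'k)" for k
      by (cases "k \<ge> 0") (auto simp: of_nat_nat)
    then show "of_nat (nat (\<kappa> \<xi> i)) * ?u (\<psi> i) - of_nat (nat (- \<kappa> \<xi> i)) * ?u (\<psi> i) = of_int (\<kappa> \<xi> i) * ?u (\<psi> i)"
      by (metis left_diff_distrib)
  qed
  finally show ?thesis using \<xi>(2) by (simp add: field_simps)
qed

lemma log_deriv_coord: "log_deriv (\<lambda>v. of_int (\<kappa> v i)) a = of_int (coord \<kappa> a i)"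
  by (simp add: log_deriv_def coord_def)

text \<open>
  The direction in which a one-parameter subgroup of the torus moves \<open>x\<close>: it multiplies each monomial
  by a coordinate of its weight.
\<close>

lemma torus_direction_tangent:
  fixes x :: "int ^ 'n \<Rightarrow> 'k::field_char_0"
  assumes \<sigma>: "\<sigma> \<in> faces P" and basis: "affine_lattice_basis \<sigma> r \<psi> \<kappa>"
    and x: "x \<in> toric_cone P \<sigma>" and i: "i \<le> r"
  shows "(\<lambda>v. of_int (\<kappa> v i) * x v) \<in> tangent_space \<sigma> x"
proof (rule tangent_by_weights[OF \<sigma>])
  show "(\<lambda>v. of_int (\<kappa> v i) * x v) \<in> coord_space (lattice_points P)"
    using toric_cone_coord_space[OF x] by (simp add: coord_space_def)
  show "x v = 0 \<and> of_int (\<kappa> v i) * x v = 0" if "v \<notin> lattice_points \<sigma>" for v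
    using toric_cone_support[OF x, of v] that by auto
  show "coeff (mon a (\<lambda>v. [:x v, of_int (\<kappa> v i) * x v:])) (Suc 0) = mon a x * of_int (coord \<kappa> a i)" for a
    unfolding log_deriv_coord[symmetric] by (rule coeff_1_mon_log) (simp add: mult.commute)
  fix a b :: "int ^ 'n \<Rightarrow>\<^sub>0 nat"
  assume ab: "keys a \<subseteq> lattice_points \<sigma>" "keys b \<subseteq> lattice_points \<sigma>" "ewt a = ewt b"
  have "keys a \<subseteq> lattice_points P" "keys b \<subseteq> lattice_points P"
    using ab lattice_points_face_subset[OF \<sigma>] by auto
  then have "mon a x = mon b x" using ab(3) by (rule toric_cone_binomial[OF x])
  moreover have "coord \<kappa> a i = coord \<kappa> b i" by (rule coord_cong[OF basis ab i])
  ultimately show "mon a x * of_int (coord \<kappa> a i) = mon b x * of_int (coord \<kappa> b i)" by simp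
qed

lemma tangent_dim_open_orbit:
  fixes x :: "int ^ 'n \<Rightarrow> 'k::field_char_0"
  assumes \<sigma>: "\<sigma> \<in> faces P" "aff_dim \<sigma> = int r"
    and x: "x \<in> toric_cone P \<sigma>" "{\<omega>. x \<omega> \<noteq> 0} = lattice_points \<sigma>"
  shows "vector_space.dim (\<lambda>(c::'k) w v. c * w v) (tangent_space \<sigma> x) = Suc r"
proof -
  obtain \<psi> \<kappa> where basis: "affine_lattice_basis \<sigma> r \<psi> \<kappa>" using affine_lattice_basis_exists[OF \<sigma>] by blast
  have \<psi>: "x (\<psi> i) \<noteq> 0" if "i \<le> r" for i
    using basis that x(2) by (auto simp: affine_lattice_basis_def)
  let ?W = "\<lambda>i v. of_int (\<kappa> v i) * x v :: 'k"
  show ?thesis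
  proof (rule dim_dual_coordinates[where W = ?W and \<psi> = \<psi>])
    show "of_int (\<kappa> (\<psi> l) i) * x (\<psi> l) = 0 \<longleftrightarrow> i \<noteq> l" if "i \<le> r" "l \<le> r" for i l
      using \<psi>[OF that(2)] by (simp add: basis_coord_basis[OF basis that])
    show "?W i \<in> tangent_space \<sigma> x" if "i \<le> r" for i
      by (rule torus_direction_tangent[OF \<sigma>(1) basis x(1) that])
    fix w v assume w: "w \<in> tangent_space \<sigma> x"
    show "w v = (\<Sum>i\<le>r. w (\<psi> i) / (of_int (\<kappa> (\<psi> i) i) * x (\<psi> i)) * (of_int (\<kappa> v i) * x v))"
    proof (cases "v \<in> lattice_points \<sigma>")
      case False
      then have "x v = 0" using x(2) by blast
      then show ?thesis using tangent_support[OF \<sigma>(1) w False] by simp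
    next
      case True
      then have "x v \<noteq> 0" using x(2) by auto
      then have "w v = x v * (\<Sum>i\<le>r. of_int (\<kappa> v i) * (w (\<psi> i) / x (\<psi> i)))"
        by (intro tangent_expansion[OF \<sigma>(1) basis x(1) w True] \<psi>)
      also have "\<dots> = (\<Sum>i\<le>r. w (\<psi> i) / (of_int (\<kappa> (\<psi> i) i) * x (\<psi> i)) * (of_int (\<kappa> v i) * x v))"
        unfolding sum_distrib_left by (rule sum.cong) (auto simp: basis_coord_basis[OF basis])
      finally show ?thesis .
    qed
  qed
qed

text \<open>
  At a point of the orbit of a facet \<open>\<tau>\<close>, besides the torus directions, there is the direction normal
  to the orbit: the derivative at \<open>0\<close> of the curve \<open>y\<^sub>v z\<^sup>h\<^sup>(\<^sup>v\<^sup>)\<close>, where \<open>h\<close> is the lattice distance from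
  \<open>\<tau>\<close> and \<open>y\<close> extends \<open>x\<close> multiplicatively.
\<close>

lemma tangent_dim_facet_orbit:
  fixes x :: "int ^ 'n \<Rightarrow> 'k::field_char_0"
  assumes \<sigma>: "\<sigma> \<in> faces P" and \<tau>: "\<tau> \<in> faces P" "\<tau> \<subseteq> \<sigma>" "aff_dim \<tau> = aff_dim \<sigma> - 1"
    and r: "aff_dim \<tau> = int r"
    and x: "x \<in> toric_cone P \<sigma>" "{\<omega>. x \<omega> \<noteq> 0} = lattice_points \<tau>"
  shows "vector_space.dim (\<lambda>(c::'k) w v. c * w v) (tangent_space \<sigma> x) = Suc (Suc r)"
proof -
  obtain \<psi>0 \<kappa>0 where "affine_lattice_basis \<tau> r \<psi>0 \<kappa>0" using affine_lattice_basis_exists[OF \<tau>(1) r] by blast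
  then obtain \<psi> \<kappa> where basis: "affine_lattice_basis \<sigma> (Suc r) \<psi> \<kappa>"
    and \<psi>\<tau>: "\<And>i. i \<le> r \<Longrightarrow> \<psi> i \<in> lattice_points \<tau>"
    and h: "\<And>\<xi>. \<xi> \<in> lattice_points \<sigma> \<Longrightarrow> \<kappa> \<xi> (Suc r) \<ge> 0"
      "\<And>\<xi>. \<xi> \<in> lattice_points \<sigma> \<Longrightarrow> \<kappa> \<xi> (Suc r) = 0 \<longleftrightarrow> \<xi> \<in> lattice_points \<tau>"
    using affine_lattice_basis_step[OF \<sigma> \<tau>] by blast
  have xnz: "x v \<noteq> 0 \<longleftrightarrow> v \<in> lattice_points \<tau>" for v using x(2) by blast
  have \<psi>: "x (\<psi> i) \<noteq> 0" if "i \<le> r" for i using \<psi>\<tau>[OF that] xnz by simp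
  have \<tau>\<sigma>: "lattice_points \<tau> \<subseteq> lattice_points \<sigma>" using \<tau>(2) by (auto simp: mem_lattice_points)
  have \<psi>\<sigma>: "\<psi> i \<in> lattice_points \<sigma>" if "i \<le> Suc r" for i
    using basis that by (simp add: affine_lattice_basis_def)
  have \<kappa>\<psi>: "\<kappa> (\<psi> l) i = (if i = l then 1 else 0)" if "i \<le> Suc r" "l \<le> Suc r" for i l
    by (rule basis_coord_basis[OF basis that])
  have \<psi>R: "x (\<psi> (Suc r)) = 0"
    using h(2)[OF \<psi>\<sigma>[of "Suc r"]] \<kappa>\<psi>[of "Suc r" "Suc r"] xnz by auto
  define y where "y v = (\<Prod>i\<le>r. x (\<psi> i) powi \<kappa> v i)" for v
  have y: "x v = y v" if v: "v \<in> lattice_points \<tau>" for v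
  proof -
    have v': "v \<in> lattice_points \<sigma>" using v \<tau>\<sigma> by blast
    have 0: "\<kappa> v (Suc r) = 0" using h(2)[OF v'] v by simp
    have "x v = (\<Prod>i\<le>Suc r. x (\<psi> i) powi \<kappa> v i)"
      by (rule cone_point_expansion[OF \<sigma> basis x(1) v']) (use 0 \<psi> in \<open>auto simp: le_Suc_eq\<close>)
    then show ?thesis using 0 by (simp add: y_def)
  qed
  define N where "N v = (if v \<in> lattice_points \<sigma> \<and> \<kappa> v (Suc r) = 1 then y v else 0)" for v
  define W where "W i v = (if i = Suc r then N v else of_int (\<kappa> v i) * x v)" for i v
  have "N \<in> tangent_space \<sigma> x"
  proof (rule tangent_by_weights[OF \<sigma>])
    show "N \<in> coord_space (lattice_points P)"
      using lattice_points_face_subset[OF \<sigma>] by (auto simp: coord_space_def N_def)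
    show "x v = 0 \<and> N v = 0" if "v \<notin> lattice_points \<sigma>" for v
      using that \<tau>\<sigma> xnz by (auto simp: N_def)
    fix a :: "int ^ 'n \<Rightarrow>\<^sub>0 nat" assume a: "keys a \<subseteq> lattice_points \<sigma>"
    let ?Y = "\<lambda>v. monom (y v) (nat (\<kappa> v (Suc r)))"
    let ?e = "\<Sum>v\<in>keys a. lookup a v * nat (\<kappa> v (Suc r))"
    have "coeff (mon a (\<lambda>v. [:x v, N v:])) (Suc 0) = coeff (mon a ?Y) (Suc 0)"
    proof (rule coeff_1_mon_cong)
      fix v assume "v \<in> keys a"
      then have v: "v \<in> lattice_points \<sigma>" using a by blast
      have "nat (\<kappa> v (Suc r)) = Suc 0 \<longleftrightarrow> \<kappa> v (Suc r) = 1" by auto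
      moreover have "nat (\<kappa> v (Suc r)) = 0 \<longleftrightarrow> v \<in> lattice_points \<tau>" using h[OF v] by auto
      ultimately show "coeff [:x v, N v:] 0 = coeff (?Y v) 0 \<and> coeff [:x v, N v:] (Suc 0) = coeff (?Y v) (Suc 0)"
        using v y[of v] xnz[of v] by (auto simp: N_def)
    qed
    also have "\<dots> = (if ?e = Suc 0 then mon a y else 0)" by (simp add: mon_monom)
    also have "int ?e = coord \<kappa> a (Suc r)"
      unfolding coord_def of_nat_sum by (rule sum.cong) (use a h(1) in auto)
    then have "?e = Suc 0 \<longleftrightarrow> coord \<kappa> a (Suc r) = 1" by linarith
    also have "mon a y = (\<Prod>v\<in>keys a. \<Prod>i\<le>r. (x (\<psi> i) powi \<kappa> v i) ^ lookup a v)"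
      by (simp add: mon_def y_def prod_power_distrib)
    also have "\<dots> = (\<Prod>i\<le>r. \<Prod>v\<in>keys a. (x (\<psi> i) powi \<kappa> v i) ^ lookup a v)"
      by (rule prod.swap)
    also have "\<dots> = (\<Prod>i\<le>r. x (\<psi> i) powi coord \<kappa> a i)"
      unfolding coord_def by (rule prod.cong) (simp_all add: prod_powi \<psi>)
    finally show "coeff (mon a (\<lambda>v. [:x v, N v:])) (Suc 0) =
      (if coord \<kappa> a (Suc r) = 1 then \<Prod>i\<le>r. x (\<psi> i) powi coord \<kappa> a i else 0)" .
  next
    fix a b :: "int ^ 'n \<Rightarrow>\<^sub>0 nat"
    assume ab: "keys a \<subseteq> lattice_points \<sigma>" "keys b \<subseteq> lattice_points \<sigma>" "ewt a = ewt b"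
    have "coord \<kappa> a i = coord \<kappa> b i" if "i \<le> Suc r" for i by (rule coord_cong[OF basis ab that])
    then show "(if coord \<kappa> a (Suc r) = 1 then \<Prod>i\<le>r. x (\<psi> i) powi coord \<kappa> a i else 0) =
      (if coord \<kappa> b (Suc r) = 1 then \<Prod>i\<le>r. x (\<psi> i) powi coord \<kappa> b i else 0)" by simp
  qed
  have N\<psi>: "N (\<psi> (Suc r)) = 1"
  proof -
    have "y (\<psi> (Suc r)) = (\<Prod>i\<le>r. 1)"
      unfolding y_def by (rule prod.cong) (simp_all add: \<kappa>\<psi>)
    then show ?thesis using \<psi>\<sigma>[of "Suc r"] \<kappa>\<psi>[of "Suc r" "Suc r"] by (simp add: N_def)
  qed
  show ?thesis
  proof (rule dim_dual_coordinates[where W = W and \<psi> = \<psi>])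
    show "W i (\<psi> l) = 0 \<longleftrightarrow> i \<noteq> l" if "i \<le> Suc r" "l \<le> Suc r" for i l
    proof (cases "i = Suc r")
      case True
      then show ?thesis using N\<psi> \<kappa>\<psi>[OF that] by (cases "l = Suc r") (auto simp: W_def N_def)
    next
      case False
      then show ?thesis using \<kappa>\<psi>[OF that] \<psi>[of l] \<psi>R that by (auto simp: W_def le_Suc_eq)
    qed
    show "W i \<in> tangent_space \<sigma> x" if "i \<le> Suc r" for i
      using torus_direction_tangent[OF \<sigma> basis x(1) that] \<open>N \<in> _\<close> by (cases "i = Suc r") (simp_all add: W_def[abs_def])
    fix w v assume w: "w \<in> tangent_space \<sigma> x"
    have WW: "W i (\<psi> i) = x (\<psi> i)" if "i \<le> r" for i using that by (simp add: W_def \<kappa>\<psi>)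
    have sum: "(\<Sum>i\<le>Suc r. w (\<psi> i) / W i (\<psi> i) * W i v)
        = (\<Sum>i\<le>r. w (\<psi> i) / x (\<psi> i) * (of_int (\<kappa> v i) * x v)) + w (\<psi> (Suc r)) * N v"
    proof -
      have "(\<Sum>i\<le>r. w (\<psi> i) / W i (\<psi> i) * W i v) = (\<Sum>i\<le>r. w (\<psi> i) / x (\<psi> i) * (of_int (\<kappa> v i) * x v))"
        by (rule sum.cong) (simp_all add: WW, simp add: W_def)
      moreover have "w (\<psi> (Suc r)) / W (Suc r) (\<psi> (Suc r)) * W (Suc r) v = w (\<psi> (Suc r)) * N v"
        by (simp add: W_def N\<psi>)
      ultimately show ?thesis by simp
    qed
    consider "v \<notin> lattice_points \<sigma>" | "v \<in> lattice_points \<tau>" | "v \<in> lattice_points \<sigma>" "v \<notin> lattice_points \<tau>"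
      by blast
    then have "w v = (\<Sum>i\<le>r. w (\<psi> i) / x (\<psi> i) * (of_int (\<kappa> v i) * x v)) + w (\<psi> (Suc r)) * N v"
    proof cases
      case 1
      then have "x v = 0" using xnz \<tau>\<sigma> by blast
      then show ?thesis using tangent_support[OF \<sigma> w 1] 1 by (simp add: N_def)
    next
      case 2
      then have v: "v \<in> lattice_points \<sigma>" "x v \<noteq> 0" using \<tau>\<sigma> xnz by auto
      have 0: "\<kappa> v (Suc r) = 0" using h(2)[OF v(1)] 2 by simp
      have "w v = x v * (\<Sum>i\<le>Suc r. of_int (\<kappa> v i) * (w (\<psi> i) / x (\<psi> i)))"
        by (rule tangent_expansion[OF \<sigma> basis x(1) w v]) (use 0 \<psi> in \<open>auto simp: le_Suc_eq\<close>)
      also have "\<dots> = (\<Sum>i\<le>r. w (\<psi> i) / x (\<psi> i) * (of_int (\<kappa> v i) * x v))"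
        using 0 by (simp add: sum_distrib_left mult_ac)
      finally show ?thesis using 0 by (simp add: N_def)
    next
      case 3
      let ?L = "\<lambda>v. [:x v, w v:]"
      let ?A = "family_monomial \<psi> {..Suc r} (\<lambda>i. nat (- \<kappa> v i))"
      let ?B = "family_monomial \<psi> {..Suc r} (\<lambda>i. nat (\<kappa> v i))"
      have x0: "x v = 0" using xnz 3(2) by blast
      define k where "k = nat (\<kappa> v (Suc r))"
      have k: "k \<noteq> 0" "nat (- \<kappa> v (Suc r)) = 0" "k = Suc 0 \<longleftrightarrow> \<kappa> v (Suc r) = 1"
        using h[OF 3(1)] 3(2) by (auto simp: k_def)
      have "coeff (mon (single v 1 + ?A) ?L) (Suc 0) = coeff (mon ?B ?L) (Suc 0)"
        by (rule tangent_binomial[OF \<sigma> w basis_monomials_in_P[OF \<sigma> basis 3(1)] basis_relation[OF basis 3(1)]])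
      moreover have "coeff (mon (single v 1 + ?A) ?L) (Suc 0) = w v * (\<Prod>i\<le>r. x (\<psi> i) ^ nat (- \<kappa> v i))"
      proof -
        have "coeff (mon (single v 1 + ?A) ?L) (Suc 0) = w v * coeff (mon ?A ?L) 0"
          by (simp add: mon_add coeff_mult_1 x0)
        also have "coeff (mon ?A ?L) 0 = mon ?A x" by (simp add: coeff_0_mon)
        finally show ?thesis by (simp add: mon_family_monomial k(2))
      qed
      moreover have "coeff (mon ?B ?L) (Suc 0) =
          (\<Prod>i\<le>r. x (\<psi> i) ^ nat (\<kappa> v i)) * (if k = Suc 0 then w (\<psi> (Suc r)) else 0)"
      proof -
        have "?L (\<psi> (Suc r)) = monom (w (\<psi> (Suc r))) 1"
          by (simp add: \<psi>R monom_altdef)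
        then have "?L (\<psi> (Suc r)) ^ k = monom (w (\<psi> (Suc r)) ^ k) k" by (simp add: monom_power)
        then have "mon ?B ?L = (\<Prod>i\<le>r. ?L (\<psi> i) ^ nat (\<kappa> v i)) * monom (w (\<psi> (Suc r)) ^ k) k"
          by (simp add: mon_family_monomial k_def)
        then have "coeff (mon ?B ?L) (Suc 0) = coeff (\<Prod>i\<le>r. ?L (\<psi> i) ^ nat (\<kappa> v i)) 0
            * (if k = Suc 0 then w (\<psi> (Suc r)) else 0)"
          using k(1) by (simp add: coeff_mult_1)
        also have "coeff (\<Prod>i\<le>r. ?L (\<psi> i) ^ nat (\<kappa> v i)) 0 = (\<Prod>i\<le>r. x (\<psi> i) ^ nat (\<kappa> v i))"
          by (simp add: poly_prod flip: poly_0_coeff_0)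
        finally show ?thesis .
      qed
      moreover have "(\<Prod>i\<le>r. x (\<psi> i) ^ nat (\<kappa> v i)) = y v * (\<Prod>i\<le>r. x (\<psi> i) ^ nat (- \<kappa> v i))"
        unfolding y_def prod.distrib[symmetric]
        by (rule prod.cong[OF refl], rule power_nat_split, rule \<psi>) simp
      moreover have "(\<Prod>i\<le>r. x (\<psi> i) ^ nat (- \<kappa> v i)) \<noteq> 0" using \<psi> by simp
      ultimately have "w v = y v * (if k = Suc 0 then w (\<psi> (Suc r)) else 0)" by simp
      then show ?thesis using x0 3(1) k(3) by (simp add: N_def)
    qed
    with sum show "w v = (\<Sum>i\<le>Suc r. w (\<psi> i) / W i (\<psi> i) * W i v)" by simp
  qed
qed

lemma face_psubset_aff_dim:
  assumes "\<sigma> \<in> faces P" "\<tau> \<in> faces P" "\<tau> \<subset> \<sigma>"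
  shows "aff_dim \<tau> < aff_dim \<sigma>"
  using face_of_aff_dim_lt[OF face_convex[OF assms(1)], of \<tau>] face_of_face_iff[OF assms(1), of \<tau>] assms by auto

text \<open>
  On the open orbit and on the orbits of the facets the tangent space has the dimension of the cone,
  so the singular points lie on orbits of codimension at least two.
\<close>

lemma orbit_closure_smooth_in_codim_one:
  assumes \<sigma>: "\<sigma> \<in> faces P"
  shows "smooth_in_codim_one (lattice_points P) (orbit_closure P \<sigma> :: (int ^ 'n \<Rightarrow> 'k::field_char_0) set set)"
  unfolding smooth_in_codim_one_def
proof (rule codim_ge_two[OF \<sigma>])
  fix L :: "(int ^ 'n \<Rightarrow> 'k) set"
  assume "L \<in> {L \<in> orbit_closure P \<sigma>. \<not> smooth_point (lattice_points P) (orbit_closure P \<sigma>) L}"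
  then have L: "L \<in> orbit_closure P \<sigma>" "\<not> smooth_point (lattice_points P) (orbit_closure P \<sigma>) L" by auto
  define r where "r = nat (aff_dim \<sigma>)"
  have r: "aff_dim \<sigma> = int r" using face_aff_dim_nonneg[OF \<sigma>] by (simp add: r_def)
  obtain x where x: "x \<in> L" "enat (vector_space.dim (\<lambda>(c::'k) w v. c * w v) (tangent_space \<sigma> x)) \<noteq> enat r + 1"
    using L(2) unfolding smooth_point_def krull_dim_orbit_closure[OF \<sigma> r] by blast
  have LP: "L \<in> proj_space (lattice_points P)" "L \<subseteq> toric_cone P \<sigma>"
    using L(1) orbit_closure_eq[OF \<sigma>] by blast+
  have xc: "x \<in> toric_cone P \<sigma>" "x \<noteq> (\<lambda>_. 0)" "L = proj_point x" "x \<in> coord_space (lattice_points P)"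
    using x(1) LP proj_space_memD[OF LP(1) x(1)] by blast+
  obtain \<tau> where \<tau>: "\<tau> \<in> faces P" "\<tau> \<subseteq> \<sigma>" "{\<omega>. x \<omega> \<noteq> 0} = lattice_points \<tau>"
    using toric_cone_support_face[OF \<sigma> xc(1,2)] by blast
  have "x \<in> toric_cone P \<tau>" using toric_cone_mono_iff[OF xc(1)] \<tau>(3) by blast
  then have "L \<in> orbit_closure P \<tau>"
    using proj_point_in_orbit_closure_iff[OF \<tau>(1) xc(4,2)] xc(3) by blast
  moreover have "aff_dim \<tau> < aff_dim \<sigma> - 1"
  proof (rule ccontr)
    assume "\<not> aff_dim \<tau> < aff_dim \<sigma> - 1"
    then consider "\<tau> = \<sigma>" | "aff_dim \<tau> = aff_dim \<sigma> - 1"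
      using face_psubset_aff_dim[OF \<sigma> \<tau>(1)] \<tau>(2) by fastforce
    then have "vector_space.dim (\<lambda>(c::'k) w v. c * w v) (tangent_space \<sigma> x) = Suc r"
    proof cases
      case 1
      then show ?thesis using tangent_dim_open_orbit[OF \<sigma> r xc(1)] \<tau>(3) by simp
    next
      case 2
      define s where "s = nat (aff_dim \<tau>)"
      have s: "aff_dim \<tau> = int s" using face_aff_dim_nonneg[OF \<tau>(1)] by (simp add: s_def)
      have "r = Suc s" using 2 s r by simp
      then show ?thesis using tangent_dim_facet_orbit[OF \<sigma> \<tau>(1,2) 2 s xc(1) \<tau>(3)] by simp
    qed
    with x(2) show False by (simp add: one_enat_def)
  qed
  ultimately show "\<exists>\<tau>\<in>faces P. \<tau> \<subseteq> \<sigma> \<and> aff_dim \<tau> < aff_dim \<sigma> - 1 \<and> L \<in> orbit_closure P \<tau>"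
    using \<tau>(1,2) by blast
qed

end

section \<open>Eigenfunctions\<close>

lemma power_int_inverse_minus: "inverse c powi a = c powi (- a)" for c :: "'k::field"
  by (simp add: power_int_minus power_int_inverse)

lemma ext_inverse_torus: "s \<in> ext_torus \<Longrightarrow> ext_inverse s \<in> ext_torus"
  by (auto simp: ext_torus_def ext_inverse_def torus_def)

lemma ext_inverse_inverse: "ext_inverse (ext_inverse s) = s"
  by (cases s) (auto simp: ext_inverse_def vec_eq_iff)

lemma ext_character_inverse: "ext_character \<mu> (ext_inverse s) = ext_character (- fst \<mu>, - snd \<mu>) s"
  by (cases s; cases \<mu>) (simp add: ext_character_def ext_inverse_def character_def power_int_inverse_minus)

lemma orbit_point_translate: "ext_act s (orbit_point \<sigma> (1, \<chi> i. 1)) = orbit_point \<sigma> s"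
  by (cases s) (auto simp: ext_act_def orbit_point_def character_def)

context normal_lattice_polytope
begin

text \<open>
  An eigenfunction restricts to a multiple of a character on the cone over the open orbit; by
  independence of characters one of the monomials of a representing polynomial has the corresponding
  weight, and the eigenfunction is a multiple of this monomial on that cone, hence on its closure.
\<close>

lemma ext_eigenfunction_monomial:
  fixes g :: "(int ^ 'n \<Rightarrow> 'k::field_char_0) \<Rightarrow> 'k"
  assumes "ext_eigenfunction P \<mu> g"
  obtains a C where "keys a \<subseteq> lattice_points P" "C \<noteq> 0"
    "fst \<mu> = - int (mdeg a)" "snd \<mu> = - wt a" "g = restrict (\<lambda>x. C * mon a x) (toric_cone P P)"
proof -
  have cone: "affine_cone (toric_variety P :: (int ^ 'n \<Rightarrow> 'k) set set) = toric_cone P P"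
    by (simp add: toric_variety_eq affine_cone_orbit_closure[OF P_face])
  obtain p where p: "p \<in> polys_over (lattice_points P)" "g = restrict (peval p) (toric_cone P P)"
    using assms unfolding ext_eigenfunction_def coord_ring_def cone by blast
  obtain x0 where x0: "x0 \<in> toric_cone P P" "g x0 \<noteq> 0"
    using assms unfolding ext_eigenfunction_def cone by blast
  have eig: "g (ext_act (ext_inverse s) x) = ext_character \<mu> s * g x"
    if "s \<in> ext_torus" "x \<in> toric_cone P P" for s x
    using assms that unfolding ext_eigenfunction_def cone by blast
  define C where "C = g (orbit_point P (1, \<chi> i. 1))"
  define \<nu> where "\<nu> = (- fst \<mu>, - snd \<mu>)"
  have gp: "g x = peval p x" if "x \<in> toric_cone P P" for x using that p(2) by simp
  have orbit: "peval p (orbit_point P s) = C * ext_character \<nu> s" if s: "s \<in> ext_torus" for s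
  proof -
    have "g (ext_act s (orbit_point P (1, \<chi> i. 1))) = ext_character \<mu> (ext_inverse s) * C"
      using eig[OF ext_inverse_torus[OF s] orbit_point_in_cone[OF P_face one_in_ext_torus(1)]]
      by (simp add: ext_inverse_inverse C_def)
    then show ?thesis
      using gp[OF orbit_point_in_cone[OF P_face s]]
      by (simp add: orbit_point_translate ext_character_inverse \<nu>_def)
  qed
  have C: "C \<noteq> 0"
  proof
    assume "C = 0"
    then have "peval p x0 = 0"
      using orbit by (intro vanish_orbit_imp_vanish_cone[OF p(1) _ x0(1)]) simp
    then show False using x0 gp by simp
  qed
  have "\<nu> \<in> ewt ` keys p"
  proof (rule ccontr)
    assume \<nu>: "\<nu> \<notin> ewt ` keys p"
    define c where "c w = (if w = \<nu> then - C else weight_coeff P p w)" for w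
    have "(\<Sum>w\<in>insert \<nu> (ewt ` keys p). c w * ext_character w s) = 0"
      if s: "s \<in> ext_torus" for s :: "'k \<times> ('k ^ 'n)"
    proof -
      have "(\<Sum>w\<in>ewt ` keys p. c w * ext_character w s)
          = (\<Sum>w\<in>ewt ` keys p. weight_coeff P p w * ext_character w s)"
        by (rule sum.cong) (use \<nu> in \<open>auto simp: c_def\<close>)
      also have "\<dots> = C * ext_character \<nu> s" using peval_orbit_point[OF s, of p P] orbit[OF s] by simp
      finally show ?thesis using \<nu> by (simp add: c_def)
    qed
    then have "\<forall>w\<in>insert \<nu> (ewt ` keys p). c w = 0"
      by (intro ext_characters_independent) auto
    then show False using C by (simp add: c_def)
  qed
  then obtain a where a: "a \<in> keys p" "ewt a = \<nu>" by blast
  have aP: "keys a \<subseteq> lattice_points P" using p(1) a(1) by (simp add: polys_over_def)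
  define q where "q = p + single a (- C)"
  have "q \<in> polys_over (lattice_points P)"
    using p(1) aP keys_add[of p "single a (- C)"]
    by (fastforce simp: q_def polys_over_def split: if_splits)
  moreover have "peval q (orbit_point P s) = 0" if s: "s \<in> ext_torus" for s
    by (simp add: q_def peval_add orbit[OF s] mon_orbit_point[OF s] aP a(2))
  ultimately have "peval q x = 0" if "x \<in> toric_cone P P" for x
    using vanish_orbit_imp_vanish_cone that by blast
  then have "g = restrict (\<lambda>x. C * mon a x) (toric_cone P P)"
    using p(2) by (auto simp: q_def peval_add restrict_def fun_eq_iff)
  moreover have "fst \<mu> = - int (mdeg a)" "snd \<mu> = - wt a" using a(2) by (auto simp: ewt_def \<nu>_def)
  ultimately show thesis using that[OF aP C] by blast
qed

text \<open>
  Multiplying a point of the open orbit by \<open>2\<close> detects the degree.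
\<close>

lemma monomial_homogeneous_iff:
  fixes C :: "'k::field_char_0"
  assumes a: "keys a \<subseteq> lattice_points P" "C \<noteq> 0"
  shows "homogeneous_fun (lattice_points P) (toric_variety P) d (restrict (\<lambda>x. C * mon a x) (toric_cone P P))
    \<longleftrightarrow> d = mdeg a"
proof -
  have cone: "affine_cone (toric_variety P :: (int ^ 'n \<Rightarrow> 'k) set set) = toric_cone P P"
    by (simp add: toric_variety_eq affine_cone_orbit_closure[OF P_face])
  show ?thesis
  proof
    assume "d = mdeg a"
    then obtain p where "p \<in> polys_over (lattice_points P)" "homogeneous d p" "(\<lambda>x. C * mon a x) = peval p"
      using form_mon[OF a(1), of C] by (auto simp: form_def)
    then show "homogeneous_fun (lattice_points P) (toric_variety P) d (restrict (\<lambda>x. C * mon a x) (toric_cone P P))"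
      unfolding homogeneous_fun_def cone by auto
  next
    assume "homogeneous_fun (lattice_points P) (toric_variety P) d (restrict (\<lambda>x. C * mon a x) (toric_cone P P))"
    then obtain p where p: "p \<in> polys_over (lattice_points P)" "homogeneous d p"
      "restrict (\<lambda>x. C * mon a x) (toric_cone P P) = restrict (peval p) (toric_cone P P)"
      unfolding homogeneous_fun_def cone by blast
    have eq: "C * mon a x = peval p x" if "x \<in> toric_cone P P" for x
      using fun_cong[OF p(3), of x] that by simp
    let ?x = "orbit_point P (1, \<chi> i. 1) :: int ^ 'n \<Rightarrow> 'k"
    have x: "?x \<in> toric_cone P P" by (rule orbit_point_in_cone[OF P_face one_in_ext_torus(1)])
    have "mon a ?x \<noteq> 0"
      unfolding mon_eq_0_iff using a(1) orbit_point_nonzero_iff[OF one_in_ext_torus(1)] by blast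
    then have nz: "C * mon a ?x \<noteq> 0" using a(2) by simp
    have "form (lattice_points P) d (peval p)" using p by (auto simp: form_def)
    then have "peval p (\<lambda>v. 2 * ?x v) = 2 ^ d * peval p ?x" by (rule form_scale)
    moreover have "C * mon a (\<lambda>v. 2 * ?x v) = 2 ^ mdeg a * (C * mon a ?x)" by (simp add: mon_scale)
    ultimately have "2 ^ mdeg a * (C * mon a ?x) = 2 ^ d * (C * mon a ?x)"
      using eq[OF x] eq[OF toric_cone_scale[OF x, of 2]] by auto
    then have "(2::'k) powi int (mdeg a) = 2 powi int d" using nz by simp
    then have "int (mdeg a) = int d" by (rule two_powi_inj)
    then show "d = mdeg a" by simp
  qed
qed

text \<open>
  On the orbit of \<open>\<tau>\<close> an eigenfunction of positive degree vanishes nowhere or everywhere, according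
  to whether its normalised weight lies in \<open>\<tau>\<close> or not.
\<close>

lemma eigenfunction_nonvanishing_iff:
  fixes g :: "(int ^ 'n \<Rightarrow> 'k::field_char_0) \<Rightarrow> 'k"
  assumes "ext_eigenfunction P \<mu> g" "toric_degree P g \<ge> 1"
  defines "q \<equiv> (- 1 / real (toric_degree P g)) *\<^sub>R lattice_vec (snd \<mu>)"
  shows "homogeneous_fun (lattice_points P) (toric_variety P) (toric_degree P g) g"
    and "fst \<mu> = - int (toric_degree P g)"
    and "q \<in> P"
    and "g (\<lambda>_. 0) = 0"
    and "\<And>x \<tau>. x \<in> toric_cone P P \<Longrightarrow> \<tau> \<in> faces P \<Longrightarrow> {\<omega>. x \<omega> \<noteq> 0} = lattice_points \<tau> \<Longrightarrow>
      g x \<noteq> 0 \<longleftrightarrow> q \<in> \<tau>"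
proof -
  obtain a C where a: "keys a \<subseteq> lattice_points P" "C \<noteq> 0"
    "fst \<mu> = - int (mdeg a)" "snd \<mu> = - wt a" "g = restrict (\<lambda>x. C * mon a x) (toric_cone P P)"
    using ext_eigenfunction_monomial[OF assms(1)] by blast
  have hom: "homogeneous_fun (lattice_points P) (toric_variety P) d g \<longleftrightarrow> d = mdeg a" for d
    unfolding a(5) by (rule monomial_homogeneous_iff[OF a(1,2)])
  have deg: "toric_degree P g = mdeg a"
    unfolding toric_degree_def fun_degree_def by (rule the_equality) (simp_all add: hom)
  show "homogeneous_fun (lattice_points P) (toric_variety P) (toric_degree P g) g" by (simp add: hom deg)
  show "fst \<mu> = - int (toric_degree P g)" by (simp add: deg a(3))
  have d1: "mdeg a \<ge> 1" using assms(2) by (simp add: deg)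
  have q: "q = (1 / real (mdeg a)) *\<^sub>R lattice_vec (wt a)"
    by (simp add: q_def deg a(4) lattice_vec_def vec_eq_iff)
  show "q \<in> P" unfolding q by (rule wt_average_in[OF convex_P a(1) d1])
  have "keys a \<noteq> {}" using d1 by (auto simp: mdeg_def)
  then have "mon a (\<lambda>_. 0 :: 'k) = 0" unfolding mon_eq_0_iff by blast
  then show "g (\<lambda>_. 0) = 0" using zero_in_toric_cone[of P P, where 'b = 'k] by (simp add: a(5))
  fix x :: "int ^ 'n \<Rightarrow> 'k" and \<tau>
  assume x: "x \<in> toric_cone P P" "\<tau> \<in> faces P" "{\<omega>. x \<omega> \<noteq> 0} = lattice_points \<tau>"
  have "g x \<noteq> 0 \<longleftrightarrow> mon a x \<noteq> 0" using x(1) a(2) by (simp add: a(5))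
  also have "\<dots> \<longleftrightarrow> keys a \<subseteq> lattice_points \<tau>"
    unfolding mon_eq_0_iff x(3)[symmetric] by blast
  also have "\<dots> \<longleftrightarrow> q \<in> \<tau>" unfolding q using wt_average_in_face_iff[OF x(2) a(1) d1] ..
  finally show "g x \<noteq> 0 \<longleftrightarrow> q \<in> \<tau>" .
qed

lemma ext_eigenfunction_imp_torus_eigenfunction:
  assumes "ext_eigenfunction P \<mu> g"
  shows "torus_eigenfunction P (snd \<mu>) g"
proof -
  have "g (ext_act (ext_inverse (1, t)) x) = character (snd \<mu>) t * g x"
    if "t \<in> torus" "x \<in> affine_cone (toric_variety P)" for t x
  proof -
    have "(1, t) \<in> ext_torus" using that(1) by (simp add: ext_torus_iff)
    then have "g (ext_act (ext_inverse (1, t)) x) = ext_character \<mu> (1, t) * g x"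
      using assms that(2) unfolding ext_eigenfunction_def by blast
    then show ?thesis by (cases \<mu>) (simp add: ext_character_def)
  qed
  then show ?thesis using assms unfolding ext_eigenfunction_def torus_eigenfunction_def by blast
qed

section \<open>Covering relations and the stratification\<close>

lemma covered_in_iff:
  "covered_in (faces P) (orbit_closure P :: _ \<Rightarrow> (int ^ 'n \<Rightarrow> 'k::field_char_0) set set) \<tau> \<sigma> \<longleftrightarrow>
    \<tau> \<in> faces P \<and> \<sigma> \<in> faces P \<and> \<tau> \<subset> \<sigma> \<and> aff_dim \<tau> = aff_dim \<sigma> - 1"
proof (cases "\<tau> \<in> faces P \<and> \<sigma> \<in> faces P \<and> \<tau> \<subset> \<sigma>")
  case False
  then show ?thesis using orbit_closure_psubset_iff[of \<tau> \<sigma>, where 'k = 'k] unfolding covered_in_def by blast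
next
  case True
  have psub: "(orbit_closure P \<rho> :: (int ^ 'n \<Rightarrow> 'k) set set) \<subset> orbit_closure P \<rho>' \<longleftrightarrow> \<rho> \<subset> \<rho>'"
    if "\<rho> \<in> faces P" "\<rho>' \<in> faces P" for \<rho> \<rho>' by (rule orbit_closure_psubset_iff[OF that])
  have cov: "covered_in (faces P) (orbit_closure P :: _ \<Rightarrow> (int ^ 'n \<Rightarrow> 'k) set set) \<tau> \<sigma> \<longleftrightarrow>
      \<not> (\<exists>\<rho>\<in>faces P. \<tau> \<subset> \<rho> \<and> \<rho> \<subset> \<sigma>)"
  proof -
    let ?X = "orbit_closure P :: _ \<Rightarrow> (int ^ 'n \<Rightarrow> 'k) set set"
    have "(\<exists>\<rho>\<in>faces P. ?X \<tau> \<subset> ?X \<rho> \<and> ?X \<rho> \<subset> ?X \<sigma>) \<longleftrightarrow> (\<exists>\<rho>\<in>faces P. \<tau> \<subset> \<rho> \<and> \<rho> \<subset> \<sigma>)"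
      by (rule bex_cong) (simp_all only: psub True)
    moreover have "?X \<tau> \<subset> ?X \<sigma>" using psub[of \<tau> \<sigma>] True by simp
    ultimately show ?thesis unfolding covered_in_def using True by simp
  qed
  obtain \<rho> where \<rho>: "\<rho> \<in> faces P" "\<tau> \<subseteq> \<rho>" "\<rho> \<subset> \<sigma>" "aff_dim \<rho> = aff_dim \<sigma> - 1"
    using facet_between True by blast
  show ?thesis
  proof
    assume "covered_in (faces P) (orbit_closure P :: _ \<Rightarrow> (int ^ 'n \<Rightarrow> 'k) set set) \<tau> \<sigma>"
    then have "\<tau> = \<rho>" using cov \<rho> by blast
    then show "\<tau> \<in> faces P \<and> \<sigma> \<in> faces P \<and> \<tau> \<subset> \<sigma> \<and> aff_dim \<tau> = aff_dim \<sigma> - 1" using True \<rho>(4) by simp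
  next
    assume dim: "\<tau> \<in> faces P \<and> \<sigma> \<in> faces P \<and> \<tau> \<subset> \<sigma> \<and> aff_dim \<tau> = aff_dim \<sigma> - 1"
    have False if "\<rho> \<in> faces P" "\<tau> \<subset> \<rho>" "\<rho> \<subset> \<sigma>" for \<rho>
      using face_psubset_aff_dim[OF that(1) _ that(2)] face_psubset_aff_dim[OF _ that(1,3)] dim by simp
    then show "covered_in (faces P) (orbit_closure P :: _ \<Rightarrow> (int ^ 'n \<Rightarrow> 'k) set set) \<tau> \<sigma>"
      using cov by blast
  qed
qed

text \<open>
  The conditions on a stratification that do not involve the functions are properties of the orbit
  closures proved above. What is left are the degrees, (S2) and (S3).
\<close>

lemma orbit_closure_stratification_iff:
  fixes f :: "(real ^ 'n) set \<Rightarrow> (int ^ 'n \<Rightarrow> 'k::field_char_0) \<Rightarrow> 'k"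
  shows "seshadri_stratification (lattice_points P) (toric_variety P) (faces P) (orbit_closure P) f \<longleftrightarrow>
    (\<forall>\<sigma>\<in>faces P. \<exists>d\<ge>1. homogeneous_fun (lattice_points P) (toric_variety P) d (f \<sigma>)) \<and>
    (\<forall>\<sigma>\<in>faces P. \<forall>\<tau>\<in>faces P. \<not> \<tau> \<subseteq> \<sigma> \<longrightarrow> (\<forall>x\<in>toric_cone P \<sigma>. f \<tau> x = 0)) \<and>
    (\<forall>\<sigma>\<in>faces P. {L \<in> orbit_closure P \<sigma>. \<forall>x\<in>L. f \<sigma> x = 0} =
      (\<Union>\<tau>\<in>{\<tau>. covered_in (faces P) (orbit_closure P :: _ \<Rightarrow> (int ^ 'n \<Rightarrow> 'k) set set) \<tau> \<sigma>}. orbit_closure P \<tau>))"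
    (is "_ \<longleftrightarrow> ?R")
proof
  let ?X = "orbit_closure P :: _ \<Rightarrow> (int ^ 'n \<Rightarrow> 'k) set set"
  assume R: ?R
  have "subvariety (lattice_points P) (?X \<sigma>)" if "\<sigma> \<in> faces P" for \<sigma>
    using orbit_closure_irr_closed[OF that] by (simp add: subvariety_def)
  moreover have "?X \<sigma> \<subseteq> ?X P" if "\<sigma> \<in> faces P" for \<sigma>
    using orbit_closure_subset_iff[OF that P_face] face_subset[OF that] by blast
  moreover have "inj_on ?X (faces P)"
    using orbit_closure_eq_iff[where 'k = 'k] by (auto intro: inj_onI)
  moreover have "\<exists>pmax\<in>faces P. (\<forall>p\<in>faces P. (\<forall>q\<in>faces P. \<not> ?X p \<subset> ?X q) \<longleftrightarrow> p = pmax) \<and> ?X pmax = ?X P"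
  proof (rule bexI[OF _ P_face], intro conjI ballI refl)
    fix p assume p: "p \<in> faces P"
    have "(\<forall>q\<in>faces P. \<not> ?X p \<subset> ?X q) \<longleftrightarrow> (\<forall>q\<in>faces P. \<not> p \<subset> q)"
      by (intro ball_cong refl arg_cong[where f = Not] orbit_closure_psubset_iff[OF p])
    also have "\<dots> \<longleftrightarrow> p = P" using P_face face_subset p by blast
    finally show "(\<forall>q\<in>faces P. \<not> ?X p \<subset> ?X q) \<longleftrightarrow> p = P" .
  qed
  moreover have "smooth_in_codim_one (lattice_points P) (?X \<sigma>)" if "\<sigma> \<in> faces P" for \<sigma>
    by (rule orbit_closure_smooth_in_codim_one[OF that])
  moreover have "codim (zariski (lattice_points P)) (?X p) (?X q) = 1" if "covered_in (faces P) ?X q p" for p q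
    using codim_facet_orbit_closure[of p q, where 'k = 'k] that unfolding covered_in_iff by blast
  moreover have "\<forall>x\<in>affine_cone (?X p). f q x = 0" if "p \<in> faces P" "q \<in> faces P" "\<not> ?X q \<subseteq> ?X p" for p q
    using R that orbit_closure_subset_iff[OF that(2,1), where 'k = 'k]
    unfolding affine_cone_orbit_closure[OF that(1)] by blast
  ultimately show "seshadri_stratification (lattice_points P) (toric_variety P) (faces P) ?X f"
    unfolding seshadri_stratification_def using R finite_faces P_face
    by (simp add: toric_variety_eq)
next
  let ?X = "orbit_closure P :: _ \<Rightarrow> (int ^ 'n \<Rightarrow> 'k) set set"
  assume "seshadri_stratification (lattice_points P) (toric_variety P) (faces P) ?X f"
  then have S: "\<forall>\<sigma>\<in>faces P. \<exists>d\<ge>1. homogeneous_fun (lattice_points P) (toric_variety P) d (f \<sigma>)"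
    "\<forall>p\<in>faces P. \<forall>q\<in>faces P. \<not> ?X q \<subseteq> ?X p \<longrightarrow> (\<forall>x\<in>affine_cone (?X p). f q x = 0)"
    "\<forall>\<sigma>\<in>faces P. {L \<in> ?X \<sigma>. \<forall>x\<in>L. f \<sigma> x = 0} = (\<Union>\<tau>\<in>{\<tau>. covered_in (faces P) ?X \<tau> \<sigma>}. ?X \<tau>)"
    unfolding seshadri_stratification_def by simp_all
  have "\<forall>x\<in>toric_cone P \<sigma>. f \<tau> x = 0" if "\<sigma> \<in> faces P" "\<tau> \<in> faces P" "\<not> \<tau> \<subseteq> \<sigma>" for \<sigma> \<tau>
    using S(2) that orbit_closure_subset_iff[OF that(2,1), where 'k = 'k]
    unfolding affine_cone_orbit_closure[OF that(1), symmetric] by blast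
  with S(1,3) show ?R by blast
qed

text \<open>
  The zero locus condition for a single face: the function vanishes on \<open>X\<^sub>\<sigma>\<close> precisely on the orbits
  of the faces of \<open>\<sigma>\<close> missing the normalised weight \<open>q\<close>, and these are the proper faces if and only
  if \<open>q\<close> is in the relative interior of \<open>\<sigma>\<close>.
\<close>

lemma zero_locus_iff:
  fixes g :: "(int ^ 'n \<Rightarrow> 'k::field_char_0) \<Rightarrow> 'k"
  assumes \<sigma>: "\<sigma> \<in> faces P" and q: "q \<in> P"
    and g: "\<And>x \<tau>. x \<in> toric_cone P P \<Longrightarrow> \<tau> \<in> faces P \<Longrightarrow> {\<omega>. x \<omega> \<noteq> 0} = lattice_points \<tau> \<Longrightarrow>
      g x \<noteq> 0 \<longleftrightarrow> q \<in> \<tau>"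
  shows "{L \<in> orbit_closure P \<sigma>. \<forall>x\<in>L. g x = 0} =
      (\<Union>\<tau>\<in>{\<tau>. covered_in (faces P) (orbit_closure P :: _ \<Rightarrow> (int ^ 'n \<Rightarrow> 'k) set set) \<tau> \<sigma>}. orbit_closure P \<tau>)
    \<longleftrightarrow> q \<in> rel_interior \<sigma>" (is "?Z = ?U \<longleftrightarrow> _")
proof -
  have support: "\<exists>\<tau>\<in>faces P. \<tau> \<subseteq> \<rho> \<and> (\<forall>\<rho>'\<in>faces P. L \<in> orbit_closure P \<rho>' \<longleftrightarrow> \<tau> \<subseteq> \<rho>') \<and>
      ((\<forall>x\<in>L. g x = 0) \<longleftrightarrow> q \<notin> \<tau>)" if \<rho>: "\<rho> \<in> faces P" and L: "L \<in> orbit_closure P \<rho>" for L \<rho>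
  proof -
    obtain x where x: "x \<in> toric_cone P \<rho>" "x \<noteq> (\<lambda>_. 0)" "x \<in> coord_space (lattice_points P)" "L = proj_point x"
      using orbit_closureE[OF \<rho> L] by blast
    obtain \<tau> where \<tau>: "\<tau> \<in> faces P" "\<tau> \<subseteq> \<rho>" "{\<omega>. x \<omega> \<noteq> 0} = lattice_points \<tau>"
      using toric_cone_support_face[OF \<rho> x(1,2)] by blast
    have memL: "z \<in> toric_cone P P \<and> {\<omega>. z \<omega> \<noteq> 0} = lattice_points \<tau>" if z: "z \<in> L" for z
    proof -
      obtain c where c: "z = (\<lambda>v. c * x v)" "c \<noteq> 0" using z unfolding x(4) proj_point_def by blast
      have "{\<omega>. x \<omega> \<noteq> 0} \<subseteq> lattice_points P" using \<tau>(3) lattice_points_face_subset[OF \<tau>(1)] by simp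
      then have "x \<in> toric_cone P P" using toric_cone_mono_iff[OF x(1)] by blast
      then show ?thesis using c toric_cone_scale \<tau>(3) by simp
    qed
    have "L \<in> orbit_closure P \<rho>' \<longleftrightarrow> \<tau> \<subseteq> \<rho>'" if \<rho>': "\<rho>' \<in> faces P" for \<rho>'
      unfolding x(4) proj_point_in_orbit_closure_iff[OF \<rho>' x(3,2)] toric_cone_mono_iff[OF x(1)] \<tau>(3)
      by (rule face_subset_iff[OF \<tau>(1) \<rho>', symmetric])
    moreover have "(\<forall>x\<in>L. g x = 0) \<longleftrightarrow> q \<notin> \<tau>"
    proof -
      have "g z = 0 \<longleftrightarrow> q \<notin> \<tau>" if "z \<in> L" for z using g[OF _ \<tau>(1)] memL[OF that] by blast
      moreover have "x \<in> L" by (simp add: x(4) proj_point_self)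
      ultimately show ?thesis by blast
    qed
    ultimately show ?thesis using \<tau>(1,2) by blast
  qed
  have orbit: "\<exists>L\<in>orbit_closure P \<rho>. (\<forall>\<rho>'\<in>faces P. L \<in> orbit_closure P \<rho>' \<longleftrightarrow> \<rho> \<subseteq> \<rho>') \<and>
      ((\<forall>x\<in>L. g x = 0) \<longleftrightarrow> q \<notin> \<rho>)" if \<rho>: "\<rho> \<in> faces P" for \<rho>
  proof -
    let ?x = "orbit_point \<rho> (1, \<chi> i. 1) :: int ^ 'n \<Rightarrow> 'k"
    have x: "?x \<in> toric_cone P \<rho>" "?x \<noteq> (\<lambda>_. 0)"
      using orbit_point_in_cone[OF \<rho> one_in_ext_torus(1)] orbit_point_nonzero[OF \<rho> one_in_ext_torus(1)] by blast+
    have xc: "?x \<in> coord_space (lattice_points P)" by (rule toric_cone_coord_space[OF x(1)])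
    have L: "proj_point ?x \<in> orbit_closure P \<rho>"
      using proj_point_in_orbit_closure_iff[OF \<rho> xc x(2)] x(1) by blast
    obtain \<tau> where \<tau>: "\<tau> \<in> faces P" "\<tau> \<subseteq> \<rho>"
      "\<forall>\<rho>'\<in>faces P. proj_point ?x \<in> orbit_closure P \<rho>' \<longleftrightarrow> \<tau> \<subseteq> \<rho>'"
      "(\<forall>z\<in>proj_point ?x. g z = 0) \<longleftrightarrow> q \<notin> \<tau>"
      using support[OF \<rho> L] by blast
    have "proj_point ?x \<in> orbit_closure P \<tau>" using \<tau>(1,3) by blast
    then have "?x \<in> toric_cone P \<tau>" using proj_point_in_orbit_closure_iff[OF \<tau>(1) xc x(2)] by blast
    then have "{\<omega>. ?x \<omega> \<noteq> 0} \<subseteq> lattice_points \<tau>" using toric_cone_mono_iff[OF x(1)] by blast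
    then have "lattice_points \<rho> \<subseteq> lattice_points \<tau>"
      using orbit_point_nonzero_iff[OF one_in_ext_torus(1), of \<rho>, where 'a = 'k] by blast
    then have "\<rho> = \<tau>" using face_subset_iff[OF \<rho> \<tau>(1)] \<tau>(2) by blast
    with L \<tau> show ?thesis by blast
  qed
  have U: "L \<in> ?U \<longleftrightarrow> (\<exists>\<tau>\<in>faces P. \<tau> \<subset> \<sigma> \<and> L \<in> orbit_closure P \<tau>)" for L
  proof
    assume "\<exists>\<tau>\<in>faces P. \<tau> \<subset> \<sigma> \<and> L \<in> orbit_closure P \<tau>"
    then obtain \<tau> where \<tau>: "\<tau> \<in> faces P" "\<tau> \<subset> \<sigma>" "L \<in> orbit_closure P \<tau>" by blast
    obtain \<rho> where \<rho>: "\<rho> \<in> faces P" "\<tau> \<subseteq> \<rho>" "\<rho> \<subset> \<sigma>" "aff_dim \<rho> = aff_dim \<sigma> - 1"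
      using facet_between[OF \<sigma> \<tau>(1,2)] by blast
    have "L \<in> orbit_closure P \<rho>" using orbit_closure_subset_iff[OF \<tau>(1) \<rho>(1), where 'k = 'k] \<rho>(2) \<tau>(3) by blast
    then show "L \<in> ?U" using \<rho> \<sigma> unfolding covered_in_iff by blast
  qed (auto simp: covered_in_iff)
  show ?thesis
  proof
    assume eq: "?Z = ?U"
    obtain \<tau> where \<tau>: "\<tau> \<in> faces P" "q \<in> rel_interior \<tau>" using rel_interior_face[OF q] by blast
    have q\<tau>: "q \<in> \<tau>" using \<tau>(2) rel_interior_subset by blast
    have "q \<in> \<sigma>"
    proof (rule ccontr)
      assume "q \<notin> \<sigma>"
      obtain L where L: "L \<in> orbit_closure P \<sigma>" "\<forall>\<rho>'\<in>faces P. L \<in> orbit_closure P \<rho>' \<longleftrightarrow> \<sigma> \<subseteq> \<rho>'"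
        "(\<forall>x\<in>L. g x = 0) \<longleftrightarrow> q \<notin> \<sigma>" using orbit[OF \<sigma>] by blast
      then have "L \<in> ?U" using eq \<open>q \<notin> \<sigma>\<close> by blast
      then show False using U L(2) by blast
    qed
    then have "\<tau> \<subseteq> \<sigma>" using face_subset_of_rel_interior[OF \<tau>(1) \<sigma> \<tau>(2)] by blast
    moreover have "\<not> \<tau> \<subset> \<sigma>"
    proof
      assume "\<tau> \<subset> \<sigma>"
      obtain L where L: "L \<in> orbit_closure P \<tau>" "(\<forall>x\<in>L. g x = 0) \<longleftrightarrow> q \<notin> \<tau>" using orbit[OF \<tau>(1)] by blast
      then have "L \<in> ?U" using U \<tau>(1) \<open>\<tau> \<subset> \<sigma>\<close> by blast
      then have "\<forall>x\<in>L. g x = 0" using eq by blast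
      then show False using L(2) q\<tau> by blast
    qed
    ultimately show "q \<in> rel_interior \<sigma>" using \<tau>(2) by blast
  next
    assume qi: "q \<in> rel_interior \<sigma>"
    have proper: "q \<in> \<tau> \<longleftrightarrow> \<tau> = \<sigma>" if "\<tau> \<in> faces P" "\<tau> \<subseteq> \<sigma>" for \<tau>
      using face_subset_of_rel_interior[OF \<sigma> that(1) qi] that(2) qi rel_interior_subset by blast
    have Z: "L \<in> ?Z \<longleftrightarrow> (\<exists>\<tau>\<in>faces P. \<tau> \<subset> \<sigma> \<and> L \<in> orbit_closure P \<tau>)" for L
    proof
      assume L: "L \<in> ?Z"
      then obtain \<tau> where \<tau>: "\<tau> \<in> faces P" "\<tau> \<subseteq> \<sigma>" "\<forall>\<rho>'\<in>faces P. L \<in> orbit_closure P \<rho>' \<longleftrightarrow> \<tau> \<subseteq> \<rho>'"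
        "(\<forall>x\<in>L. g x = 0) \<longleftrightarrow> q \<notin> \<tau>"
        using support[OF \<sigma>, of L] by blast
      then have "\<tau> \<noteq> \<sigma>" using L proper by blast
      with \<tau> show "\<exists>\<tau>\<in>faces P. \<tau> \<subset> \<sigma> \<and> L \<in> orbit_closure P \<tau>" by blast
    next
      assume "\<exists>\<tau>\<in>faces P. \<tau> \<subset> \<sigma> \<and> L \<in> orbit_closure P \<tau>"
      then obtain \<rho> where \<rho>: "\<rho> \<in> faces P" "\<rho> \<subset> \<sigma>" "L \<in> orbit_closure P \<rho>" by blast
      then obtain \<tau> where \<tau>: "\<tau> \<in> faces P" "\<tau> \<subseteq> \<rho>" "\<forall>\<rho>'\<in>faces P. L \<in> orbit_closure P \<rho>' \<longleftrightarrow> \<tau> \<subseteq> \<rho>'"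
        "(\<forall>x\<in>L. g x = 0) \<longleftrightarrow> q \<notin> \<tau>"
        using support[OF \<rho>(1,3)] by blast
      have "q \<notin> \<tau>" using proper[OF \<tau>(1)] \<tau>(2) \<rho>(2) by blast
      then show "L \<in> ?Z" using \<tau> \<rho>(2) \<sigma> by blast
    qed
    show "?Z = ?U" by (rule set_eqI, rule trans[OF Z U[symmetric]])
  qed
qed

end

section \<open>The equivalence\<close>

theorem theorem7p4:
  fixes P :: "(real ^ 'n::finite) set"
    and f :: "(real ^ 'n) set \<Rightarrow> (int ^ 'n \<Rightarrow> 'k::{alg_closed_field, field_char_0}) \<Rightarrow> 'k"
    and \<mu> :: "(real ^ 'n) set \<Rightarrow> int \<times> (int ^ 'n)"
  assumes "lattice_polytope P"
    and "aff_dim P = int CARD('n)"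
    and "normal_polytope P"
    and "\<And>\<sigma>. \<sigma> \<in> faces P \<Longrightarrow> ext_eigenfunction P (\<mu> \<sigma>) (f \<sigma>)"
    and "\<And>\<sigma>. \<sigma> \<in> faces P \<Longrightarrow> toric_degree P (f \<sigma>) \<ge> 1"
  shows "seshadri_stratification (lattice_points P) (toric_variety P) (faces P) (orbit_closure P) f
           \<and> torus_equivariant P (faces P) (orbit_closure P) f
         \<longleftrightarrow> combinatorial_seshadri_stratification P f \<mu>"
proof -
  interpret normal_lattice_polytope P by unfold_locales (fact assms)+
  define q where "q \<sigma> = (- 1 / real (toric_degree P (f \<sigma>))) *\<^sub>R lattice_vec (snd (\<mu> \<sigma>))" for \<sigma>
  note eigen = eigenfunction_nonvanishing_iff[OF assms(4,5), folded q_def]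
  have comb: "combinatorial_seshadri_stratification P f \<mu> \<longleftrightarrow> (\<forall>\<sigma>\<in>faces P. q \<sigma> \<in> rel_interior \<sigma>)"
  proof -
    have "(- 1 / real (toric_degree P (f \<sigma>))) *\<^sub>R
        (real_of_int (fst (\<mu> \<sigma>)), lattice_vec (snd (\<mu> \<sigma>))) = (1, q \<sigma>)" if "\<sigma> \<in> faces P" for \<sigma>
      using eigen(2)[OF that that] assms(5)[OF that] by (simp add: q_def)
    then show ?thesis using assms(4,5) by (simp add: combinatorial_seshadri_stratification_def)
  qed
  have equivariant: "torus_equivariant P (faces P) (orbit_closure P) f"
    unfolding torus_equivariant_def
    using ext_eigenfunction_imp_torus_eigenfunction[OF assms(4)] eigen(1) by blast
  have hom: "\<forall>\<sigma>\<in>faces P. \<exists>d\<ge>1. homogeneous_fun (lattice_points P) (toric_variety P) d (f \<sigma>)"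
    using eigen(1) assms(5) by blast
  have zero: "{L \<in> orbit_closure P \<sigma>. \<forall>x\<in>L. f \<sigma> x = 0} =
      (\<Union>\<tau>\<in>{\<tau>. covered_in (faces P) (orbit_closure P :: _ \<Rightarrow> (int ^ 'n \<Rightarrow> 'k) set set) \<tau> \<sigma>}. orbit_closure P \<tau>)
    \<longleftrightarrow> q \<sigma> \<in> rel_interior \<sigma>" if \<sigma>: "\<sigma> \<in> faces P" for \<sigma>
    by (rule zero_locus_iff[OF \<sigma> eigen(3)[OF \<sigma> \<sigma>] eigen(5)[OF \<sigma> \<sigma>]])
  \<comment> \<open>The normalised weight of \<open>f\<^sub>\<tau>\<close> lies in the relative interior of \<open>\<tau>\<close>, so a face of \<open>\<sigma>\<close>
    that contains it contains \<open>\<tau>\<close>.\<close>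
  have vanish: "f \<tau> x = 0"
    if \<sigma>: "\<sigma> \<in> faces P" and \<tau>: "\<tau> \<in> faces P" "\<not> \<tau> \<subseteq> \<sigma>" "q \<tau> \<in> rel_interior \<tau>" and x: "x \<in> toric_cone P \<sigma>"
    for \<sigma> \<tau> x
  proof (cases "x = (\<lambda>_. 0)")
    case True
    then show ?thesis using eigen(4)[OF \<tau>(1) \<tau>(1)] by simp
  next
    case False
    obtain \<rho> where \<rho>: "\<rho> \<in> faces P" "\<rho> \<subseteq> \<sigma>" "{\<omega>. x \<omega> \<noteq> 0} = lattice_points \<rho>"
      using toric_cone_support_face[OF \<sigma> x False] by blast
    have xP: "x \<in> toric_cone P P"
      using toric_cone_mono_iff[OF x] \<rho>(3) lattice_points_face_subset[OF \<rho>(1)] by blast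
    have "q \<tau> \<notin> \<rho>" using face_subset_of_rel_interior[OF \<tau>(1) \<rho>(1) \<tau>(3)] \<rho>(2) \<tau>(2) by blast
    then show ?thesis using eigen(5)[OF \<tau>(1) \<tau>(1) xP \<rho>(1,3)] by blast
  qed
  have "seshadri_stratification (lattice_points P) (toric_variety P) (faces P) (orbit_closure P) f \<longleftrightarrow>
      (\<forall>\<sigma>\<in>faces P. q \<sigma> \<in> rel_interior \<sigma>)"
  proof
    assume "seshadri_stratification (lattice_points P) (toric_variety P) (faces P) (orbit_closure P) f"
    note S3 = this[unfolded orbit_closure_stratification_iff, THEN conjunct2, THEN conjunct2, rule_format]
    show "\<forall>\<sigma>\<in>faces P. q \<sigma> \<in> rel_interior \<sigma>"
    proof
      fix \<sigma> assume "\<sigma> \<in> faces P"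
      from S3[OF this] show "q \<sigma> \<in> rel_interior \<sigma>" unfolding zero[OF \<open>\<sigma> \<in> faces P\<close>] .
    qed
  next
    assume q: "\<forall>\<sigma>\<in>faces P. q \<sigma> \<in> rel_interior \<sigma>"
    show "seshadri_stratification (lattice_points P) (toric_variety P) (faces P) (orbit_closure P) f"
      unfolding orbit_closure_stratification_iff
    proof (intro conjI hom ballI impI)
      fix \<sigma> \<tau> and x :: "int ^ 'n \<Rightarrow> 'k"
      assume "\<sigma> \<in> faces P" "\<tau> \<in> faces P" "\<not> \<tau> \<subseteq> \<sigma>" "x \<in> toric_cone P \<sigma>"
      with q show "f \<tau> x = 0" by (intro vanish) auto
    next
      fix \<sigma> assume "\<sigma> \<in> faces P"
      then show "{L \<in> orbit_closure P \<sigma>. \<forall>x\<in>L. f \<sigma> x = 0} =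
          (\<Union>\<tau>\<in>{\<tau>. covered_in (faces P) (orbit_closure P :: _ \<Rightarrow> (int ^ 'n \<Rightarrow> 'k) set set) \<tau> \<sigma>}. orbit_closure P \<tau>)"
        using q by (simp only: zero)
    qed
  qed
  with equivariant comb show ?thesis by blast
qed

end
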